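(* Let $\lambda$ be an essentially regular point and let $r_\lambda$ be a real resonance point of a triple $(\lambda,H_0,V)$, $V=F^*JF$. The following assertions are equivalent: (i) $r_\lambda$ has property $S$. (ii) $P_{\lambda+i0}(r_\lambda)P_{\lambda-i0}(r_\lambda)=P_{\lambda+i0}(r_\lambda)$ and $P_{\lambda-i0}(r_\lambda)P_{\lambda+i0}(r_\lambda)=P_{\lambda-i0}(r_\lambda)$. (iii) $\operatorname{im}Q_{\lambda+i0}(r_\lambda)=\operatorname{im}Q_{\lambda-i0}(r_\lambda)$. (iv) $Q_{\lambda+i0}(r_\lambda)Q_{\lambda-i0}(r_\lambda)=Q_{\lambda-i0}(r_\lambda)$ and $Q_{\lambda-i0}(r_\lambda)Q_{\lambda+i0}(r_\lambda)=Q_{\lambda+i0}(r_\lambda)$. (v) $Q_{\lambda-i0}(r_\lambda)JP_{\lambda+i0}(r_\lambda)=JP_{\lambda+i0}(r_\lambda)$. (vi) $Q_{\lambda+i0}(r_\lambda)JP_{\lambda-i0}(r_\lambda)=JP_{\lambda-i0}(r_\lambda)$. (vii) $Q_{\lambda-i0}(r_\lambda)JP_{\lambda+i0}(r_\lambda)=Q_{\lambda-i0}(r_\lambda)J$. (viii) $Q_{\lambda+i0}(r_\lambda)JP_{\lambda-i0}(r_\lambda)=Q_{\lambda+i0}(r_\lambda)J$. (ix) $Q_{\lambda-i0}(r_\lambda)JP_{\lambda+i0}(r_\lambda)=Q_{\lambda+i0}(r_\lambda)JP_{\lambda-i0}(r_\lambda)$.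
   Context: Setting. $\mathcal H,\mathcal K$ are complex separable Hilbert spaces. $F:\mathcal H\to\mathcal K$ is a closed densely defined operator with trivial kernel and co-kernel. $\{H_r=H_0+rV:r\in\mathbb R\}$ is a line of self-adjoint operators on $\mathcal H$, $V=F^*JF$ self-adjoint with $J$ bounded self-adjoint on $\mathcal K$. Standing assumptions: all $H_r$ have a common dense domain $\mathcal D$, $\mathcal D\subset\operatorname{dom}(F)\cap\operatorname{dom}(V)$, $V$ is relatively compact with respect to each $H_r$, and for non-real $z$ the operator $T_z(H_r):=F(H_r-z)^{-1}F^*$ (densely defined on $\operatorname{dom}F^*$) extends to a compact operator on $\mathcal K$, also denoted $T_z(H_r)$. $\Lambda(H_r,F)$ is the set of real $\lambda$ for which the norm limits $T_{\lambda\pm i0}(H_r):=\lim_{y\to0^+}T_{\lambda\pm iy}(H_r)$ exist (assumed of full Lebesgue measure). It is assumed that $\lambda\in\Lambda(H_r,F)$ for some real $r$ (that is, the line is regular at $\lambda$); a real $r$ is non-resonant if $\lambda\in\Lambda(H_r,F)$, otherwise it is a real resonance point of the triple $(\lambda,H_0,V)$. For $z=\lambda\pm i0$ and non-resonant $s$ put $A_z(s)=T_z(H_s)J$ and $B_z(s)=JT_z(H_s)$; as functions of $s$ they extend meromorphically to $\mathbb C$, their real poles being the real resonance points. For such a pole $r_\lambda$: $P_z(r_\lambda)=\frac1{2\pi i}\oint_{C(r_\lambda)}A_z(s)\,ds$ and $Q_z(r_\lambda)=\frac1{2\pi i}\oint_{C(r_\lambda)}B_z(s)\,ds$, with $C(r_\lambda)$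 a small counter-clockwise circle around $r_\lambda$ enclosing no other poles; these are finite-rank idempotents. The point $r_\lambda$ has property $S$ if $\ker P_{\lambda+i0}(r_\lambda)=\ker P_{\lambda-i0}(r_\lambda)$. *)

theory Defs
  imports "HOL-Complex_Analysis.Complex_Analysis"
begin

section \<open>Complex Hilbert spaces\<close>

class complex_normed_vector = real_normed_vector +
  fixes scaleC :: "complex \<Rightarrow> 'a \<Rightarrow> 'a"  (infixr \<open>*\<^sub>C\<close> 75)
  assumes scaleC_add_right: "a *\<^sub>C (x + y) = a *\<^sub>C x + a *\<^sub>C y"
    and scaleC_add_left: "(a + b) *\<^sub>C x = a *\<^sub>C x + b *\<^sub>C x"
    and scaleC_scaleC: "a *\<^sub>C (b *\<^sub>C x) = (a * b) *\<^sub>C x"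
    and scaleC_of_real: "complex_of_real r *\<^sub>C x = r *\<^sub>R x"
    and norm_scaleC: "norm (a *\<^sub>C x) = cmod a * norm x"

text \<open>
  The norm and the real inner product of \<^class>\<open>real_inner\<close> are tied to the complex
  inner product by \<open>Re (cinner x y) = inner x y\<close>, so that \<open>cinner x x = (norm x)\<^sup>2\<close>.
  The inner product is conjugate linear in its first argument.
\<close>

class complex_inner = complex_normed_vector + real_inner +
  fixes cinner :: "'a \<Rightarrow> 'a \<Rightarrow> complex"
  assumes cinner_commute: "cinner x y = cnj (cinner y x)"
    and cinner_add_right: "cinner x (y + z) = cinner x y + cinner x z"
    and cinner_scaleC_right: "cinner x (a *\<^sub>C y) = a * cinner x y"
    and Re_cinner: "Re (cinner x y) = inner x y"

class complex_hilbert = complex_inner + complete_space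

class separable_complex_hilbert = complex_hilbert + second_countable_topology


section \<open>Bounded operators\<close>

text \<open>
  Bounded operators are elements of the library type of bounded real-linear maps (with the
  operator norm), on which complex scalars act pointwise.  Complex linearity is a separate
  predicate.
\<close>

instantiation blinfun :: (real_normed_vector, complex_normed_vector) complex_normed_vector
begin

lift_definition scaleC_blinfun :: "complex \<Rightarrow> 'a \<Rightarrow>\<^sub>L 'b \<Rightarrow> 'a \<Rightarrow>\<^sub>L 'b"
  is "\<lambda>c f x. c *\<^sub>C f x"
proof -
  fix c :: complex and f :: "'a \<Rightarrow> 'b"
  assume "bounded_linear f"
  then interpret f: bounded_linear f .
  obtain K where K: "\<And>x. norm (f x) \<le> norm x * K"
    using f.bounded by blast
  show "bounded_linear (\<lambda>x. c *\<^sub>C f x)"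
  proof (rule bounded_linear_intro[where K = "cmod c * K"])
    show "c *\<^sub>C f (x + y) = c *\<^sub>C f x + c *\<^sub>C f y" for x y
      by (simp add: f.add scaleC_add_right)
    show "c *\<^sub>C f (r *\<^sub>R x) = r *\<^sub>R (c *\<^sub>C f x)" for r x
      by (simp add: f.scaleR scaleC_of_real[symmetric] scaleC_scaleC mult.commute)
    show "norm (c *\<^sub>C f x) \<le> norm x * (cmod c * K)" for x
      using mult_left_mono[OF K[of x], of "cmod c"] by (simp add: norm_scaleC ac_simps)
  qed
qed

instance
proof
  fix a b :: complex and r :: real and x y :: "'a \<Rightarrow>\<^sub>L 'b"
  show "a *\<^sub>C (x + y) = a *\<^sub>C x + a *\<^sub>C y"
    by transfer (simp add: scaleC_add_right)
  show "(a + b) *\<^sub>C x = a *\<^sub>C x + b *\<^sub>C x"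
    by transfer (simp add: scaleC_add_left)
  show "a *\<^sub>C b *\<^sub>C x = (a * b) *\<^sub>C x"
    by transfer (simp add: scaleC_scaleC)
  show "complex_of_real r *\<^sub>C x = r *\<^sub>R x"
    by transfer (simp add: scaleC_of_real)
  have app: "blinfun_apply (c *\<^sub>C z) v = c *\<^sub>C blinfun_apply z v"
    for c v and z :: "'a \<Rightarrow>\<^sub>L 'b"
    by transfer simp
  have le: "norm (c *\<^sub>C z) \<le> cmod c * norm z" for c and z :: "'a \<Rightarrow>\<^sub>L 'b"
  proof (rule norm_blinfun_bound)
    show "norm (blinfun_apply (c *\<^sub>C z) v) \<le> cmod c * norm z * norm v" for v
      using mult_left_mono[OF norm_blinfun[of z v], of "cmod c"]
      by (simp add: app norm_scaleC mult.assoc)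
  qed simp
  show "norm (a *\<^sub>C x) = cmod a * norm x"
  proof (cases "a = 0")
    case True
    then show ?thesis using le[of a x] by simp
  next
    case False
    have one: "(1::complex) *\<^sub>C x = x"
      by (rule blinfun_eqI) (use scaleC_of_real[of 1] in \<open>simp add: app\<close>)
    have "inverse a *\<^sub>C (a *\<^sub>C x) = (inverse a * a) *\<^sub>C x"
      by transfer (simp add: scaleC_scaleC)
    then have "inverse a *\<^sub>C (a *\<^sub>C x) = x"
      using False one by simp
    then have "norm x \<le> cmod (inverse a) * norm (a *\<^sub>C x)"
      using le[of "inverse a" "a *\<^sub>C x"] by simp
    then have "cmod a * norm x \<le> norm (a *\<^sub>C x)"
      using False by (simp add: norm_inverse norm_divide field_simps)
    then show ?thesis using le[of a x] by simp
  qed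
qed

end

definition compact_operator ::
    "('a::complex_normed_vector \<Rightarrow>\<^sub>L 'b::complex_normed_vector) \<Rightarrow> bool" where
  "compact_operator A \<longleftrightarrow>
     (\<forall>c x. blinfun_apply A (c *\<^sub>C x) = c *\<^sub>C blinfun_apply A x) \<and>
     compact (closure (blinfun_apply A ` cball 0 1))"


section \<open>Unbounded operators\<close>

text \<open>
  A possibly unbounded operator is represented by its graph.  Its domain is
  \<^const>\<open>Domain\<close>, the product \<open>S T\<close> on its natural domain is \<open>T O S\<close>, an inverse
  is the converse relation, and \<open>T\<close> is closed iff \<open>closed T\<close>.
\<close>

type_synonym ('a, 'b) op_graph = "('a \<times> 'b) set"

definition graph_of :: "('a::real_normed_vector \<Rightarrow>\<^sub>L 'b::real_normed_vector) \<Rightarrow> ('a, 'b) op_graph" where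
  "graph_of A = {(x, blinfun_apply A x) | x. True}"

definition linear_op :: "('a::complex_normed_vector, 'b::complex_normed_vector) op_graph \<Rightarrow> bool" where
  "linear_op T \<longleftrightarrow> single_valued T \<and> (0, 0) \<in> T \<and>
     (\<forall>x y u v. (x, y) \<in> T \<longrightarrow> (u, v) \<in> T \<longrightarrow> (x + u, y + v) \<in> T) \<and>
     (\<forall>c x y. (x, y) \<in> T \<longrightarrow> (c *\<^sub>C x, c *\<^sub>C y) \<in> T)"

definition densely_defined :: "('a::complex_normed_vector, 'b) op_graph \<Rightarrow> bool" where
  "densely_defined T \<longleftrightarrow> closure (Domain T) = UNIV"

definition op_kernel :: "('a, 'b::complex_normed_vector) op_graph \<Rightarrow> 'a set" where
  "op_kernel T = {x. (x, 0) \<in> T}"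

definition op_adjoint :: "('a::complex_inner, 'b::complex_inner) op_graph \<Rightarrow> ('b, 'a) op_graph" where
  "op_adjoint T = {(y, w). \<forall>(x, v) \<in> T. cinner v y = cinner x w}"

definition self_adjoint :: "('a::complex_inner, 'a) op_graph \<Rightarrow> bool" where
  "self_adjoint T \<longleftrightarrow> linear_op T \<and> densely_defined T \<and> op_adjoint T = T"

text \<open>\<open>op_line H V r\<close> is \<open>H + r V\<close> on \<open>dom H \<inter> dom V\<close>.\<close>

definition op_line ::
    "('a::complex_normed_vector, 'a) op_graph \<Rightarrow> ('a, 'a) op_graph \<Rightarrow> real \<Rightarrow> ('a, 'a) op_graph" where
  "op_line H V r = {(x, y + r *\<^sub>R v) | x y v. (x, y) \<in> H \<and> (x, v) \<in> V}"

definition resolvent ::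
    "('a::complex_normed_vector, 'a) op_graph \<Rightarrow> complex \<Rightarrow> ('a, 'a) op_graph" where
  "resolvent H z = {(x, y - z *\<^sub>C x) | x y. (x, y) \<in> H}\<inverse>"

text \<open>Every sequence that is bounded in the graph norm of \<open>T\<close> has a subsequence whose image
  under \<open>A\<close> converges.\<close>

definition relatively_compact ::
    "('a::complex_normed_vector, 'b::complex_normed_vector) op_graph \<Rightarrow>
     ('a, 'c::complex_normed_vector) op_graph \<Rightarrow> bool" where
  "relatively_compact A T \<longleftrightarrow> Domain T \<subseteq> Domain A \<and>
     (\<forall>u v w. (\<forall>n::nat. (u n, v n) \<in> T \<and> (u n, w n) \<in> A) \<longrightarrow>
        bounded (range u) \<longrightarrow> bounded (range v) \<longrightarrow>
        (\<exists>k l. strict_mono k \<and> (w \<circ> k) \<longlonglongrightarrow> l))"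


section \<open>The sandwiched resolvent and its boundary values\<close>

text \<open>\<open>F (H - z)\<^sup>-\<^sup>1 F\<^sup>*\<close> has a compact extension \<open>C\<close>, unique when the domain of the adjoint is
  dense.\<close>

definition is_sandwiched_resolvent ::
    "('h::complex_inner, 'k::complex_inner) op_graph \<Rightarrow> ('h, 'h) op_graph \<Rightarrow> complex \<Rightarrow>
     ('k \<Rightarrow>\<^sub>L 'k) \<Rightarrow> bool" where
  "is_sandwiched_resolvent F H z C \<longleftrightarrow>
     compact_operator C \<and> op_adjoint F O resolvent H z O F \<subseteq> graph_of C"

definition sandwiched_resolvent ::
    "('h::complex_inner, 'k::complex_inner) op_graph \<Rightarrow> ('h, 'h) op_graph \<Rightarrow> complex \<Rightarrow> ('k \<Rightarrow>\<^sub>L 'k)"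
  where
  "sandwiched_resolvent F H z = (SOME C. is_sandwiched_resolvent F H z C)"

text \<open>From here on a sign \<open>\<sigma> \<in> {1, -1}\<close> selects the boundary point: \<open>\<sigma> = 1\<close> stands for
  \<open>lam + i0\<close> and \<open>\<sigma> = -1\<close> for \<open>lam - i0\<close>.\<close>

definition boundary_resolvent ::
    "('h::complex_inner, 'k::complex_inner) op_graph \<Rightarrow> ('h, 'h) op_graph \<Rightarrow> real \<Rightarrow> real \<Rightarrow> ('k \<Rightarrow>\<^sub>L 'k)"
  where
  "boundary_resolvent F H lam \<sigma> =
     Lim (at_right 0) (\<lambda>y. sandwiched_resolvent F H (Complex lam (\<sigma> * y)))"

definition regular_points ::
    "('h::complex_inner, 'k::complex_inner) op_graph \<Rightarrow> ('h, 'h) op_graph \<Rightarrow> real set" where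
  "regular_points F H =
     {lam. \<forall>\<sigma>\<in>{1, -1}. \<exists>L. ((\<lambda>y. sandwiched_resolvent F H (Complex lam (\<sigma> * y))) \<longlongrightarrow> L) (at_right 0)}"

definition nonresonant_points ::
    "('h::complex_inner, 'k::complex_inner) op_graph \<Rightarrow> ('h, 'h) op_graph \<Rightarrow> ('h, 'h) op_graph \<Rightarrow>
     real \<Rightarrow> real set" where
  "nonresonant_points F H0 V lam = {r. lam \<in> regular_points F (op_line H0 V r)}"

definition resonance_points ::
    "('h::complex_inner, 'k::complex_inner) op_graph \<Rightarrow> ('h, 'h) op_graph \<Rightarrow> ('h, 'h) op_graph \<Rightarrow>
     real \<Rightarrow> real set" where
  "resonance_points F H0 V lam = - nonresonant_points F H0 V lam"

definition essentially_regular ::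
    "('h::complex_inner, 'k::complex_inner) op_graph \<Rightarrow> ('h, 'h) op_graph \<Rightarrow> ('h, 'h) op_graph \<Rightarrow>
     real \<Rightarrow> bool" where
  "essentially_regular F H0 V lam \<longleftrightarrow> (\<exists>r. lam \<in> regular_points F (op_line H0 V r))"


section \<open>Meromorphic functions with values in a complex normed space\<close>

text \<open>These generalize the library notions for \<open>complex \<Rightarrow> complex\<close>, with multiplication
  replaced by scalar multiplication.\<close>

definition complex_differentiable_at ::
    "(complex \<Rightarrow> 'b::complex_normed_vector) \<Rightarrow> complex \<Rightarrow> bool" where
  "complex_differentiable_at f s \<longleftrightarrow>
     (\<exists>D. ((\<lambda>w. inverse (w - s) *\<^sub>C (f w - f s)) \<longlongrightarrow> D) (at s))"

text \<open>\<open>f\<close> is holomorphic off the discrete closed set \<open>S\<close> and has at worst poles in \<open>S\<close>.\<close>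

definition meromorphic_off :: "complex set \<Rightarrow> (complex \<Rightarrow> 'b::complex_normed_vector) \<Rightarrow> bool" where
  "meromorphic_off S f \<longleftrightarrow>
     (\<forall>s. \<not> s islimpt S) \<and>
     (\<forall>s. s \<notin> S \<longrightarrow> complex_differentiable_at f s) \<and>
     (\<forall>s\<in>S. \<exists>n::nat. \<exists>L. ((\<lambda>w. (w - s) ^ n *\<^sub>C f w) \<longlongrightarrow> L) (at s))"

definition is_meromorphic_extension ::
    "real set \<Rightarrow> (real \<Rightarrow> 'b::complex_normed_vector) \<Rightarrow> (complex \<Rightarrow> 'b) \<Rightarrow> bool" where
  "is_meromorphic_extension R f g \<longleftrightarrow>
     (\<exists>S. meromorphic_off S g \<and> (\<forall>s\<in>R. complex_of_real s \<notin> S \<and> g (complex_of_real s) = f s))"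

text \<open>When \<open>R\<close> has an accumulation point in itself, an extension is unique up to its values
  at isolated points, which do not affect residues.  For the functions \<open>A_fun\<close> and \<open>B_fun\<close>
  below, existence is analytic Fredholm theory applied to the second resolvent identity.\<close>

definition meromorphic_extension ::
    "real set \<Rightarrow> (real \<Rightarrow> 'b::complex_normed_vector) \<Rightarrow> complex \<Rightarrow> 'b" where
  "meromorphic_extension R f = (SOME g. is_meromorphic_extension R f g)"

definition has_vector_contour_integral ::
    "(complex \<Rightarrow> 'b::complex_normed_vector) \<Rightarrow> 'b \<Rightarrow> (real \<Rightarrow> complex) \<Rightarrow> bool" where
  "has_vector_contour_integral f i g \<longleftrightarrow>
     ((\<lambda>x. vector_derivative g (at x within {0..1}) *\<^sub>C f (g x)) has_integral i) {0..1}"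

text \<open>As for the library's \<^const>\<open>residue\<close>, this is \<open>(2 \<pi> i)\<^sup>-\<^sup>1\<close> times the integral over
  any sufficiently small circle around \<open>z\<close>.\<close>

definition vector_residue :: "(complex \<Rightarrow> 'b::complex_normed_vector) \<Rightarrow> complex \<Rightarrow> 'b" where
  "vector_residue f z =
     (SOME R. \<exists>e>0. \<forall>\<epsilon>>0. \<epsilon> < e \<longrightarrow>
        has_vector_contour_integral f ((2 * complex_of_real pi * \<i>) *\<^sub>C R) (circlepath z \<epsilon>))"


section \<open>The idempotents \<open>P\<close> and \<open>Q\<close> of a real resonance point\<close>

definition A_fun ::
    "('h::complex_inner, 'k::complex_inner) op_graph \<Rightarrow> ('k \<Rightarrow>\<^sub>L 'k) \<Rightarrow> ('h, 'h) op_graph \<Rightarrow>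
     ('h, 'h) op_graph \<Rightarrow> real \<Rightarrow> real \<Rightarrow> complex \<Rightarrow> ('k \<Rightarrow>\<^sub>L 'k)" where
  "A_fun F J H0 V lam \<sigma> =
     meromorphic_extension (nonresonant_points F H0 V lam)
       (\<lambda>s. boundary_resolvent F (op_line H0 V s) lam \<sigma> o\<^sub>L J)"

definition B_fun ::
    "('h::complex_inner, 'k::complex_inner) op_graph \<Rightarrow> ('k \<Rightarrow>\<^sub>L 'k) \<Rightarrow> ('h, 'h) op_graph \<Rightarrow>
     ('h, 'h) op_graph \<Rightarrow> real \<Rightarrow> real \<Rightarrow> complex \<Rightarrow> ('k \<Rightarrow>\<^sub>L 'k)" where
  "B_fun F J H0 V lam \<sigma> =
     meromorphic_extension (nonresonant_points F H0 V lam)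
       (\<lambda>s. J o\<^sub>L boundary_resolvent F (op_line H0 V s) lam \<sigma>)"

definition P_idem ::
    "('h::complex_inner, 'k::complex_inner) op_graph \<Rightarrow> ('k \<Rightarrow>\<^sub>L 'k) \<Rightarrow> ('h, 'h) op_graph \<Rightarrow>
     ('h, 'h) op_graph \<Rightarrow> real \<Rightarrow> real \<Rightarrow> real \<Rightarrow> ('k \<Rightarrow>\<^sub>L 'k)" where
  "P_idem F J H0 V lam \<sigma> r = vector_residue (A_fun F J H0 V lam \<sigma>) (complex_of_real r)"

definition Q_idem ::
    "('h::complex_inner, 'k::complex_inner) op_graph \<Rightarrow> ('k \<Rightarrow>\<^sub>L 'k) \<Rightarrow> ('h, 'h) op_graph \<Rightarrow>
     ('h, 'h) op_graph \<Rightarrow> real \<Rightarrow> real \<Rightarrow> real \<Rightarrow> ('k \<Rightarrow>\<^sub>L 'k)" where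
  "Q_idem F J H0 V lam \<sigma> r = vector_residue (B_fun F J H0 V lam \<sigma>) (complex_of_real r)"

definition property_S ::
    "('h::complex_inner, 'k::complex_inner) op_graph \<Rightarrow> ('k \<Rightarrow>\<^sub>L 'k) \<Rightarrow> ('h, 'h) op_graph \<Rightarrow>
     ('h, 'h) op_graph \<Rightarrow> real \<Rightarrow> real \<Rightarrow> bool" where
  "property_S F J H0 V lam r \<longleftrightarrow>
     {x. blinfun_apply (P_idem F J H0 V lam 1 r) x = 0} =
     {x. blinfun_apply (P_idem F J H0 V lam (- 1) r) x = 0}"


section \<open>Standing assumptions\<close>

text \<open>The co-kernel of \<open>F\<close> is the orthogonal complement of its range, that is, the kernel of
  its adjoint.\<close>

locale rigged_line =
  fixes F :: "('h::separable_complex_hilbert, 'k::separable_complex_hilbert) op_graph"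
    and J :: "'k \<Rightarrow>\<^sub>L 'k"
    and H0 V :: "('h, 'h) op_graph"
    and \<D> :: "'h set"
  assumes F_operator: "linear_op F" "densely_defined F" "closed F"
    and F_kernel: "op_kernel F = {0}"
    and F_cokernel: "op_kernel (op_adjoint F) = {0}"
    and J_self_adjoint: "self_adjoint (graph_of J)"
    and V_factorization: "V = F O graph_of J O op_adjoint F"
    and V_self_adjoint: "self_adjoint V"
    and H0_self_adjoint: "self_adjoint H0" "Domain H0 = \<D>"
    and line_self_adjoint: "\<And>r. self_adjoint (op_line H0 V r)"
    and line_domain: "\<And>r. Domain (op_line H0 V r) = \<D>"
    and domain_dense: "closure \<D> = UNIV"
    and domain_subset: "\<D> \<subseteq> Domain F \<inter> Domain V"
    and V_relatively_compact: "\<And>r. relatively_compact V (op_line H0 V r)"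
    and sandwiched_resolvent_exists:
      "\<And>r z. z \<notin> \<real> \<Longrightarrow> \<exists>C. is_sandwiched_resolvent F (op_line H0 V r) z C"
    and regular_points_full:
      "\<And>r. AE lam in lebesgue. lam \<in> regular_points F (op_line H0 V r)"

end

theory Submission
  imports Defs
begin

text \<open>
  Let \<open>r\<^sub>0\<close> be non-resonant and \<open>T\<^sub>\<plusminus>\<close> the boundary values of the sandwiched resolvent at
  \<open>r\<^sub>0\<close>.  By the second resolvent identity the continuation of \<open>A\<^sub>\<plusminus>\<close> is
  \<open>K (1 + (s - r\<^sub>0) K)\<^sup>-\<^sup>1\<close> with \<open>K = T\<^sub>\<plusminus> J\<close> compact, so its residue \<open>P\<^sub>\<plusminus>\<close> at \<open>r\<close> is the Riesz
  projection of \<open>1 + (r - r\<^sub>0) K\<close> for the eigenvalue \<open>0\<close>; similarly for \<open>Q\<^sub>\<plusminus>\<close> and \<open>J T\<^sub>\<plusminus>\<close>.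
  Since \<open>T\<^sub>-\<close> is the adjoint of \<open>T\<^sub>+\<close>, this gives that \<open>Q\<^sub>\<minusplus>\<close> is the adjoint of \<open>P\<^sub>\<plusminus>\<close>, and
  \<open>J P\<^sub>\<plusminus> = Q\<^sub>\<plusminus> J\<close>.  The one analytic ingredient beyond this is that \<open>Q\<^sub>\<minusplus> J P\<^sub>\<plusminus>\<close> has the same
  kernel as \<open>P\<^sub>\<plusminus>\<close>, which rests on the semidefiniteness of the imaginary part of \<open>T\<^sub>\<plusminus>\<close>.  Each of the
  conditions then reduces to the equality of the two kernels.
\<close>

section \<open>Complex scalars and bounded operators\<close>

text \<open>Adjunction couples \<open>Pp\<close> only with \<open>Qm\<close>, and \<open>J\<close>
  couples \<open>Pp\<close> only with \<open>Qp\<close>; nothing algebraic relates the kernels of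
  \<open>Pp\<close> and \<open>Pm\<close>. The obstacle is that conditions containing
  \<open>J\<close> could lose information where \<open>J\<close> is degenerate. Positivity excludes
  this on the ranges of the idempotents, because the two boundary values agree on every vector on
  which the imaginary part of the form vanishes.

  Both the extension and the residue are defined by choice, so their uniqueness has to come before
  any integration. To this end \<open>r0\<close> is surrounded by non-resonant points, which feeds
  the identity theorem; the exceptional points of a chosen extension are avoided by taking the
  circle small.

  Inverses and adjoints enter only through the equations that they satisfy. A Riesz projection is
  likewise characterized by nilpotency on its range and invertibility on its kernel, not by an
  integral: commutation, complex linearity and adjointness are then pure algebra, and the integral
  is evaluated once, from an explicit Laurent expansion.\<close>

instance complex_hilbert \<subseteq> banach ..

lemma bounded_bilinear_scaleC:
  "bounded_bilinear (scaleC :: complex \<Rightarrow> 'a::complex_normed_vector \<Rightarrow> 'a)"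
proof
  show "(r *\<^sub>R a) *\<^sub>C b = r *\<^sub>R a *\<^sub>C b" for r a and b :: 'a
    by (simp add: scaleC_of_real[symmetric] scaleC_scaleC scaleR_conv_of_real)
  show "a *\<^sub>C r *\<^sub>R b = r *\<^sub>R a *\<^sub>C b" for r a and b :: 'a
    by (simp add: scaleC_of_real[symmetric] scaleC_scaleC mult.commute)
  show "\<exists>K. \<forall>a. \<forall>b::'a. norm (a *\<^sub>C b) \<le> norm a * norm b * K"
    by (intro exI[of _ 1]) (simp add: norm_scaleC)
qed (auto simp: scaleC_add_left scaleC_add_right)

interpretation scaleC: bounded_bilinear scaleC
  by (rule bounded_bilinear_scaleC)

lemma scaleC_one [simp]: "1 *\<^sub>C x = (x::'a::complex_normed_vector)"
  using scaleC_of_real[of 1 x] by simp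

section \<open>The complex inner product\<close>

lemma cinner_zero_right [simp]: "cinner x 0 = 0"
  using cinner_add_right[of x 0 0] by simp

lemma cinner_minus_right: "cinner x (- y) = - cinner x y"
  using cinner_add_right[of x y "- y"] by (simp add: eq_neg_iff_add_eq_0 add.commute)

lemma cinner_add_left: "cinner (x + y) z = cinner x z + cinner y z"
  by (subst (1 2 3) cinner_commute) (simp add: cinner_add_right)

lemma cinner_scaleC_left: "cinner (a *\<^sub>C x) y = cnj a * cinner x y"
  by (subst (1 2) cinner_commute) (simp add: cinner_scaleC_right)

lemma Im_cinner: "Im (cinner x y) = - inner x (\<i> *\<^sub>C y)"
  by (simp add: Re_cinner[symmetric] cinner_scaleC_right)

lemma cinner_self: "cinner x x = complex_of_real ((norm x)\<^sup>2)"
proof -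
  have "Im (cinner x x) = 0"
    using arg_cong[OF cinner_commute[of x x], of Im] by simp
  then show ?thesis
    by (simp add: complex_eq_iff Re_cinner power2_norm_eq_inner)
qed

lemma bounded_bilinear_cinner:
  "bounded_bilinear (cinner :: 'a::complex_inner \<Rightarrow> 'a \<Rightarrow> complex)"
proof
  show "cinner (r *\<^sub>R a) b = r *\<^sub>R cinner a b" for r and a b :: 'a
    by (simp add: scaleC_of_real[symmetric] cinner_scaleC_left scaleR_conv_of_real)
  show "cinner a (r *\<^sub>R b) = r *\<^sub>R cinner a b" for r and a b :: 'a
    by (simp add: scaleC_of_real[symmetric] cinner_scaleC_right scaleR_conv_of_real)
  show "\<exists>K. \<forall>a b::'a. norm (cinner a b) \<le> norm a * norm b * K"
  proof (intro exI[of _ 2] allI)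
    fix a b :: 'a
    have "norm (cinner a b) \<le> \<bar>Re (cinner a b)\<bar> + \<bar>Im (cinner a b)\<bar>"
      by (rule cmod_le)
    also have "\<dots> \<le> norm a * norm b + norm a * norm (\<i> *\<^sub>C b)"
      unfolding Re_cinner Im_cinner abs_minus_cancel
      by (intro add_mono Cauchy_Schwarz_ineq2)
    finally show "norm (cinner a b) \<le> norm a * norm b * 2"
      by (simp add: norm_scaleC)
  qed
qed (auto simp: cinner_add_left cinner_add_right)

interpretation cinner: bounded_bilinear cinner
  by (rule bounded_bilinear_cinner)

lemma cinner_eq_zeroD: "(\<And>y. cinner y x = 0) \<Longrightarrow> x = 0"
  using cinner_self[of x] by simp

lemma cinner_ext: "(\<And>z. cinner z x = cinner z y) \<Longrightarrow> x = y"
  using cinner_eq_zeroD[of "x - y"] by (simp add: cinner.diff_right)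

text \<open>Orthogonal projection below yields only real orthogonality; on a set closed under
  complex scalars this upgrades it, with c = 1 for the real and c = \<i> for the imaginary
  part.\<close>

lemma inner_imp_cinner_eq_zero:
  fixes x :: "'a::complex_inner"
  assumes "\<And>c. inner x (c *\<^sub>C y) = 0"
  shows "cinner x y = 0"
  using assms[of 1] assms[of \<i>] by (simp add: complex_eq_iff Re_cinner Im_cinner)

section \<open>Complex-linear operators and their powers\<close>

lemma scaleC_blinfun_apply [simp]: "blinfun_apply (c *\<^sub>C A) x = c *\<^sub>C blinfun_apply A x"
  by (simp add: scaleC_blinfun.rep_eq)

interpretation blinfun_compose: bounded_bilinear "(o\<^sub>L)"
  by (rule bounded_bilinear_blinfun_compose)

lemmas op_simps = blinfun.bilinear_simps scaleC.add_left scaleC.add_right scaleC.diff_left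
  scaleC.diff_right scaleC.minus_left scaleC.minus_right scaleC_scaleC

definition clinear_op :: "('a::complex_normed_vector \<Rightarrow>\<^sub>L 'b::complex_normed_vector) \<Rightarrow> bool" where
  "clinear_op A \<longleftrightarrow> (\<forall>c x. A (c *\<^sub>C x) = c *\<^sub>C A x)"

lemma clinear_opD: "clinear_op A \<Longrightarrow> A (c *\<^sub>C x) = c *\<^sub>C A x"
  by (simp add: clinear_op_def)

lemma clinear_op_id: "clinear_op id_blinfun"
  by (simp add: clinear_op_def)

lemma clinear_op_zero: "clinear_op 0"
  by (simp add: clinear_op_def scaleC.zero_right)

lemma clinear_op_compose: "clinear_op A \<Longrightarrow> clinear_op B \<Longrightarrow> clinear_op (A o\<^sub>L B)"
  by (simp add: clinear_op_def)

lemma clinear_op_add: "clinear_op A \<Longrightarrow> clinear_op B \<Longrightarrow> clinear_op (A + B)"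
  by (simp add: clinear_op_def op_simps)

lemma clinear_op_scaleC: "clinear_op A \<Longrightarrow> clinear_op (c *\<^sub>C A)"
  by (simp add: clinear_op_def op_simps mult.commute)

lemma clinear_op_sum: "(\<And>i. i \<in> I \<Longrightarrow> clinear_op (A i)) \<Longrightarrow> clinear_op (\<Sum>i\<in>I. A i)"
  by (induction I rule: infinite_finite_induct) (auto intro: clinear_op_zero clinear_op_add)

lemma clinear_op_tendsto:
  assumes "(f \<longlongrightarrow> A) G" "G \<noteq> bot" "\<forall>\<^sub>F y in G. clinear_op (f y)"
  shows "clinear_op A"
  unfolding clinear_op_def
proof (intro allI)
  fix c x
  have "((\<lambda>y. f y (c *\<^sub>C x)) \<longlongrightarrow> A (c *\<^sub>C x)) G"
    by (intro tendsto_intros assms(1))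
  moreover have "((\<lambda>y. c *\<^sub>C f y x) \<longlongrightarrow> c *\<^sub>C A x) G"
    by (intro scaleC.tendsto tendsto_intros assms(1))
  then have "((\<lambda>y. f y (c *\<^sub>C x)) \<longlongrightarrow> c *\<^sub>C A x) G"
    by (rule tendsto_cong[THEN iffD1, rotated])
      (use assms(3) in eventually_elim, simp add: clinear_op_def)
  ultimately show "A (c *\<^sub>C x) = c *\<^sub>C A x"
    using tendsto_unique[OF assms(2)] by blast
qed

primrec opow :: "('a::real_normed_vector \<Rightarrow>\<^sub>L 'a) \<Rightarrow> nat \<Rightarrow> 'a \<Rightarrow>\<^sub>L 'a" where
  "opow U 0 = id_blinfun"
| "opow U (Suc n) = U o\<^sub>L opow U n"

lemma opow_add: "opow U (m + n) x = opow U m (opow U n x)"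
  by (induction m) auto

lemma opow_commute:
  fixes U A :: "_ \<Rightarrow>\<^sub>L _"
  assumes "\<And>x. A (U x) = U (A x)"
  shows "A (opow U n x) = opow U n (A x)"
  by (induction n) (auto simp: assms)

lemma opow_Suc_right: "opow U (Suc n) x = opow U n (U x)"
  using opow_commute[of U U n x] by simp

lemma clinear_op_opow: "clinear_op U \<Longrightarrow> clinear_op (opow U n)"
  by (induction n) (auto intro: clinear_op_compose clinear_op_id)


section \<open>Orthogonal projection\<close>

text \<open>A minimizing sequence for the distance to \<open>M\<close> is Cauchy, and its limit is
  the foot of the perpendicular. Only the real inner product enters, so the lemma also applies to a
  graph inside a product space.\<close>

lemma orthogonal_decomposition:
  fixes M :: "'a::{real_inner,complete_space} set"
  assumes sub: "subspace M" and cl: "closed M"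
  obtains m u where "m \<in> M" "x = m + u" "\<And>y. y \<in> M \<Longrightarrow> inner u y = 0"
proof -
  define d where "d = infdist x M"
  have ne: "M \<noteq> {}" using sub subspace_0 by blast
  have "\<exists>y\<in>M. dist x y < d + inverse (Suc n)" for n
  proof (rule ccontr)
    assume "\<not> ?thesis"
    then have "d + inverse (Suc n) \<le> infdist x M"
      unfolding infdist_notempty[OF ne] by (intro cINF_greatest ne) (auto simp: not_less)
    then show False by (simp add: d_def)
  qed
  then obtain f where f: "\<And>n. f n \<in> M" "\<And>n. dist x (f n) < d + inverse (Suc n)"
    by metis
  have d0: "d \<ge> 0" unfolding d_def by (rule infdist_nonneg)
  \<comment> \<open>Parallelogram law for x - a and x - b. Half their sum is x minus the midpoint of
    a and b, and the midpoint lies in \<open>M\<close>, hence at distance at least \<open>d\<close>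
    from x.\<close>
  have par: "(norm (a - b))\<^sup>2 \<le> 2 * (norm (x - a))\<^sup>2 + 2 * (norm (x - b))\<^sup>2 - 4 * d\<^sup>2"
    if "a \<in> M" "b \<in> M" for a b
  proof -
    have "(1/2) *\<^sub>R (a + b) \<in> M" using that sub by (simp add: subspace_add subspace_scale)
    then have "d \<le> norm (x - (1/2) *\<^sub>R (a + b))"
      unfolding d_def by (metis infdist_le dist_norm)
    then have "d\<^sup>2 \<le> (norm (x - (1/2) *\<^sub>R (a + b)))\<^sup>2" using d0 by (rule power_mono)
    then show ?thesis
      by (simp add: power2_norm_eq_inner algebra_simps inner_commute)
  qed
  have "Cauchy f"
  proof (rule metric_CauchyI)
    fix e :: real assume e: "e > 0"
    have lim: "(\<lambda>n. 4 * (d + inverse (real (Suc n)))\<^sup>2 - 4 * d\<^sup>2) \<longlonglongrightarrow> 4 * (d + 0)\<^sup>2 - 4 * d\<^sup>2"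
      by (intro tendsto_intros LIMSEQ_inverse_real_of_nat)
    have "\<forall>\<^sub>F n in sequentially. 4 * (d + inverse (real (Suc n)))\<^sup>2 - 4 * d\<^sup>2 < e\<^sup>2"
      using order_tendstoD(2)[OF lim, of "e\<^sup>2"] e by simp
    then obtain N where N: "4 * (d + inverse (real (Suc N)))\<^sup>2 - 4 * d\<^sup>2 < e\<^sup>2"
      using eventually_sequentially by auto
    have "dist (f m) (f n) < e" if "m \<ge> N" "n \<ge> N" for m n
    proof -
      have *: "(norm (x - f k))\<^sup>2 \<le> (d + inverse (real (Suc N)))\<^sup>2" if "k \<ge> N" for k
      proof (rule power_mono)
        have "norm (x - f k) < d + inverse (real (Suc k))"
          using f(2)[of k] by (simp add: dist_norm)
        also have "\<dots> \<le> d + inverse (real (Suc N))"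
          using that by (intro add_left_mono le_imp_inverse_le) auto
        finally show "norm (x - f k) \<le> d + inverse (real (Suc N))" by simp
      qed simp
      have "(norm (f m - f n))\<^sup>2 < e\<^sup>2"
        using par[OF f(1)[of m] f(1)[of n]] *[OF that(1)] *[OF that(2)] N by linarith
      then show ?thesis using e by (simp add: dist_norm power2_less_imp_less)
    qed
    then show "\<exists>N. \<forall>m\<ge>N. \<forall>n\<ge>N. dist (f m) (f n) < e" by blast
  qed
  then obtain m where m: "f \<longlonglongrightarrow> m" using Cauchy_convergent_iff convergent_def by blast
  have mM: "m \<in> M" using closed_sequentially[OF cl _ m] f(1) by blast
  have "dist x m \<le> d"
  proof (rule LIMSEQ_le)
    show "(\<lambda>n. dist x (f n)) \<longlonglongrightarrow> dist x m" by (intro tendsto_intros m)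
    show "(\<lambda>n. d + inverse (real (Suc n))) \<longlonglongrightarrow> d"
      using tendsto_add[OF tendsto_const LIMSEQ_inverse_real_of_nat, of d] by simp
    show "\<exists>N. \<forall>n\<ge>N. dist x (f n) \<le> d + inverse (real (Suc n))" using f(2) less_imp_le by blast
  qed
  have orth: "inner (x - m) y = 0" if y: "y \<in> M" for y
  proof (cases "y = 0")
    case False
    \<comment> \<open>The coefficient of the projection of x - m onto y: moving m by
      \<open>t *\<^sub>R y\<close> would lower the squared distance by exactly the quantity to be
      shown zero.\<close>
    define t where "t = inner (x - m) y / (norm y)\<^sup>2"
    have "m + t *\<^sub>R y \<in> M" using mM y sub by (simp add: subspace_add subspace_scale)
    then have "norm (x - m) \<le> norm (x - (m + t *\<^sub>R y))"
      using infdist_le[of "m + t *\<^sub>R y" M x] \<open>dist x m \<le> d\<close> by (simp add: d_def dist_norm)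
    then have "(norm (x - m))\<^sup>2 \<le> (norm ((x - m) - t *\<^sub>R y))\<^sup>2"
      by (simp add: diff_diff_eq power_mono)
    also have "\<dots> = (norm (x - m))\<^sup>2 - 2 * t * inner (x - m) y + t\<^sup>2 * (norm y)\<^sup>2"
      unfolding power2_norm_eq_inner inner_diff_left[of "x - m" "t *\<^sub>R y"]
        inner_diff_right[of _ "x - m" "t *\<^sub>R y"] inner_scaleR_left inner_scaleR_right
        inner_commute[of y "x - m"] by (simp add: power2_eq_square right_diff_distrib)
    also have "\<dots> = (norm (x - m))\<^sup>2 - (inner (x - m) y)\<^sup>2 / (norm y)\<^sup>2"
      using False by (simp add: t_def power2_eq_square)
    finally have "(inner (x - m) y)\<^sup>2 / (norm y)\<^sup>2 \<le> 0" by simp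
    then show ?thesis using False
      by (simp add: divide_le_0_iff)
  qed simp
  show ?thesis using that[of m "x - m"] mM orth by auto
qed

text \<open>Riesz's lemma with the sharp constant 1, attained in a Hilbert space by a unit vector of
  \<open>N\<close> orthogonal to \<open>M\<close>.\<close>

lemma strict_subspace_orthonormal:
  fixes M N :: "'a::{real_inner,complete_space} set"
  assumes "subspace M" "closed M" "subspace N" "M \<subset> N"
  obtains x where "x \<in> N" "norm x = 1" "\<And>y. y \<in> M \<Longrightarrow> norm (x - y) \<ge> 1"
proof -
  obtain z where z: "z \<in> N" "z \<notin> M" using assms(4) by blast
  obtain m u where m: "m \<in> M" "z = m + u" "\<And>y. y \<in> M \<Longrightarrow> inner u y = 0"
    using orthogonal_decomposition[OF assms(1,2)] by blast
  have u0: "u \<noteq> 0" using z m by auto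
  have uN: "u \<in> N" using subspace_diff[OF assms(3) z(1), of m] m assms(4) by auto
  define x where "x = (1 / norm u) *\<^sub>R u"
  have nx: "norm x = 1" using u0 by (simp add: x_def)
  show ?thesis
  proof (rule that)
    show "x \<in> N" using uN assms(3) by (simp add: x_def subspace_scale)
    show "norm x = 1" by (fact nx)
    show "1 \<le> norm (x - y)" if "y \<in> M" for y
    proof -
      have "inner x y = 0" using m(3)[OF that] by (simp add: x_def)
      then have "(norm (x - y))\<^sup>2 = 1 + (norm y)\<^sup>2"
        using nx by (simp add: power2_norm_eq_inner inner_diff inner_commute norm_eq_1)
      then have "1\<^sup>2 \<le> (norm (x - y))\<^sup>2" by simp
      then show ?thesis by (rule power2_le_imp_le) simp
    qed
  qed
qed

section \<open>Riesz theory of compact operators\<close>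

text \<open>Complex linearity, part of \<open>compact_operator\<close>, is left out here: Riesz
  theory runs over the reals and linearity of the projections is recovered afterwards.\<close>

definition seq_compact_op :: "('a::real_normed_vector \<Rightarrow>\<^sub>L 'b::real_normed_vector) \<Rightarrow> bool" where
  "seq_compact_op A \<longleftrightarrow>
     (\<forall>x::nat \<Rightarrow> 'a. bounded (range x) \<longrightarrow> (\<exists>l r. strict_mono r \<and> (\<lambda>n. A (x (r n))) \<longlonglongrightarrow> l))"

lemma seq_compact_opE:
  fixes A :: "'a::real_normed_vector \<Rightarrow>\<^sub>L 'b::real_normed_vector"
  assumes "seq_compact_op A" "bounded (range (x :: nat \<Rightarrow> 'a))"
  obtains l r where "strict_mono (r :: nat \<Rightarrow> nat)" "(\<lambda>n. A (x (r n))) \<longlonglongrightarrow> l"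
  using assms unfolding seq_compact_op_def by blast

lemma bounded_subseq: "bounded (range x) \<Longrightarrow> bounded (range (\<lambda>n. x (r n)))"
  by (erule bounded_subset) auto

lemma seq_compact_op_compose_right:
  fixes A :: "'a::real_normed_vector \<Rightarrow>\<^sub>L 'b::real_normed_vector"
    and B :: "'c::real_normed_vector \<Rightarrow>\<^sub>L 'a"
  shows "seq_compact_op A \<Longrightarrow> seq_compact_op (A o\<^sub>L B)"
  unfolding seq_compact_op_def
proof (intro allI impI)
  fix x :: "nat \<Rightarrow> 'c"
  assume *: "\<forall>x::nat \<Rightarrow> 'a. bounded (range x) \<longrightarrow> (\<exists>l r. strict_mono r \<and> (\<lambda>n. A (x (r n))) \<longlonglongrightarrow> l)"
    and "bounded (range x)"
  then have "bounded (range (\<lambda>n. B (x n)))"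
    using bounded_linear_image[of "range x" B] blinfun.bounded_linear_right[of B]
    by (simp add: image_image)
  from *[rule_format, OF this]
  show "\<exists>l r. strict_mono r \<and> (\<lambda>n. (A o\<^sub>L B) (x (r n))) \<longlonglongrightarrow> l" by simp
qed

lemma seq_compact_op_compose_left:
  fixes A :: "'a::real_normed_vector \<Rightarrow>\<^sub>L 'b::real_normed_vector"
  assumes "seq_compact_op A"
  shows "seq_compact_op (B o\<^sub>L A)"
  unfolding seq_compact_op_def
proof (intro allI impI)
  fix x :: "nat \<Rightarrow> 'a" assume "bounded (range x)"
  then obtain l r where "strict_mono (r :: nat \<Rightarrow> nat)" "(\<lambda>n. A (x (r n))) \<longlonglongrightarrow> l"
    using seq_compact_opE[OF assms] by metis
  then show "\<exists>l r. strict_mono r \<and> (\<lambda>n. (B o\<^sub>L A) (x (r n))) \<longlonglongrightarrow> l"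
    by (intro exI[of _ "B l"] exI[of _ r]) (auto intro!: tendsto_intros)
qed

lemma seq_compact_op_add:
  fixes A :: "'a::real_normed_vector \<Rightarrow>\<^sub>L 'b::real_normed_vector"
  assumes "seq_compact_op A" "seq_compact_op B"
  shows "seq_compact_op (A + B)"
  unfolding seq_compact_op_def
proof (intro allI impI)
  fix x :: "nat \<Rightarrow> 'a" assume x: "bounded (range x)"
  then obtain l r where r: "strict_mono (r :: nat \<Rightarrow> nat)" "(\<lambda>n. A (x (r n))) \<longlonglongrightarrow> l"
    using seq_compact_opE[OF assms(1)] by metis
  obtain l' r' where r': "strict_mono (r' :: nat \<Rightarrow> nat)" "(\<lambda>n. B (x (r (r' n)))) \<longlonglongrightarrow> l'"
    using seq_compact_opE[OF assms(2) bounded_subseq[OF x, of r]] by metis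
  have "(\<lambda>n. A (x (r (r' n)))) \<longlonglongrightarrow> l"
    using LIMSEQ_subseq_LIMSEQ[OF r(2) r'(1)] by (simp add: o_def)
  then show "\<exists>l r. strict_mono r \<and> (\<lambda>n. (A + B) (x (r n))) \<longlonglongrightarrow> l"
    using r'(2) strict_mono_o[OF r(1) r'(1)]
    by (intro exI[of _ "l + l'"] exI[of _ "r \<circ> r'"]) (auto simp: blinfun.add_left intro!: tendsto_intros)
qed

lemma seq_compact_op_scaleC:
  fixes A :: "'a::complex_normed_vector \<Rightarrow>\<^sub>L 'b::complex_normed_vector"
  assumes "seq_compact_op A"
  shows "seq_compact_op (c *\<^sub>C A)"
  unfolding seq_compact_op_def
proof (intro allI impI)
  fix x :: "nat \<Rightarrow> 'a" assume "bounded (range x)"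
  then obtain l r where "strict_mono (r :: nat \<Rightarrow> nat)" "(\<lambda>n. A (x (r n))) \<longlonglongrightarrow> l"
    using seq_compact_opE[OF assms] by metis
  then show "\<exists>l r. strict_mono r \<and> (\<lambda>n. (c *\<^sub>C A) (x (r n))) \<longlonglongrightarrow> l"
    by (intro exI[of _ "c *\<^sub>C l"] exI[of _ r]) (auto intro!: scaleC.tendsto tendsto_intros)
qed

text \<open>Total boundedness of the image of the unit ball survives a small perturbation in norm.
  This is how compactness reaches the boundary values, which are norm limits of compact
  operators.\<close>

lemma seq_compact_op_limit:
  fixes A :: "'a::complex_normed_vector \<Rightarrow>\<^sub>L 'b::{complex_normed_vector,complete_space}"
  assumes "\<And>e. e > 0 \<Longrightarrow> \<exists>C. compact_operator C \<and> norm (A - C) < e"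
  shows "seq_compact_op A"
proof -
  have "\<exists>k. finite k \<and> closure (A ` cball 0 1) \<subseteq> (\<Union>y\<in>k. ball y e)" if e: "e > 0" for e
  proof -
    obtain C where C: "compact_operator C" "norm (A - C) < e / 3"
      using assms[of "e / 3"] e by auto
    then have "compact (closure (C ` cball 0 1))" by (simp add: compact_operator_def)
    then obtain k where k: "finite k" "closure (C ` cball 0 1) \<subseteq> (\<Union>y\<in>k. ball y (e / 3))"
      unfolding compact_eq_totally_bounded using e by (meson divide_pos_pos zero_less_numeral)
    have "closure (A ` cball 0 1) \<subseteq> (\<Union>y\<in>k. ball y e)"
    proof
      fix z assume "z \<in> closure (A ` cball 0 1)"
      then obtain x where x: "norm x \<le> 1" "dist (A x) z < e / 3"
        unfolding closure_approachable using e
        by (metis (no_types, lifting) divide_pos_pos imageE mem_cball_0 zero_less_numeral)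
      then have "C x \<in> closure (C ` cball 0 1)" using closure_subset by fastforce
      then obtain y where y: "y \<in> k" "dist y (C x) < e / 3" using k by auto
      have "dist (A x) (C x) \<le> norm (A - C) * norm x"
        using norm_blinfun[of "A - C" x] by (simp add: dist_norm blinfun.diff_left)
      also have "\<dots> \<le> norm (A - C)" using x(1) by (simp add: mult_left_le)
      finally have "dist (A x) (C x) < e / 3" using C(2) by simp
      then have "dist y z < e" using x(2) y(2)
        using dist_triangle[of y z "C x"] dist_triangle[of "C x" z "A x"] dist_commute[of "A x" "C x"]
        by linarith
      then show "z \<in> (\<Union>y\<in>k. ball y e)" using y(1) by auto
    qed
    then show ?thesis using k(1) by blast
  qed
  then have "compact (closure (A ` cball 0 1))"
    unfolding compact_eq_totally_bounded by (simp add: complete_eq_closed)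
  then have comp: "seq_compact (closure (A ` cball 0 1))" by (simp add: compact_imp_seq_compact)
  show ?thesis
    unfolding seq_compact_op_def
  proof (intro allI impI)
    fix x :: "nat \<Rightarrow> 'a" assume "bounded (range x)"
    then obtain B where B: "B > 0" "\<And>n. norm (x n) \<le> B"
      unfolding bounded_pos by auto
    define y where "y n = (1 / B) *\<^sub>R x n" for n
    have "A (y n) \<in> closure (A ` cball 0 1)" for n
      using B by (intro closure_subset[THEN subsetD] imageI) (simp add: y_def)
    then obtain l r where "strict_mono (r :: nat \<Rightarrow> nat)" "((\<lambda>n. A (y n)) \<circ> r) \<longlonglongrightarrow> l"
      using seq_compactE[OF comp, of "\<lambda>n. A (y n)"] by blast
    then show "\<exists>l r. strict_mono r \<and> (\<lambda>n. A (x (r n))) \<longlonglongrightarrow> l"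
      using tendsto_scaleR[OF tendsto_const, of "\<lambda>n. A (y (r n))" l sequentially B] B(1)
      by (intro exI[of _ "B *\<^sub>R l"] exI[of _ r])
        (auto simp: y_def blinfun.scaleR_right o_def)
  qed
qed

text \<open>The contradiction shared by the ascent and the descent argument.\<close>

lemma seq_compact_op_not_separated:
  fixes K :: "'a::real_normed_vector \<Rightarrow>\<^sub>L 'b::real_normed_vector"
  assumes K: "seq_compact_op K"
    and x: "\<And>n::nat. norm (x n) = 1" "\<And>m n. m < n \<Longrightarrow> 1 \<le> norm (K (x n) - K (x m))"
  shows False
proof -
  have "bounded (range x)" using x(1) by (intro boundedI[of _ 1]) auto
  then obtain l r where r: "strict_mono (r :: nat \<Rightarrow> nat)" "(\<lambda>n. K (x (r n))) \<longlonglongrightarrow> l"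
    using seq_compact_opE[OF K] by metis
  then have "Cauchy (\<lambda>n. K (x (r n)))" using LIMSEQ_imp_Cauchy by blast
  then obtain N where "dist (K (x (r (Suc N)))) (K (x (r N))) < 1"
    unfolding Cauchy_def by (metis le_SucI order_refl zero_less_one)
  moreover have "r N < r (Suc N)" using r(1) by (simp add: strict_mono_Suc_iff)
  ultimately show False using x(2)[of "r N" "r (Suc N)"] by (simp add: dist_norm)
qed

lemma seq_compact_id_minus_opow:
  assumes "seq_compact_op (id_blinfun - U)"
  shows "seq_compact_op (id_blinfun - opow U n)"
proof (induction n)
  case 0
  show ?case unfolding seq_compact_op_def
    by (auto intro!: exI[of _ id] strict_mono_id)
next
  case (Suc n)
  have "id_blinfun - opow U (Suc n) = (id_blinfun - U) + (U o\<^sub>L (id_blinfun - opow U n))"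
    by (rule blinfun_eqI) (simp add: op_simps)
  then show ?case
    using seq_compact_op_add[OF assms seq_compact_op_compose_left[OF Suc]] by (simp only:)
qed

section \<open>Closed range, ascent and descent of a compact perturbation of the identity\<close>

lemma bounded_below_of_injective:
  fixes U :: "'a::real_normed_vector \<Rightarrow>\<^sub>L 'a"
  assumes U: "seq_compact_op (id_blinfun - U)" and M: "subspace M" "closed M"
    and inj: "\<And>x. x \<in> M \<Longrightarrow> U x = 0 \<Longrightarrow> x = 0"
  obtains c where "c > 0" "\<And>x. x \<in> M \<Longrightarrow> c * norm x \<le> norm (U x)"
proof (rule ccontr)
  assume "\<not> thesis"
  then have "\<forall>n::nat. \<exists>x\<in>M. norm (U x) < inverse (real (Suc n)) * norm x"
    using that[of "inverse (real (Suc _))"] by (force simp: not_le)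
  then obtain x where x: "\<And>n. x n \<in> M" "\<And>n::nat. norm (U (x n)) < inverse (real (Suc n)) * norm (x n)"
    by metis
  \<comment> \<open>Unit vectors with \<open>U (y n)\<close> tending to 0. Since y = (1 - U) y + U
    y, compactness makes a subsequence converge, and its limit is a unit vector of \<open>M\<close>
    killed by \<open>U\<close>.\<close>
  define y where "y n = (1 / norm (x n)) *\<^sub>R x n" for n
  have x0: "x n \<noteq> 0" for n using x(2)[of n] by auto
  have y: "y n \<in> M" "norm (y n) = 1" for n
    using x(1)[of n] x0[of n] M(1) by (auto simp: y_def subspace_scale)
  have Uy: "norm (U (y n)) \<le> inverse (real (Suc n))" for n
    using x(2)[of n] x0[of n] by (simp add: y_def blinfun.scaleR_right field_simps)
  have "(\<lambda>n. U (y n)) \<longlonglongrightarrow> 0"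
    by (rule Lim_null_comparison[OF _ LIMSEQ_inverse_real_of_nat]) (use Uy in auto)
  moreover have "bounded (range y)" using y(2) by (intro boundedI[of _ 1]) auto
  then obtain l r where r: "strict_mono (r :: nat \<Rightarrow> nat)" "(\<lambda>n. (id_blinfun - U) (y (r n))) \<longlonglongrightarrow> l"
    using seq_compact_opE[OF U] by metis
  ultimately have "(\<lambda>n. (id_blinfun - U) (y (r n)) + U (y (r n))) \<longlonglongrightarrow> l + 0"
    by (intro tendsto_add) (auto dest: LIMSEQ_subseq_LIMSEQ simp: o_def)
  then have lim: "(\<lambda>n. y (r n)) \<longlonglongrightarrow> l" by (simp add: blinfun.diff_left)
  have "l \<in> M" using closed_sequentially[OF M(2) _ lim] y by blast
  have "norm l = 1" using tendsto_norm[OF lim] y(2) LIMSEQ_unique[OF _ tendsto_const] by simp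
  have "(\<lambda>n. U (y (r n))) \<longlonglongrightarrow> U l" by (intro tendsto_intros lim)
  moreover have "(\<lambda>n. U (y (r n))) \<longlonglongrightarrow> 0"
    using LIMSEQ_subseq_LIMSEQ[OF \<open>(\<lambda>n. U (y n)) \<longlonglongrightarrow> 0\<close> r(1)] by (simp add: o_def)
  ultimately have "U l = 0" using LIMSEQ_unique by blast
  then show False using inj[OF \<open>l \<in> M\<close>] \<open>norm l = 1\<close> by simp
qed

lemma subspace_blinfun_kernel: "subspace {x. blinfun_apply A x = 0}"
  by (rule subspaceI) (auto simp: op_simps)

lemma closed_blinfun_kernel: "closed {x. blinfun_apply A x = 0}"
  by (intro closed_Collect_eq continuous_intros)

lemma subspace_blinfun_range: "subspace (range (blinfun_apply A))"
  by (intro linear_subspace_image bounded_linear.linear blinfun.bounded_linear_right subspace_UNIV)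

text \<open>On the orthogonal complement of its kernel \<open>U\<close> is injective, hence bounded
  below, so the image of the complement is complete; it is already the whole range.\<close>

lemma closed_range_of_compact_perturbation:
  fixes U :: "'a::{real_inner,complete_space} \<Rightarrow>\<^sub>L 'a"
  assumes U: "seq_compact_op (id_blinfun - U)"
  shows "closed (range U)"
proof -
  define N where "N = {x. U x = 0}"
  define M where "M = {x. \<forall>y\<in>N. inner x y = 0}"
  have M: "subspace M" "closed M"
    unfolding M_def Ball_def
    by (auto simp: subspace_def inner_add_left
        intro!: closed_Collect_all closed_Collect_imp closed_Collect_eq continuous_intros)
  have "x = 0" if "x \<in> M" "U x = 0" for x
    using that unfolding M_def N_def by force
  then obtain c where c: "c > 0" "\<And>x. x \<in> M \<Longrightarrow> c * norm x \<le> norm (U x)"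
    using bounded_below_of_injective[OF U M] by blast
  have "complete (U ` M)"
    by (rule complete_isometric_image[OF c(1) M(1) blinfun.bounded_linear_right])
      (use c(2) M(2) in \<open>auto simp: complete_eq_closed\<close>)
  moreover have "U ` M = range U"
  proof -
    have "U x \<in> U ` M" for x
    proof -
      obtain m u where mu: "m \<in> N" "x = m + u" "\<And>y. y \<in> N \<Longrightarrow> inner u y = 0"
        using orthogonal_decomposition[of N x] subspace_blinfun_kernel[of U] closed_blinfun_kernel[of U]
        unfolding N_def by blast
      then have "u \<in> M" "U x = U u" by (auto simp: M_def N_def op_simps)
      then show ?thesis by blast
    qed
    then show ?thesis by blast
  qed
  ultimately show ?thesis by (simp add: complete_eq_closed)
qed

text \<open>If the kernels kept growing, choose unit vectors x_n in the kernel of U^(n+1) at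
  distance 1 from the kernel of U^n. For m < n the difference of their images under 1 - U is x_n
  plus an element of the smaller kernel, so the images stay separated.\<close>

lemma finite_ascent:
  fixes U :: "'a::{real_inner,complete_space} \<Rightarrow>\<^sub>L 'a"
  assumes U: "seq_compact_op (id_blinfun - U)"
  shows "\<exists>n. {x. opow U (Suc n) x = 0} = {x. opow U n x = 0}"
proof (rule ccontr)
  define N where "N n = {x. opow U n x = 0}" for n
  assume "\<not> ?thesis"
  moreover have N_Suc: "N n \<subseteq> N (Suc n)" for n by (auto simp: N_def op_simps)
  ultimately have "N n \<subset> N (Suc n)" for n unfolding N_def by blast
  moreover have "subspace (N n)" "closed (N n)" for n
    unfolding N_def by (rule subspace_blinfun_kernel closed_blinfun_kernel)+
  ultimately have "\<exists>x. x \<in> N (Suc n) \<and> norm x = 1 \<and> (\<forall>y\<in>N n. norm (x - y) \<ge> 1)" for n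
    using strict_subspace_orthonormal[of "N n" "N (Suc n)"] by metis
  then obtain x where x: "\<And>n. x n \<in> N (Suc n)" "\<And>n. norm (x n) = 1"
    "\<And>n y. y \<in> N n \<Longrightarrow> norm (x n - y) \<ge> 1" by metis
  have mono: "N m \<subseteq> N n" if "m \<le> n" for m n using lift_Suc_mono_le[of N, OF N_Suc that] .
  show False
  proof (rule seq_compact_op_not_separated[OF U, of x])
    show "1 \<le> norm ((id_blinfun - U) (x n) - (id_blinfun - U) (x m))" if "m < n" for m n
    proof -
      have "x m \<in> N n" using x(1)[of m] mono[of "Suc m" n] that by auto
      moreover have "U (x m) \<in> N n" 
        using \<open>x m \<in> N n\<close> opow_commute[of U U n "x m"] by (simp add: N_def op_simps)
      moreover have "U (x n) \<in> N n" 
        using x(1)[of n] opow_commute[of U U n "x n"] by (simp add: N_def)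
      ultimately have "U (x n) + x m - U (x m) \<in> N n"
        by (simp add: N_def op_simps)
      from x(3)[OF this] show ?thesis by (simp add: op_simps algebra_simps)
    qed
  qed (rule x)
qed

text \<open>The mirror image of the ascent argument, with decreasing ranges. Their closedness,
  needed to pick the unit vectors, comes from the closed range of compact perturbations applied to
  powers of \<open>U\<close>; now the vector with the smaller index provides the separation.\<close>

lemma finite_descent:
  fixes U :: "'a::{real_inner,complete_space} \<Rightarrow>\<^sub>L 'a"
  assumes U: "seq_compact_op (id_blinfun - U)"
  shows "\<exists>n. range (opow U (Suc n)) = range (opow U n)"
proof (rule ccontr)
  define N where "N n = range (opow U n)" for n
  assume "\<not> ?thesis"
  moreover have N_Suc: "N (Suc n) \<subseteq> N n" for n
    unfolding N_def by (auto simp: opow_Suc_right simp del: opow.simps)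
  ultimately have "N (Suc n) \<subset> N n" for n unfolding N_def by blast
  moreover have "closed (N n)" for n
    unfolding N_def by (intro closed_range_of_compact_perturbation seq_compact_id_minus_opow U)
  moreover have "subspace (N n)" for n
    unfolding N_def by (rule subspace_blinfun_range)
  ultimately have "\<exists>x. x \<in> N n \<and> norm x = 1 \<and> (\<forall>y\<in>N (Suc n). norm (x - y) \<ge> 1)" for n
    using strict_subspace_orthonormal[of "N (Suc n)" "N n"] by metis
  then obtain x where x: "\<And>n. x n \<in> N n" "\<And>n. norm (x n) = 1"
    "\<And>n y. y \<in> N (Suc n) \<Longrightarrow> norm (x n - y) \<ge> 1" by metis
  have mono: "N n \<subseteq> N m" if "m \<le> n" for m n using lift_Suc_antimono_le[of N, OF N_Suc that] .
  have U_N: "U y \<in> N (Suc n)" if "y \<in> N n" for y n using that by (auto simp: N_def)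
  show False
  proof (rule seq_compact_op_not_separated[OF U, of x])
    show "1 \<le> norm ((id_blinfun - U) (x n) - (id_blinfun - U) (x m))" if "m < n" for m n
    proof -
      have *: "x n \<in> N (Suc m)" using x(1)[of n] mono[of "Suc m" n] that by auto
      have "U (x n) \<in> N (Suc m)" using U_N[OF *] N_Suc by blast
      then have "U (x m) + x n - U (x n) \<in> N (Suc m)"
        using U_N[OF x(1)[of m]] * subspace_blinfun_range[of "opow U (Suc m)"]
        unfolding N_def by (intro subspace_diff subspace_add) auto
      from x(3)[OF this] show ?thesis by (simp add: op_simps algebra_simps norm_minus_commute)
    qed
  qed (rule x)
qed

section \<open>Riesz projections\<close>

text \<open>The lower bound makes the solution in \<open>M\<close> unique, hence additive and
  bounded. This produces the projection onto the range of a power of \<open>U\<close> as well as the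
  inverse of \<open>U\<close> there.\<close>

lemma blinfun_inverse_on:
  fixes S :: "'a::real_normed_vector \<Rightarrow>\<^sub>L 'b::real_normed_vector"
    and f :: "'c::real_normed_vector \<Rightarrow>\<^sub>L 'b"
  assumes M: "subspace M" and c: "c > 0" "\<And>x. x \<in> M \<Longrightarrow> c * norm x \<le> norm (S x)"
    and f: "\<And>x. f x \<in> S ` M"
  obtains Z :: "'c \<Rightarrow>\<^sub>L 'a" where "\<And>x. Z x \<in> M" "\<And>x. S (Z x) = f x"
proof -
  have "\<exists>z. z \<in> M \<and> S z = f x" for x
    using imageE[OF f[of x]] by metis
  then obtain g where g: "\<And>x. g x \<in> M" "\<And>x. S (g x) = f x"
    by metis
  have inj: "a = b" if "a \<in> M" "b \<in> M" "S a = S b" for a b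
    using c(2)[OF subspace_diff[OF M that(1,2)]] c(1) that(3) 
    by (simp add: op_simps mult_le_0_iff)
  have "bounded_linear g"
  proof (rule bounded_linear_intro[where K = "norm f / c"])
    show "g (x + y) = g x + g y" for x y
      by (rule inj) (use g M in \<open>auto simp: op_simps subspace_add\<close>)
    show "g (r *\<^sub>R x) = r *\<^sub>R g x" for r x
      by (rule inj) (use g M in \<open>auto simp: op_simps subspace_scale\<close>)
    show "norm (g x) \<le> norm x * (norm f / c)" for x
      using c(2)[OF g(1)[of x]] norm_blinfun[of f x] c(1) g(2)[of x]
      by (simp add: field_simps)
  qed
  then show ?thesis using that[of "Blinfun g"] g by (simp add: bounded_linear_Blinfun_apply)
qed

text \<open>The Riesz projection of \<open>U\<close> for the eigenvalue 0: \<open>U\<close> is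
  nilpotent on the range of \<open>P\<close>, and \<open>W\<close> is the Drazin inverse, which
  inverts \<open>U\<close> on the kernel of \<open>P\<close> and vanishes on the range.\<close>

definition riesz_projection ::
    "('a::real_normed_vector \<Rightarrow>\<^sub>L 'a) \<Rightarrow> nat \<Rightarrow> ('a \<Rightarrow>\<^sub>L 'a) \<Rightarrow> ('a \<Rightarrow>\<^sub>L 'a) \<Rightarrow> bool" where
  "riesz_projection U n W P \<longleftrightarrow>
     (\<forall>x. P (P x) = P x) \<and> (\<forall>x. P (U x) = U (P x)) \<and> (\<forall>x. opow U n (P x) = 0) \<and>
     (\<forall>x. W (U x) = x - P x) \<and> (\<forall>x. U (W x) = x - P x) \<and> (\<forall>x. P (W x) = 0) \<and> (\<forall>x. W (P x) = 0)"

lemma riesz_projection_exists: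
  fixes U :: "'a::{real_inner,complete_space} \<Rightarrow>\<^sub>L 'a"
  assumes U: "seq_compact_op (id_blinfun - U)"
  shows "\<exists>n W P. riesz_projection U n W P"
proof -
  obtain p where p: "{x. opow U (Suc p) x = 0} = {x. opow U p x = 0}" using finite_ascent[OF U] by blast
  obtain q where q: "range (opow U (Suc q)) = range (opow U q)" using finite_descent[OF U] by blast
  \<comment> \<open>At least both the ascent \<open>p\<close> and the descent \<open>q\<close>, so
    from \<open>n\<close> on neither kernels nor ranges change and the space splits into the kernel
    and the range \<open>M\<close> of U^n.\<close>
  define n where "n = p + q"
  define M where "M = range (opow U n)"
  have ker: "opow U n x = 0" if "opow U (k + n) x = 0" for k x
    using that
  proof (induction k)
    case (Suc k)
    have "Suc k + n = Suc p + (k + q)" by (simp add: n_def)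
    then have "opow U (Suc p) (opow U (k + q) x) = 0" using Suc.prems by (metis opow_add)
    then have "opow U p (opow U (k + q) x) = 0" using p by blast
    then have "opow U (k + n) x = 0" by (simp add: n_def opow_add[symmetric] add_ac)
    then show ?case by (rule Suc.IH)
  qed simp
  have ran1: "range (opow U (Suc n)) = range (opow U n)"
  proof -
    have "range (opow U (Suc n)) = opow U p ` range (opow U (Suc q))"
      unfolding image_image opow_add[symmetric] by (simp only: n_def add_Suc_right)
    also have "\<dots> = range (opow U n)"
      unfolding q image_image opow_add[symmetric] by (simp only: n_def)
    finally show ?thesis .
  qed
  have ran: "opow U k ` M = M" for k
  proof (induction k)
    case (Suc k)
    have "opow U (Suc k) ` M = U ` (opow U k ` M)" by (simp add: image_image)
    also have "\<dots> = U ` range (opow U n)" unfolding Suc by (simp add: M_def)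
    also have "\<dots> = range (opow U (Suc n))" by (simp add: image_image)
    finally show ?case using ran1 by (simp add: M_def)
  qed simp
  have subM: "subspace M" unfolding M_def by (rule subspace_blinfun_range)
  have clM: "closed M"
    unfolding M_def by (intro closed_range_of_compact_perturbation seq_compact_id_minus_opow U)
  have inj: "x = 0" if xM: "x \<in> M" and "opow U n x = 0" for x
  proof -
    obtain y where y: "x = opow U n y" using xM unfolding M_def by blast
    then have "opow U (n + n) y = 0" using that(2) by (simp add: opow_add)
    then show ?thesis using ker y by blast
  qed
  have inj1: "x = 0" if "x \<in> M" "U x = 0" for x
    using inj[OF that(1)] that(2) opow_commute[of U U n x] ker[of 1 x] by simp
  obtain c where c: "c > 0" "\<And>x. x \<in> M \<Longrightarrow> c * norm x \<le> norm (opow U n x)"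
    using bounded_below_of_injective[OF seq_compact_id_minus_opow[OF U] subM clM inj] by blast
  have "opow U n x \<in> opow U n ` M" for x using ran[of n] by (auto simp: M_def)
  \<comment> \<open>\<open>Y\<close> is the projection onto \<open>M\<close> along the kernel of
    U^n; the Riesz projection will be its complement, and \<open>W\<close> will be \<open>Y\<close>
    followed by the inverse of \<open>U\<close> on \<open>M\<close>.\<close>
  then obtain Y where Y: "\<And>x. blinfun_apply Y x \<in> M" "\<And>x. opow U n (Y x) = opow U n x"
    using blinfun_inverse_on[OF subM c] by metis
  obtain c' where c': "c' > 0" "\<And>x. x \<in> M \<Longrightarrow> c' * norm x \<le> norm (U x)"
    using bounded_below_of_injective[OF U subM clM inj1] by blast
  have "U ` M = M" using ran[of 1] by simp
  then have "Y x \<in> U ` M" for x using Y(1) by simp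
  then obtain W where W: "\<And>x. blinfun_apply W x \<in> M" "\<And>x. U (W x) = Y x"
    using blinfun_inverse_on[OF subM c'] by metis
  have UM: "U x \<in> M" if "x \<in> M" for x using \<open>U ` M = M\<close> that by blast
  have eq: "a = b" if "a \<in> M" "b \<in> M" "opow U n a = opow U n b" for a b
    using inj[OF subspace_diff[OF subM that(1,2)]] that(3) by (simp add: op_simps)
  have eq1: "a = b" if "a \<in> M" "b \<in> M" "U a = U b" for a b
    using inj1[OF subspace_diff[OF subM that(1,2)]] that(3) by (simp add: op_simps)
  have YM: "Y x = x" if "x \<in> M" for x by (rule eq[OF Y(1) that Y(2)])
  have comm: "opow U n (U x) = U (opow U n x)" for x
    by (rule opow_commute[of U U n x, symmetric]) simp
  have YU: "Y (U x) = U (Y x)" for x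
    by (rule eq[OF Y(1) UM[OF Y(1)]]) (simp only: Y(2) comm)
  have Y0: "Y (x - Y x) = 0" for x by (simp add: op_simps YM Y(1))
  have "riesz_projection U n W (id_blinfun - Y)"
    unfolding riesz_projection_def
  proof (intro conjI allI)
    fix x
    have "W (U x) = Y x"
      by (rule eq1[OF W(1) Y(1)]) (simp only: W(2) YU)
    then show "W (U x) = x - (id_blinfun - Y) x"
      by (simp add: blinfun.diff_left)
    have "W (x - Y x) = 0"
      by (rule eq1[OF W(1) subspace_0[OF subM]]) (simp only: W(2) Y0 blinfun.zero_right)
    then show "W ((id_blinfun - Y) x) = 0"
      by (simp only: blinfun.diff_left blinfun_apply_id_blinfun)
    have "Y (Y x) = Y x" by (rule YM[OF Y(1)])
    then show "(id_blinfun - Y) ((id_blinfun - Y) x) = (id_blinfun - Y) x"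
      by (simp add: blinfun.diff_left blinfun.diff_right)
    show "(id_blinfun - Y) (U x) = U ((id_blinfun - Y) x)"
      by (simp add: blinfun.diff_left blinfun.diff_right YU)
    show "opow U n ((id_blinfun - Y) x) = 0"
      by (simp add: blinfun.diff_left blinfun.diff_right Y(2))
    show "U (W x) = x - (id_blinfun - Y) x"
      by (simp add: blinfun.diff_left W(2))
    show "(id_blinfun - Y) (W x) = 0"
      by (simp add: blinfun.diff_left YM[OF W(1)])
  qed
  then show ?thesis by blast
qed

text \<open>The kernel of \<open>P\<close> is invariant under \<open>U\<close> and \<open>W\<close>,
  which are mutually inverse on it, so the powers cancel from the inside out.\<close>

lemma riesz_projection_complement:
  fixes U W P :: "'a::real_normed_vector \<Rightarrow>\<^sub>L 'a"
  assumes R: "riesz_projection U n W P" and y: "P y = 0"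
  shows "opow W k (opow U k y) = y" and "opow U k (opow W k y) = y"
proof -
  have P: "P (U x) = U (P x)" "W (U x) = x - P x" "U (W x) = x - P x" "P (W x) = 0" for x
    using R by (auto simp: riesz_projection_def)
  have PU: "P (opow U k y) = 0" for k
    by (induction k) (use y P in auto)
  have PW: "P (opow W k y) = 0" for k
    by (induction k) (use y P in auto)
  show "opow W k (opow U k y) = y"
  proof (induction k)
    case (Suc k)
    have "opow W (Suc k) (opow U (Suc k) y) = opow W k (W (U (opow U k y)))"
      by (simp only: opow_Suc_right[of W]) simp
    then show ?case using Suc P(2) PU by simp
  qed simp
  show "opow U k (opow W k y) = y"
  proof (induction k)
    case (Suc k)
    have "opow U (Suc k) (opow W (Suc k) y) = opow U k (U (W (opow W k y)))"
      by (simp only: opow_Suc_right[of U]) simp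
    then show ?case using Suc P(3) PW by simp
  qed simp
qed

lemma opow_intertwine:
  fixes A :: "'a::real_normed_vector \<Rightarrow>\<^sub>L 'b::real_normed_vector"
    and U :: "'a \<Rightarrow>\<^sub>L 'a" and U' :: "'b \<Rightarrow>\<^sub>L 'b"
  assumes "\<And>x. A (U x) = U' (A x)"
  shows "A (opow U n x) = opow U' n (A x)"
  by (induction n) (auto simp: assms)

text \<open>Range and kernel of a Riesz projection are intrinsic: vectors killed by some power of
  \<open>U\<close>, and vectors in the range of every power. An intertwiner respects both. Its uses
  are complex linearity, commutation with operators commuting with \<open>U\<close>, and the
  relation J P = Q J.\<close>

lemma riesz_projection_intertwine:
  fixes A :: "'a::real_normed_vector \<Rightarrow>\<^sub>L 'b::real_normed_vector"
  assumes R: "riesz_projection U n W P" and R': "riesz_projection U' n' W' P'"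
    and A: "\<And>x. A (U x) = U' (A x)"
  shows "A (P x) = P' (A x)" and "A (W x) = W' (A x)"
proof -
  have P: "P (P x) = P x" "opow U n (P x) = 0" "P (W x) = 0" "U (W x) = x - P x" for x
    using R by (auto simp: riesz_projection_def)
  have P': "P' (P' x) = P' x" "opow U' n' (P' x) = 0" "P' (U' x) = U' (P' x)"
    "W' (U' x) = x - P' x" "W' (P' x) = 0" for x
    using R' by (auto simp: riesz_projection_def)
  have P'U: "P' (opow U' k z) = opow U' k (P' z)" for k z
    by (rule opow_commute) (simp add: P')
  have inter: "A (P x) = P' (A x)" for x
  proof -
    \<comment> \<open>x - P x lies in the range of every power of \<open>U\<close>, so its image
      lies in the range of the n'-th power of \<open>U'\<close>, which \<open>P'\<close>
      kills.\<close>
    have "P (x - P x) = 0" by (simp add: blinfun.diff_right P)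
    then have "x - P x = opow U n' (opow W n' (x - P x))"
      using riesz_projection_complement(2)[OF R] by metis
    then have "P' (A (x - P x)) = P' (A (opow U n' (opow W n' (x - P x))))" by simp
    also have "\<dots> = 0"
      by (simp only: opow_intertwine[of A U U', OF A] P'U P'(2))
    finally have 1: "P' (A x) = P' (A (P x))" by (simp add: blinfun.diff_right)
    let ?z = "A (P x)"
    \<comment> \<open>The image of P x is nilpotent for \<open>U'\<close>. Its part in the kernel of
      \<open>P'\<close>, where \<open>U'\<close> is injective, must vanish.\<close>
    have "opow U' n ?z = 0"
      using opow_intertwine[of A U U' n "P x", OF A] P(2) by simp
    then have "opow U' n (?z - P' ?z) = 0"
      using P'U[of n ?z, symmetric] by (simp add: blinfun.diff_right)
    moreover have "P' (?z - P' ?z) = 0" by (simp add: blinfun.diff_right P')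
    ultimately have "?z - P' ?z = 0"
      using riesz_projection_complement(1)[OF R', of "?z - P' ?z" n] by simp
    then show ?thesis using 1 by simp
  qed
  then show "A (P x) = P' (A x)" .
  have "W' (A (U (W x))) = A (W x) - P' (A (W x))" by (simp only: A P')
  also have "P' (A (W x)) = 0" by (simp only: inter[symmetric] P blinfun.zero_right)
  finally have "A (W x) = W' (A x - P' (A x))" by (simp add: P blinfun.diff_right inter)
  then show "A (W x) = W' (A x)" by (simp add: blinfun.diff_right P')
qed

text \<open>Multiplication by a complex scalar intertwines \<open>U\<close> with itself.\<close>

lemma riesz_projection_clinear:
  assumes "riesz_projection U n W P" "clinear_op U"
  shows "clinear_op P" "clinear_op W"
proof -
  have *: "(c *\<^sub>C id_blinfun) (U x) = U ((c *\<^sub>C id_blinfun) x)" for c x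
    using assms(2) by (simp add: clinear_op_def)
  show "clinear_op P" "clinear_op W"
    using riesz_projection_intertwine[OF assms(1) assms(1) *] by (simp_all add: clinear_op_def)
qed


section \<open>The resolvent family of a compact operator\<close>

text \<open>\<open>X = K (1 + c K)\<^sup>-\<^sup>1\<close>, written without inverses.\<close>

definition is_resolvent_family ::
    "('a::complex_normed_vector \<Rightarrow>\<^sub>L 'a) \<Rightarrow> complex \<Rightarrow> ('a \<Rightarrow>\<^sub>L 'a) \<Rightarrow> bool" where
  "is_resolvent_family K c X \<longleftrightarrow> clinear_op X \<and>
     (\<forall>x. X x + c *\<^sub>C X (K x) = K x) \<and> (\<forall>x. X x + c *\<^sub>C K (X x) = K x)"

definition resolvent_family ::
    "('a::complex_normed_vector \<Rightarrow>\<^sub>L 'a) \<Rightarrow> complex \<Rightarrow> ('a \<Rightarrow>\<^sub>L 'a)" where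
  "resolvent_family K c = (THE X. is_resolvent_family K c X)"

text \<open>The argument that a left inverse equals a right inverse: evaluating \<open>X\<close> on
  the equation for \<open>Y\<close> gives X K = K Y.\<close>

lemma left_right_resolvent_eq:
  fixes K X Y :: "'a::complex_normed_vector \<Rightarrow>\<^sub>L 'a"
  assumes "clinear_op X" "\<And>x. X x + c *\<^sub>C X (K x) = K x" "\<And>x. Y x + c *\<^sub>C K (Y x) = K x"
  shows "X = Y"
proof (rule blinfun_eqI)
  fix x
  have "X (Y x) + c *\<^sub>C X (K (Y x)) = X (K x)"
    using arg_cong[OF assms(3)[of x], of X] assms(1) by (simp add: blinfun.add_right clinear_op_def)
  then have "X (K x) = K (Y x)" using assms(2)[of "Y x"] by simp
  then show "X x = Y x" using assms(2)[of x] assms(3)[of x] by (metis add_right_cancel)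
qed

lemma is_resolvent_family_unique:
  "is_resolvent_family K c X \<Longrightarrow> is_resolvent_family K c Y \<Longrightarrow> X = Y"
  unfolding is_resolvent_family_def using left_right_resolvent_eq[of X c K Y] by blast

lemma resolvent_family_eq: "is_resolvent_family K c X \<Longrightarrow> resolvent_family K c = X"
  unfolding resolvent_family_def using is_resolvent_family_unique by blast

lemma is_resolvent_family_zero: "clinear_op K \<Longrightarrow> is_resolvent_family K 0 K"
  by (simp add: is_resolvent_family_def scaleC.zero_left)

text \<open>With X = K (1 + c K)^-1 one has K (1 + (c + d) K)^-1 = X (1 + d X)^-1. Any point of the
  family can therefore serve as a new origin, and local statements reduce to small
  parameters.\<close>

lemma is_resolvent_family_shift:
  assumes "is_resolvent_family K c X" "is_resolvent_family X d Y" "clinear_op K"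
  shows "is_resolvent_family K (c + d) Y"
proof -
  have X: "X x + c *\<^sub>C X (K x) = K x" "X x + c *\<^sub>C K (X x) = K x" for x
    using assms(1) by (auto simp: is_resolvent_family_def)
  have Y: "Y x + d *\<^sub>C Y (X x) = X x" "Y x + d *\<^sub>C X (Y x) = X x" and lin: "clinear_op Y" for x
    using assms(2) by (auto simp: is_resolvent_family_def)
  have Yd: "d *\<^sub>C Y (X x) = X x - Y x" "d *\<^sub>C X (Y x) = X x - Y x" for x
    using Y[of x] by (auto simp: eq_diff_eq add.commute)
  show ?thesis
    unfolding is_resolvent_family_def
  proof (intro conjI allI lin)
    fix x
    have "d *\<^sub>C Y (K x) = d *\<^sub>C Y (X x + c *\<^sub>C X (K x))"
      by (simp only: X(1))
    also have "\<dots> = d *\<^sub>C Y (X x) + c *\<^sub>C (d *\<^sub>C Y (X (K x)))"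
      using lin by (simp add: blinfun.add_right scaleC.add_right scaleC_scaleC clinear_op_def mult.commute)
    also have "\<dots> = X x - Y x + (c *\<^sub>C X (K x) - c *\<^sub>C Y (K x))"
      by (simp only: Yd scaleC.diff_right)
    finally show "Y x + (c + d) *\<^sub>C Y (K x) = K x"
      using X(1)[of x] by (simp add: scaleC.add_left algebra_simps)
    have "d *\<^sub>C K (Y x) = d *\<^sub>C (X (Y x) + c *\<^sub>C K (X (Y x)))"
      by (simp only: X(2))
    also have "\<dots> = d *\<^sub>C X (Y x) + c *\<^sub>C K (d *\<^sub>C X (Y x))"
      using assms(3) by (simp add: scaleC.add_right scaleC_scaleC clinear_op_def mult.commute)
    also have "\<dots> = X x - Y x + (c *\<^sub>C K (X x) - c *\<^sub>C K (Y x))"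
      by (simp only: Yd scaleC.diff_right blinfun.diff_right)
    finally show "Y x + (c + d) *\<^sub>C K (Y x) = K x"
      using X(2)[of x] by (simp add: scaleC.add_left algebra_simps)
  qed
qed

text \<open>Contraction replaces the Neumann series. The equations with \<open>K\<close> on the
  right and on the left are solved separately, and the two solutions are identified only once the
  first is known to be complex linear.\<close>

lemma is_resolvent_family_exists:
  fixes K :: "'a::{complex_normed_vector,banach} \<Rightarrow>\<^sub>L 'a"
  assumes K: "clinear_op K" and c: "cmod c * norm K < 1"
  shows "\<exists>X. is_resolvent_family K c X"
proof -
  have "\<exists>!X. K - c *\<^sub>C (X o\<^sub>L K) = X"
  proof (rule banach_fix_type[OF _ c], safe)
    fix X Y :: "'a \<Rightarrow>\<^sub>L 'a"
    have "(K - c *\<^sub>C (X o\<^sub>L K)) - (K - c *\<^sub>C (Y o\<^sub>L K)) = c *\<^sub>C ((Y - X) o\<^sub>L K)"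
      by (simp add: blinfun_compose.diff_left scaleC.diff_right)
    then show "dist (K - c *\<^sub>C (X o\<^sub>L K)) (K - c *\<^sub>C (Y o\<^sub>L K)) \<le> cmod c * norm K * dist X Y"
      using mult_left_mono[OF norm_blinfun_compose[of "Y - X" K], of "cmod c"]
      by (simp add: dist_norm norm_scaleC norm_minus_commute mult_ac)
  qed simp
  then obtain X where X: "K - c *\<^sub>C (X o\<^sub>L K) = X"
    and uniq: "\<And>Y. K - c *\<^sub>C (Y o\<^sub>L K) = Y \<Longrightarrow> Y = X" by metis
  have "\<exists>!X. K - c *\<^sub>C (K o\<^sub>L X) = X"
  proof (rule banach_fix_type[OF _ c], safe)
    fix X Y :: "'a \<Rightarrow>\<^sub>L 'a"
    have "(K - c *\<^sub>C (K o\<^sub>L X)) - (K - c *\<^sub>C (K o\<^sub>L Y)) = c *\<^sub>C (K o\<^sub>L (Y - X))"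
      by (simp add: blinfun_compose.diff_right scaleC.diff_right)
    then show "dist (K - c *\<^sub>C (K o\<^sub>L X)) (K - c *\<^sub>C (K o\<^sub>L Y)) \<le> cmod c * norm K * dist X Y"
      using mult_left_mono[OF norm_blinfun_compose[of K "Y - X"], of "cmod c"]
      by (simp add: dist_norm norm_scaleC norm_minus_commute mult_ac)
  qed simp
  then obtain Y where Y: "K - c *\<^sub>C (K o\<^sub>L Y) = Y" by metis
  have Xx: "K x - c *\<^sub>C X (K x) = X x" for x
    using arg_cong[OF X, of "\<lambda>X. blinfun_apply X x"] by (simp add: blinfun.diff_left)
  have Yx: "K x - c *\<^sub>C K (Y x) = Y x" for x
    using arg_cong[OF Y, of "\<lambda>X. blinfun_apply X x"] by (simp add: blinfun.diff_left)
  have lin: "clinear_op X"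
    unfolding clinear_op_def
  proof (intro allI)
    fix a x
    show "X (a *\<^sub>C x) = a *\<^sub>C X x"
    proof (cases "a = 0")
      case False
      \<comment> \<open>Conjugation by a nonzero scalar maps fixed points of the contraction to
        fixed points, so uniqueness yields complex linearity.\<close>
      have "inverse a *\<^sub>C (X o\<^sub>L (a *\<^sub>C id_blinfun)) = X"
      proof (rule uniq, rule blinfun_eqI)
        fix x
        have "inverse a *\<^sub>C X (a *\<^sub>C x) = inverse a *\<^sub>C (a *\<^sub>C K x - c *\<^sub>C X (a *\<^sub>C K x))"
          using Xx[of "a *\<^sub>C x"] K by (simp add: clinear_op_def)
        also have "\<dots> = K x - c *\<^sub>C inverse a *\<^sub>C X (a *\<^sub>C K x)"
          using False by (simp add: scaleC.diff_right scaleC_scaleC mult.commute)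
        finally show "(K - c *\<^sub>C ((inverse a *\<^sub>C (X o\<^sub>L (a *\<^sub>C id_blinfun))) o\<^sub>L K)) x =
            (inverse a *\<^sub>C (X o\<^sub>L (a *\<^sub>C id_blinfun))) x"
          by (simp add: blinfun.diff_left)
      qed
      then have "inverse a *\<^sub>C X (a *\<^sub>C x) = X x"
        by (metis blinfun_apply_blinfun_compose blinfun_apply_id_blinfun scaleC_blinfun_apply)
      then have "a *\<^sub>C inverse a *\<^sub>C X (a *\<^sub>C x) = a *\<^sub>C X x" by simp
      then show ?thesis using False by (simp add: scaleC_scaleC)
    qed (simp add: scaleC.zero_left)
  qed
  have 1: "X x + c *\<^sub>C X (K x) = K x" for x using Xx[of x] by (simp add: algebra_simps)
  have 2: "Y x + c *\<^sub>C K (Y x) = K x" for x using Yx[of x] by (simp add: algebra_simps)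
  have "X = Y" by (rule left_right_resolvent_eq[OF lin 1 2])
  then show ?thesis using lin 1 2 unfolding is_resolvent_family_def by blast
qed

lemma is_resolvent_family_compose:
  assumes "is_resolvent_family K c X"
  shows "X - K = - c *\<^sub>C (X o\<^sub>L K)"
proof (rule blinfun_eqI)
  fix x
  have "X x + c *\<^sub>C X (K x) = K x" using assms by (simp add: is_resolvent_family_def)
  then have "X x - K x = - (c *\<^sub>C X (K x))" by (simp add: algebra_simps)
  then show "(X - K) x = (- c *\<^sub>C (X o\<^sub>L K)) x"
    by (simp add: blinfun.diff_left blinfun.minus_left scaleC.minus_left)
qed

text \<open>From Y - X = - d Y X, smallness of d absorbs half of the norm of \<open>Y\<close>; hence
  the norm of \<open>Y\<close> is at most twice that of \<open>X\<close>, and the factor 2 in the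
  estimate.\<close>

lemma is_resolvent_family_local:
  fixes K :: "'a::{complex_normed_vector,banach} \<Rightarrow>\<^sub>L 'a"
  assumes "clinear_op K" "is_resolvent_family K c X" "cmod d * norm X \<le> 1 / 2"
  obtains Y where "is_resolvent_family K (c + d) Y" "Y - X = - d *\<^sub>C (Y o\<^sub>L X)"
    "norm (Y - X) \<le> 2 * cmod d * (norm X)\<^sup>2"
proof -
  have "clinear_op X" using assms(2) by (simp add: is_resolvent_family_def)
  moreover have "cmod d * norm X < 1" using assms(3) by linarith
  ultimately obtain Y where Y: "is_resolvent_family X d Y"
    using is_resolvent_family_exists by blast
  have eq: "Y - X = - d *\<^sub>C (Y o\<^sub>L X)" by (rule is_resolvent_family_compose[OF Y])
  have le: "norm (Y - X) \<le> cmod d * (norm Y * norm X)"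
    unfolding eq norm_scaleC by (simp add: mult_left_mono norm_blinfun_compose)
  have "norm Y \<le> norm X + norm (Y - X)" by (rule norm_triangle_sub)
  also have "\<dots> \<le> norm X + (1 / 2) * norm Y"
    using le mult_right_mono[OF assms(3), of "norm Y"] by (simp add: mult_ac)
  finally have "norm Y \<le> 2 * norm X" by simp
  then have "cmod d * (norm Y * norm X) \<le> cmod d * (2 * norm X * norm X)"
    by (intro mult_left_mono mult_right_mono) auto
  then have "norm (Y - X) \<le> 2 * cmod d * (norm X)\<^sup>2"
    using le by (simp add: power2_eq_square mult_ac)
  then show ?thesis
    using that is_resolvent_family_shift[OF assms(2) Y assms(1)] eq by blast
qed

text \<open>The difference quotient is exactly - Y X, where \<open>Y\<close> is the nearby value,
  and \<open>Y\<close> tends to \<open>X\<close>; the derivative is - X^2.\<close>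

lemma resolvent_family_differentiable:
  fixes K :: "'a::{complex_normed_vector,banach} \<Rightarrow>\<^sub>L 'a"
  assumes K: "clinear_op K" and X: "is_resolvent_family K c X"
  shows "\<forall>\<^sub>F w in nhds c. \<exists>Y. is_resolvent_family K w Y"
    and "complex_differentiable_at (resolvent_family K) c"
proof -
  obtain e where e: "e > 0" "e * norm X \<le> 1 / 2"
  proof (cases "X = 0")
    case False
    then show thesis using that[of "1 / (2 * norm X)"] by simp
  qed (use that[of 1] in simp)
  have small: "cmod d * norm X \<le> 1 / 2" if "cmod d < e" for d
    using mult_right_mono[OF less_imp_le[OF that] norm_ge_zero[of X]] e(2) by linarith
  have near: "\<exists>Y. is_resolvent_family K w Y \<and> Y - X = - (w - c) *\<^sub>C (Y o\<^sub>L X) \<and>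
      norm (Y - X) \<le> 2 * cmod (w - c) * (norm X)\<^sup>2" if "dist w c < e" for w
  proof -
    have "cmod (w - c) * norm X \<le> 1 / 2" using that by (intro small) (simp add: dist_norm)
    from is_resolvent_family_local[OF K X this]
    obtain Y where "is_resolvent_family K (c + (w - c)) Y" "Y - X = - (w - c) *\<^sub>C (Y o\<^sub>L X)"
      "norm (Y - X) \<le> 2 * cmod (w - c) * (norm X)\<^sup>2" by blast
    then show ?thesis by (intro exI[of _ Y]) simp
  qed
  show "\<forall>\<^sub>F w in nhds c. \<exists>Y. is_resolvent_family K w Y"
    unfolding eventually_nhds_metric using near e(1) by blast
  have "((\<lambda>w. inverse (w - c) *\<^sub>C (resolvent_family K w - resolvent_family K c)) \<longlongrightarrow> - (X o\<^sub>L X)) (at c)"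
  proof (rule Lim_transform)
    show "((\<lambda>w::complex. - (X o\<^sub>L X)) \<longlongrightarrow> - (X o\<^sub>L X)) (at c)" by simp
    have "norm (inverse (w - c) *\<^sub>C (resolvent_family K w - resolvent_family K c) - (- (X o\<^sub>L X)))
        \<le> 2 * cmod (w - c) * (norm X)\<^sup>2 * norm X" if w: "w \<noteq> c" "dist w c < e" for w
    proof -
      obtain Y where Y: "is_resolvent_family K w Y" "Y - X = - (w - c) *\<^sub>C (Y o\<^sub>L X)"
        "norm (Y - X) \<le> 2 * cmod (w - c) * (norm X)\<^sup>2" using near[OF w(2)] by blast
      have "inverse (w - c) *\<^sub>C (resolvent_family K w - resolvent_family K c) = - (Y o\<^sub>L X)"
      proof -
        have "inverse (w - c) * - (w - c) = - 1" using w(1) by (simp add: field_simps)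
        then show ?thesis
          unfolding resolvent_family_eq[OF Y(1)] resolvent_family_eq[OF X] Y(2) scaleC_scaleC
          by (simp only: scaleC.minus_left scaleC_one)
      qed
      then have "norm (inverse (w - c) *\<^sub>C (resolvent_family K w - resolvent_family K c) - (- (X o\<^sub>L X)))
          = norm ((X - Y) o\<^sub>L X)" by (simp add: blinfun_compose.diff_left)
      also have "\<dots> \<le> norm (Y - X) * norm X"
        using norm_blinfun_compose[of "X - Y" X] by (simp add: norm_minus_commute)
      also have "\<dots> \<le> 2 * cmod (w - c) * (norm X)\<^sup>2 * norm X"
        using Y(3) by (intro mult_right_mono) auto
      finally show ?thesis .
    qed
    then have "\<forall>\<^sub>F w in at c. norm (inverse (w - c) *\<^sub>C (resolvent_family K w - resolvent_family K c) - (- (X o\<^sub>L X)))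
        \<le> 2 * cmod (w - c) * (norm X)\<^sup>2 * norm X"
      unfolding eventually_at using e(1) by blast
    moreover have "((\<lambda>w. 2 * cmod (w - c) * (norm X)\<^sup>2 * norm X) \<longlongrightarrow> 2 * cmod (c - c) * (norm X)\<^sup>2 * norm X) (at c)"
      by (intro tendsto_intros)
    then have "((\<lambda>w. 2 * cmod (w - c) * (norm X)\<^sup>2 * norm X) \<longlongrightarrow> 0) (at c)"
      by (simp only: diff_self norm_zero mult_zero_right mult_zero_left)
    ultimately show "((\<lambda>w. inverse (w - c) *\<^sub>C (resolvent_family K w - resolvent_family K c) - (- (X o\<^sub>L X))) \<longlongrightarrow> 0) (at c)"
      by (rule Lim_null_comparison)
  qed
  then show "complex_differentiable_at (resolvent_family K) c"
    unfolding complex_differentiable_at_def by blast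
qed

text \<open>The coefficient of U^k in the geometric expansion of ((1 + \<sigma>/t) U -
  \<sigma>/t)^-1. As a function of \<sigma> it has residue -t at 0, whatever k is.\<close>

definition laurent_coeff :: "complex \<Rightarrow> nat \<Rightarrow> complex \<Rightarrow> complex" where
  "laurent_coeff t k \<sigma> = - (t / \<sigma>) * (1 + t / \<sigma>) ^ k"

text \<open>On the range of \<open>P\<close> the operator \<open>U = 1 + t K\<close> is nilpotent, so there the inverse of
  \<open>1 + (t + \<sigma>) K = (1 + \<sigma>/t) U - \<sigma>/t\<close> is a finite geometric sum, the principal part; on the
  kernel of \<open>P\<close> the operator \<open>W\<close> inverts \<open>U\<close>.\<close>

lemma is_resolvent_family_laurent:
  fixes K :: "'a::complex_normed_vector \<Rightarrow>\<^sub>L 'a"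
  assumes K: "clinear_op K" and t: "t \<noteq> 0" and \<sigma>: "\<sigma> \<noteq> 0"
    and R: "riesz_projection (id_blinfun + t *\<^sub>C K) n W P"
    and h: "is_resolvent_family (W o\<^sub>L K) \<sigma> h"
  shows "is_resolvent_family K (t + \<sigma>)
    ((\<Sum>k<n. laurent_coeff t k \<sigma> *\<^sub>C (opow (id_blinfun + t *\<^sub>C K) k o\<^sub>L (K o\<^sub>L P))) + h)"
proof -
  define U where "U = id_blinfun + t *\<^sub>C K"
  define \<psi> where "\<psi> k = laurent_coeff t k \<sigma>" for k
  define D where "D k = opow U k o\<^sub>L (K o\<^sub>L P)" for k
  note R = R[folded U_def]
  have Ux: "U x = x + t *\<^sub>C K x" for x by (simp add: U_def blinfun.add_left)
  have linU: "clinear_op U" unfolding U_def by (intro clinear_op_add clinear_op_id clinear_op_scaleC K)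
  note lin = riesz_projection_clinear[OF R linU]
  have P: "P (P x) = P x" "opow U n (P x) = 0" "P (W x) = 0" "U (W x) = x - P x" "W (U x) = x - P x"
    "W (P x) = 0" for x
    using R by (auto simp: riesz_projection_def)
  have KU: "K (U x) = U (K x)" for x using K by (simp add: Ux blinfun.add_right clinear_op_def)
  have PK: "K (P x) = P (K x)" and WK: "K (W x) = W (K x)" for x
    by (rule riesz_projection_intertwine[OF R R KU])+
  have KUk: "K (opow U k x) = opow U k (K x)" for k x by (rule opow_commute[OF KU])
  have linD: "clinear_op (D k)" for k
    unfolding D_def by (intro clinear_op_compose clinear_op_opow linU K lin)
  have KD: "K (D k x) = D k (K x)" for k x by (simp add: D_def KUk PK)
  have Dn: "D n x = 0" for x by (simp add: D_def PK[symmetric] KUk[symmetric] P)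
  have D_Suc: "D (Suc k) x = D k x + t *\<^sub>C K (D k x)" for k x by (simp add: D_def Ux)
  \<comment> \<open>The ratio of consecutive coefficients is what makes the sum telescope after
    multiplication by 1 + (t + \<sigma>) K.\<close>
  have \<psi>_Suc: "(t + \<sigma>) / t * \<psi> k = \<sigma> / t * \<psi> (Suc k)" for k
    using t \<sigma> by (simp add: \<psi>_def laurent_coeff_def field_simps)
  define XN where "XN = (\<Sum>k<n. \<psi> k *\<^sub>C D k)"
  have XNx: "XN x = (\<Sum>k<n. \<psi> k *\<^sub>C D k x)" for x
    by (simp add: XN_def blinfun.sum_left)
  have linXN: "clinear_op XN"
    unfolding XN_def by (intro clinear_op_sum clinear_op_scaleC linD)
  have KXN: "K (XN x) = XN (K x)" for x
    using K by (simp add: XNx blinfun.sum_right KD clinear_op_def)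
  have XN: "XN x + (t + \<sigma>) *\<^sub>C K (XN x) = K (P x)" for x
  proof -
    have "(t + \<sigma>) *\<^sub>C K v = ((t + \<sigma>) / t) *\<^sub>C (t *\<^sub>C K v)" for v
      using t by (simp add: scaleC_scaleC)
    then have *: "(t + \<sigma>) *\<^sub>C K (D k x) = ((t + \<sigma>) / t) *\<^sub>C (D (Suc k) x - D k x)" for k
      by (simp add: D_Suc)
    have "\<psi> k *\<^sub>C D k x + (t + \<sigma>) *\<^sub>C K (\<psi> k *\<^sub>C D k x) =
        (\<sigma> / t) *\<^sub>C (\<psi> (Suc k) *\<^sub>C D (Suc k) x - \<psi> k *\<^sub>C D k x)" for k
    proof -
      have "(t + \<sigma>) *\<^sub>C K (\<psi> k *\<^sub>C D k x) = \<psi> k *\<^sub>C ((t + \<sigma>) *\<^sub>C K (D k x))"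
        using K by (simp add: clinear_op_def scaleC_scaleC mult.commute)
      also have "\<dots> = ((t + \<sigma>) / t * \<psi> k) *\<^sub>C D (Suc k) x - ((t + \<sigma>) / t * \<psi> k) *\<^sub>C D k x"
        unfolding * by (simp add: scaleC.diff_right scaleC_scaleC mult.commute)
      also have "(t + \<sigma>) / t * \<psi> k = \<sigma> / t * \<psi> (Suc k)" by (rule \<psi>_Suc)
      also have "(\<sigma> / t * \<psi> (Suc k)) *\<^sub>C D k x = \<psi> k *\<^sub>C D k x + (\<sigma> / t * \<psi> k) *\<^sub>C D k x"
        unfolding \<psi>_Suc[symmetric] scaleC.add_left[symmetric] using t by (simp add: field_simps)
      finally show ?thesis by (simp add: scaleC.diff_right scaleC_scaleC)
    qed
    then have "XN x + (t + \<sigma>) *\<^sub>C K (XN x) =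
        (\<Sum>k<n. (\<sigma> / t) *\<^sub>C (\<psi> (Suc k) *\<^sub>C D (Suc k) x - \<psi> k *\<^sub>C D k x))"
      by (simp add: XNx blinfun.sum_right scaleC.sum_right flip: sum.distrib)
    \<comment> \<open>The upper end vanishes since U^n kills the range of \<open>P\<close>; at the
      lower end \<psi>_0 = - t/\<sigma> cancels the prefactor and leaves K P.\<close>
    also have "\<dots> = (\<sigma> / t) *\<^sub>C (\<psi> n *\<^sub>C D n x - \<psi> 0 *\<^sub>C D 0 x)"
      using sum_lessThan_telescope[of "\<lambda>k. \<psi> k *\<^sub>C D k x" n] by (simp add: scaleC.sum_right[symmetric])
    also have "\<dots> = K (P x)"
    proof -
      have "D 0 x = K (P x)" "\<psi> 0 = - (t / \<sigma>)" by (simp_all add: D_def \<psi>_def laurent_coeff_def)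
      then show ?thesis
        using t \<sigma> by (simp add: Dn scaleC.zero_right scaleC.minus_left scaleC_scaleC)
    qed
    finally show ?thesis .
  qed
  \<comment> \<open>The regular part: \<open>h\<close> takes values in the kernel of
    \<open>P\<close> and vanishes on its range, and there it accounts for the remaining K - K
    P.\<close>
  have h1: "h x + \<sigma> *\<^sub>C h (W (K x)) = W (K x)" and h2: "h x + \<sigma> *\<^sub>C W (K (h x)) = W (K x)"
    and linh: "clinear_op h" for x using h by (auto simp: is_resolvent_family_def)
  have h1': "h x = W (K x) - \<sigma> *\<^sub>C h (W (K x))" and h2': "h x = W (K x) - \<sigma> *\<^sub>C W (K (h x))" for x
    using h1[of x] h2[of x] by (simp_all add: eq_diff_eq)
  have Ph: "P (h x) = 0" for x
    using arg_cong[OF h2'[of x], of P] lin(1)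
    by (simp add: blinfun.diff_right P clinear_op_def scaleC.zero_right)
  have hP: "h (P x) = 0" for x
  proof -
    have "W (K (P x)) = 0" by (simp add: WK[symmetric] P)
    then show ?thesis using h1'[of "P x"] by (simp add: scaleC.zero_right)
  qed
  have H1: "h x + (t + \<sigma>) *\<^sub>C K (h x) = K x - K (P x)" for x
  proof -
    have "U (h x) = U (W (K x)) - \<sigma> *\<^sub>C U (W (K (h x)))"
      using arg_cong[OF h2'[of x], of U] linU by (simp add: blinfun.diff_right clinear_op_def)
    also have "\<dots> = K x - K (P x) - \<sigma> *\<^sub>C K (h x)"
      by (simp add: P PK[symmetric] Ph)
    finally show ?thesis by (simp add: Ux scaleC.add_left algebra_simps)
  qed
  have H2: "h x + (t + \<sigma>) *\<^sub>C h (K x) = K x - K (P x)" for x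
  proof -
    have "W (K (U x)) = K x - K (P x)" by (simp add: WK[symmetric] P blinfun.diff_right)
    then have "h (U x) = (K x - K (P x)) - \<sigma> *\<^sub>C (h (K x) - h (P (K x)))"
      using h1'[of "U x"] by (simp add: blinfun.diff_right PK)
    then show ?thesis
      using linh by (simp add: hP Ux blinfun.add_right clinear_op_def scaleC.add_left algebra_simps)
  qed
  have "is_resolvent_family K (t + \<sigma>) (XN + h)"
    unfolding is_resolvent_family_def
  proof (intro conjI allI clinear_op_add linXN linh)
    fix x
    show "(XN + h) x + (t + \<sigma>) *\<^sub>C (XN + h) (K x) = K x"
      using arg_cong2[OF XN[of x] H2[of x], of "(+)"]
      by (simp add: KXN blinfun.add_left scaleC.add_right add_ac)
    show "(XN + h) x + (t + \<sigma>) *\<^sub>C K ((XN + h) x) = K x"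
      using arg_cong2[OF XN[of x] H1[of x], of "(+)"]
      by (simp add: blinfun.add_left blinfun.add_right scaleC.add_right add_ac)
  qed
  then show ?thesis by (simp add: XN_def \<psi>_def D_def U_def)
qed

section \<open>Meromorphic continuation and residues\<close>

lemma complex_differentiable_at_tendsto:
  assumes "complex_differentiable_at f s"
  shows "(f \<longlongrightarrow> f s) (at s)"
proof -
  obtain D where D: "((\<lambda>w. inverse (w - s) *\<^sub>C (f w - f s)) \<longlongrightarrow> D) (at s)"
    using assms unfolding complex_differentiable_at_def by blast
  have "((\<lambda>w. w - s) \<longlongrightarrow> s - s) (at s)" by (intro tendsto_intros)
  from scaleC.tendsto[OF this D]
  have "((\<lambda>w. (w - s) *\<^sub>C inverse (w - s) *\<^sub>C (f w - f s)) \<longlongrightarrow> 0) (at s)"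
    by (simp add: scaleC.zero_left)
  then have "((\<lambda>w. f w - f s) \<longlongrightarrow> 0) (at s)"
    by (rule Lim_transform_eventually)
      (auto simp: eventually_at scaleC_scaleC intro!: exI[of _ 1])
  then show ?thesis by (simp add: Lim_null[symmetric])
qed

lemma complex_differentiable_at_shift:
  assumes "complex_differentiable_at f (s - a)"
  shows "complex_differentiable_at (\<lambda>w. f (w - a)) s"
proof -
  obtain D where "((\<lambda>w. inverse (w - (s - a)) *\<^sub>C (f w - f (s - a))) \<longlongrightarrow> D) (at (s - a))"
    using assms unfolding complex_differentiable_at_def by blast
  from LIM_offset[OF this, of "- a"]
  have "((\<lambda>w. inverse (w - s) *\<^sub>C (f (w - a) - f (s - a))) \<longlongrightarrow> D) (at s)"
    by (simp add: algebra_simps)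
  then show ?thesis unfolding complex_differentiable_at_def by blast
qed

text \<open>Testing against vectors reduces the identity theorem and Cauchy's theorem for
  operator-valued functions to the scalar ones.\<close>

lemma complex_differentiable_at_cinner:
  fixes f :: "complex \<Rightarrow> 'a::complex_normed_vector \<Rightarrow>\<^sub>L 'b::complex_inner"
  assumes "complex_differentiable_at f s"
  shows "(\<lambda>w. cinner y (f w x)) field_differentiable at s"
proof -
  obtain D where D: "((\<lambda>w. inverse (w - s) *\<^sub>C (f w - f s)) \<longlongrightarrow> D) (at s)"
    using assms unfolding complex_differentiable_at_def by blast
  have "((\<lambda>w. cinner y ((inverse (w - s) *\<^sub>C (f w - f s)) x)) \<longlongrightarrow> cinner y (D x)) (at s)"
    by (intro cinner.tendsto blinfun.tendsto D tendsto_const)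
  then have "((\<lambda>w. (cinner y (f w x) - cinner y (f s x)) / (w - s)) \<longlongrightarrow> cinner y (D x)) (at s)"
    by (simp add: cinner_scaleC_right blinfun.diff_left cinner.diff_right divide_inverse mult.commute)
  then show ?thesis
    unfolding field_differentiable_def has_field_derivative_iff by blast
qed

text \<open>Removing the two discrete exceptional sets leaves the plane open and connected, so the
  identity theorem applies to every matrix element. At exceptional points the values are arbitrary,
  hence the restriction on z.\<close>

lemma meromorphic_off_unique:
  fixes f g :: "complex \<Rightarrow> 'a::complex_normed_vector \<Rightarrow>\<^sub>L 'b::complex_inner"
  assumes f: "meromorphic_off S f" and g: "meromorphic_off S' g"
    and U: "\<xi> islimpt U" "\<xi> \<notin> S \<union> S'" "U \<inter> (S \<union> S') = {}" "\<And>z. z \<in> U \<Longrightarrow> f z = g z"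
    and z: "z \<notin> S \<union> S'"
  shows "f z = g z"
proof -
  define T where "T = S \<union> S'"
  have "T sparse_in UNIV"
    using f g unfolding T_def meromorphic_off_def by (auto simp: sparse_in_open islimpt_Un)
  then have "open (UNIV - T)" "connected (UNIV - T)"
    by (auto intro!: open_diff_sparse_pts sparse_imp_connected)
  then have T: "open (- T)" "connected (- T)" by (simp_all add: Compl_eq_Diff_UNIV)
  have "cinner y ((f z - g z) x) = 0" for x y
  proof (rule analytic_continuation[of "\<lambda>w. cinner y (f w x) - cinner y (g w x)" "- T" U \<xi> z,
        unfolded cinner.diff_right[symmetric] blinfun.diff_left[symmetric]])
    have "(\<lambda>w. cinner y (f w x) - cinner y (g w x)) field_differentiable at w" if "w \<in> - T" for w
      using that f g unfolding T_def meromorphic_off_def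
      by (intro field_differentiable_diff complex_differentiable_at_cinner) auto
    then show "(\<lambda>w. cinner y ((f w - g w) x)) holomorphic_on - T"
      unfolding holomorphic_on_def blinfun.diff_left cinner.diff_right
      by (blast intro: field_differentiable_at_within)
  qed (use T U z in \<open>auto simp: T_def\<close>)
  then have "(f z - g z) x = 0" for x using cinner_eq_zeroD by blast
  then show ?thesis by (intro blinfun_eqI) (simp add: blinfun.diff_left)
qed

text \<open>The holomorphic remainder is the resolvent family of \<open>W o\<^sub>L K\<close> around
  the parameter 0; the radius is the one on which the contraction argument for that operator
  works.\<close>

lemma resolvent_family_near_pole:
  fixes K :: "'a::{complex_normed_vector,banach} \<Rightarrow>\<^sub>L 'a"
  assumes K: "clinear_op K" and t: "t \<noteq> 0"
    and R: "riesz_projection (id_blinfun + t *\<^sub>C K) n W P"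
  shows "\<exists>e>0. \<exists>h. (\<forall>\<sigma>. cmod \<sigma> < e \<longrightarrow> complex_differentiable_at h \<sigma>) \<and>
    (\<forall>\<sigma>. \<sigma> \<noteq> 0 \<longrightarrow> cmod \<sigma> < e \<longrightarrow> is_resolvent_family K (t + \<sigma>)
      ((\<Sum>k<n. laurent_coeff t k \<sigma> *\<^sub>C (opow (id_blinfun + t *\<^sub>C K) k o\<^sub>L (K o\<^sub>L P))) + h \<sigma>))"
proof -
  define L where "L = W o\<^sub>L K"
  have "clinear_op W"
    by (rule riesz_projection_clinear[OF R]) (intro clinear_op_add clinear_op_id clinear_op_scaleC K)
  then have L: "clinear_op L" unfolding L_def by (intro clinear_op_compose K)
  obtain e where e: "e > 0" "e * norm L < 1"
  proof (cases "L = 0")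
    case False
    then show thesis using that[of "1 / (2 * norm L)"] by simp
  qed (use that[of 1] in simp)
  have "\<exists>X. is_resolvent_family L \<sigma> X" if "cmod \<sigma> < e" for \<sigma>
  proof (rule is_resolvent_family_exists[OF L])
    have "cmod \<sigma> * norm L \<le> e * norm L" using that by (intro mult_right_mono) auto
    then show "cmod \<sigma> * norm L < 1" using e(2) by linarith
  qed
  then have h: "is_resolvent_family L \<sigma> (resolvent_family L \<sigma>)" if "cmod \<sigma> < e" for \<sigma>
    using resolvent_family_eq that by metis
  have "complex_differentiable_at (resolvent_family L) \<sigma>" if "cmod \<sigma> < e" for \<sigma>
    by (rule resolvent_family_differentiable(2)[OF L h[OF that]])
  moreover have "is_resolvent_family K (t + \<sigma>) ((\<Sum>k<n. laurent_coeff t k \<sigma> *\<^sub>C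
      (opow (id_blinfun + t *\<^sub>C K) k o\<^sub>L (K o\<^sub>L P))) + resolvent_family L \<sigma>)"
    if "\<sigma> \<noteq> 0" "cmod \<sigma> < e" for \<sigma>
    by (rule is_resolvent_family_laurent[OF K t that(1) R h[OF that(2), unfolded L_def], folded L_def])
  ultimately show ?thesis
    using e(1) by (intro exI[of _ e] conjI exI[of _ "resolvent_family L"]) auto
qed

lemma seq_compact_op_riesz_projection:
  fixes K :: "'a::complex_hilbert \<Rightarrow>\<^sub>L 'a"
  assumes "seq_compact_op K"
  shows "\<exists>n W P. riesz_projection (id_blinfun + t *\<^sub>C K) n W P"
proof -
  have "id_blinfun - (id_blinfun + t *\<^sub>C K) = (- t) *\<^sub>C K" by (simp add: scaleC.minus_left)
  then show ?thesis
    using riesz_projection_exists seq_compact_op_scaleC[OF assms] by metis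
qed

text \<open>The pole of the k-th coefficient has order at most k + 1 \<le> n. Writing the limit with
  a power of 0 treats k = n - 1 and smaller k alike.\<close>

lemma laurent_coeff_pole:
  assumes "k < n"
  shows "((\<lambda>\<sigma>. \<sigma> ^ n * laurent_coeff t k \<sigma>) \<longlongrightarrow> - t * 0 ^ (n - 1 - k) * (0 + t) ^ k) (at 0)"
proof (rule Lim_transform_eventually)
  show "((\<lambda>\<sigma>. - t * \<sigma> ^ (n - 1 - k) * (\<sigma> + t) ^ k) \<longlongrightarrow> - t * 0 ^ (n - 1 - k) * (0 + t) ^ k) (at 0)"
    by (intro tendsto_intros)
  have "- t * \<sigma> ^ (n - 1 - k) * (\<sigma> + t) ^ k = \<sigma> ^ n * laurent_coeff t k \<sigma>" if "\<sigma> \<noteq> 0" for \<sigma>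
  proof -
    have "n = Suc ((n - 1 - k) + k)" using assms by simp
    then have "\<sigma> ^ n = \<sigma> * (\<sigma> ^ (n - 1 - k) * \<sigma> ^ k)" by (metis power_Suc power_add)
    moreover have "\<sigma> ^ k * (1 + t / \<sigma>) ^ k = (\<sigma> + t) ^ k"
      using that by (simp add: power_mult_distrib[symmetric] distrib_left)
    ultimately show ?thesis
      using that by (simp add: laurent_coeff_def)
  qed
  then show "\<forall>\<^sub>F \<sigma> in at 0. - t * \<sigma> ^ (n - 1 - k) * (\<sigma> + t) ^ k = \<sigma> ^ n * laurent_coeff t k \<sigma>"
    by (auto simp: eventually_at intro!: exI[of _ 1])
qed

text \<open>Analytic Fredholm theory in this special case: nilpotency on the range of the Riesz
  projection makes the principal part finite, so singular points are isolated poles.\<close>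

lemma resolvent_family_meromorphic:
  fixes K :: "'a::complex_hilbert \<Rightarrow>\<^sub>L 'a"
  assumes K: "clinear_op K" "seq_compact_op K"
  shows "meromorphic_off {s. \<nexists>X. is_resolvent_family K (s - a) X} (\<lambda>s. resolvent_family K (s - a))"
    (is "meromorphic_off ?S ?g")
  unfolding meromorphic_off_def
proof (intro conjI allI impI ballI)
  fix s
  have "\<forall>\<^sub>F w in at s. w \<notin> ?S"
  proof (cases "s - a = 0")
    \<comment> \<open>The Laurent expansion divides by s - a, so the centre is treated apart; there
      the family is regular with value \<open>K\<close>.\<close>
    case True
    have "\<forall>\<^sub>F w in nhds 0. \<exists>X. is_resolvent_family K w X"
      by (rule resolvent_family_differentiable(1)[OF K(1) is_resolvent_family_zero[OF K(1)]])
    then obtain e where "e > 0" "\<And>w. dist w 0 < e \<Longrightarrow> \<exists>X. is_resolvent_family K w X"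
      unfolding eventually_nhds_metric by blast
    then show ?thesis using True
      unfolding eventually_at by (intro exI[of _ e]) (auto simp: dist_norm)
  next
    case False
    obtain n W P where "riesz_projection (id_blinfun + (s - a) *\<^sub>C K) n W P"
      using seq_compact_op_riesz_projection[OF K(2)] by blast
    from resolvent_family_near_pole[OF K(1) False this]
    obtain e where e: "e > 0" "\<And>\<sigma>. \<sigma> \<noteq> 0 \<Longrightarrow> cmod \<sigma> < e \<Longrightarrow> \<exists>X. is_resolvent_family K (s - a + \<sigma>) X"
      by blast
    have "w \<notin> ?S" if "w \<noteq> s" "dist w s < e" for w
      using e(2)[of "w - s"] that by (simp add: dist_norm algebra_simps)
    then show ?thesis unfolding eventually_at using e(1) by blast
  qed
  then show "\<not> s islimpt ?S" by (simp add: islimpt_iff_eventually)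
next
  fix s assume "s \<notin> ?S"
  then show "complex_differentiable_at ?g s"
    using resolvent_family_differentiable(2)[OF K(1)] by (auto intro: complex_differentiable_at_shift)
next
  fix s assume "s \<in> ?S"
  then have t: "s - a \<noteq> 0" using is_resolvent_family_zero[OF K(1)] by auto
  define t where "t = s - a"
  obtain n W P where "riesz_projection (id_blinfun + t *\<^sub>C K) n W P"
    using seq_compact_op_riesz_projection[OF K(2)] by blast
  from resolvent_family_near_pole[OF K(1) t[folded t_def] this]
  obtain e h where e: "e > 0" and hd: "\<And>\<sigma>. cmod \<sigma> < e \<Longrightarrow> complex_differentiable_at h \<sigma>"
    and h: "\<And>\<sigma>. \<sigma> \<noteq> 0 \<Longrightarrow> cmod \<sigma> < e \<Longrightarrow> is_resolvent_family K (t + \<sigma>)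
      ((\<Sum>k<n. laurent_coeff t k \<sigma> *\<^sub>C (opow (id_blinfun + t *\<^sub>C K) k o\<^sub>L (K o\<^sub>L P))) + h \<sigma>)"
    by blast
  define D where "D k = opow (id_blinfun + t *\<^sub>C K) k o\<^sub>L (K o\<^sub>L P)" for k
  define L where "L = (\<Sum>k<n. (- t * 0 ^ (n - 1 - k) * (0 + t) ^ k) *\<^sub>C D k) + 0 ^ n *\<^sub>C h 0"
  have "((\<lambda>\<sigma>. (\<Sum>k<n. (\<sigma> ^ n * laurent_coeff t k \<sigma>) *\<^sub>C D k) + \<sigma> ^ n *\<^sub>C h \<sigma>) \<longlongrightarrow> L) (at 0)"
    unfolding L_def using hd[of 0] e
    by (intro tendsto_add tendsto_sum scaleC.tendsto tendsto_const laurent_coeff_pole tendsto_power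
        tendsto_ident_at complex_differentiable_at_tendsto) auto
  then have "((\<lambda>\<sigma>. \<sigma> ^ n *\<^sub>C resolvent_family K (t + \<sigma>)) \<longlongrightarrow> L) (at 0)"
  proof (rule Lim_transform_eventually)
    have "(\<Sum>k<n. (\<sigma> ^ n * laurent_coeff t k \<sigma>) *\<^sub>C D k) + \<sigma> ^ n *\<^sub>C h \<sigma> = \<sigma> ^ n *\<^sub>C resolvent_family K (t + \<sigma>)"
      if "\<sigma> \<noteq> 0" "dist \<sigma> 0 < e" for \<sigma>
      using resolvent_family_eq[OF h[OF that(1)]] that(2)
      by (simp add: D_def scaleC.add_right scaleC.sum_right scaleC_scaleC)
    then show "\<forall>\<^sub>F \<sigma> in at 0. (\<Sum>k<n. (\<sigma> ^ n * laurent_coeff t k \<sigma>) *\<^sub>C D k) + \<sigma> ^ n *\<^sub>C h \<sigma> =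
        \<sigma> ^ n *\<^sub>C resolvent_family K (t + \<sigma>)"
      unfolding eventually_at using e by blast
  qed
  from LIM_offset[OF this, of "- s"]
  have "((\<lambda>w. (w - s) ^ n *\<^sub>C ?g w) \<longlongrightarrow> L) (at s)"
    by (simp add: t_def algebra_simps)
  then show "\<exists>n L. ((\<lambda>w. (w - s) ^ n *\<^sub>C ?g w) \<longlongrightarrow> L) (at s)" by blast
qed

section \<open>Contour integrals and residues\<close>

lemma has_contour_integral_laurent_coeff:
  assumes "r > 0"
  shows "((\<lambda>w. laurent_coeff t k (w - s)) has_contour_integral (2 * complex_of_real pi * \<i>) * (- t)) (circlepath s r)"
proof (induction k)
  case 0
  have "((\<lambda>w. - t / (w - s)) has_contour_integral (2 * of_real pi * \<i> * (- t))) (circlepath s r)"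
    by (rule Cauchy_integral_circlepath_simple) (use assms in auto)
  then show ?case by (simp add: laurent_coeff_def)
next
  case (Suc k)
  \<comment> \<open>A primitive, on the punctured plane, of the difference of consecutive
    coefficients. All of them therefore have the same integral as the first, - t/(w - s).\<close>
  define f where "f w = t / of_nat (Suc k) * (1 + t / (w - s)) ^ Suc k" for w
  define f' where "f' w = laurent_coeff t (Suc k) (w - s) - laurent_coeff t k (w - s)" for w
  have "(f has_field_derivative f' w) (at w within - {s})" if "w \<in> - {s}" for w
  proof -
    have ne: "w - s \<noteq> 0" using that by simp
    have "((\<lambda>w. 1 + t / (w - s)) has_field_derivative - t / (w - s)\<^sup>2) (at w within - {s})"
      using ne by (auto intro!: derivative_eq_intros simp: power2_eq_square)
    from DERIV_power[OF this, of "Suc k"]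
    have "((\<lambda>w. (1 + t / (w - s)) ^ Suc k) has_field_derivative
        of_nat (Suc k) * ((1 + t / (w - s)) ^ k * (- t / (w - s)\<^sup>2))) (at w within - {s})"
      by (simp only: diff_Suc_Suc diff_zero mult.commute)
    from DERIV_cmult[OF this, of "t / of_nat (Suc k)"]
    have "(f has_field_derivative t / of_nat (Suc k) * (of_nat (Suc k) * ((1 + t / (w - s)) ^ k * (- t / (w - s)\<^sup>2))))
        (at w within - {s})" unfolding f_def .
    moreover have "t / of_nat (Suc k) * (of_nat (Suc k) * ((1 + t / (w - s)) ^ k * (- t / (w - s)\<^sup>2))) = f' w"
    proof -
      have "t / of_nat (Suc k) * (of_nat (Suc k) * X) = t * X" for X :: complex
        using of_nat_neq_0[of k, where 'a = complex] by (simp del: of_nat_Suc)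
      then have "t / of_nat (Suc k) * (of_nat (Suc k) * ((1 + t / (w - s)) ^ k * (- t / (w - s)\<^sup>2))) =
          t * ((1 + t / (w - s)) ^ k * (- t / (w - s)\<^sup>2))" .
      also have "\<dots> = f' w"
        by (simp add: f'_def laurent_coeff_def power2_eq_square algebra_simps)
      finally show ?thesis .
    qed
    ultimately show ?thesis by simp
  qed
  then have "(f' has_contour_integral 0) (circlepath s r)"
    by (rule Cauchy_theorem_primitive) (use assms in auto)
  from has_contour_integral_add[OF this Suc] show ?case by (simp add: f'_def)
qed

lemma has_vector_contour_integral_scaleC:
  assumes "(\<phi> has_contour_integral i) g"
  shows "has_vector_contour_integral (\<lambda>w. \<phi> w *\<^sub>C (D :: 'b::complex_normed_vector)) (i *\<^sub>C D) g"
proof -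
  have "((\<lambda>x. \<phi> (g x) * vector_derivative g (at x within {0..1})) has_integral i) {0..1}"
    using assms by (simp add: has_contour_integral_def)
  from has_integral_linear[OF this scaleC.bounded_linear_left[of D]]
  show ?thesis
    unfolding has_vector_contour_integral_def
    by (simp add: o_def scaleC_scaleC mult.commute)
qed

lemma has_vector_contour_integral_add:
  assumes "has_vector_contour_integral f i g" "has_vector_contour_integral f' i' g"
  shows "has_vector_contour_integral (\<lambda>w. f w + f' w) (i + i') g"
  using has_integral_add[OF assms[unfolded has_vector_contour_integral_def]]
  by (simp add: has_vector_contour_integral_def scaleC.add_right)

lemma has_vector_contour_integral_sum:
  assumes "finite I" "\<And>k. k \<in> I \<Longrightarrow> has_vector_contour_integral (f k) (i k) g"
  shows "has_vector_contour_integral (\<lambda>w. \<Sum>k\<in>I. f k w) (\<Sum>k\<in>I. i k) g"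
  using assms
  by (induction I rule: finite_induct)
    (auto simp: has_vector_contour_integral_add,
      simp add: has_vector_contour_integral_def scaleC.zero_right)

text \<open>Continuity along the circle gives existence of the integral; only its value is found by
  testing against vectors.\<close>

lemma vector_Cauchy_circlepath:
  fixes f :: "complex \<Rightarrow> 'a::complex_normed_vector \<Rightarrow>\<^sub>L 'b::complex_hilbert"
  assumes f: "\<And>w. w \<in> ball s e \<Longrightarrow> complex_differentiable_at f w" and r: "0 < r" "r < e"
  shows "has_vector_contour_integral f 0 (circlepath s r)"
proof -
  let ?g = "circlepath s r"
  have img: "?g x \<in> ball s e" if "x \<in> {0..1}" for x
  proof -
    have "?g x \<in> path_image ?g" using that by (auto simp: path_image_def)
    then show ?thesis using r by (auto simp: dist_norm)
  qed
  have cf: "continuous_on (ball s e) f"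
    unfolding continuous_on_def
    using f complex_differentiable_at_tendsto by (metis tendsto_within_subset subset_UNIV)
  have cg: "continuous_on {0..1} ?g"
    using valid_path_imp_path[OF valid_path_circlepath[of s r]] by (simp add: path_def)
  have "continuous_on {0..1} (\<lambda>x. f (?g x))"
    by (rule continuous_on_compose2[OF cf cg]) (use img in auto)
  moreover have "continuous_on {0..1} (\<lambda>x. vector_derivative ?g (at x within {0..1}))"
    by (subst continuous_on_cong[OF refl vector_derivative_circlepath01])
      (auto intro!: continuous_intros)
  ultimately have "continuous_on {0..1} (\<lambda>x. vector_derivative ?g (at x within {0..1}) *\<^sub>C f (?g x))"
    by (intro scaleC.continuous_on)
  then obtain I where I: "has_vector_contour_integral f I ?g"
    unfolding has_vector_contour_integral_def
    using integrable_continuous_real unfolding integrable_on_def by blast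
  have "cinner y (I x) = 0" for x y
  proof -
    have "bounded_linear (\<lambda>A :: 'a \<Rightarrow>\<^sub>L 'b. cinner y (A x))"
      using bounded_linear_compose[OF cinner.bounded_linear_right[of y] blinfun.bounded_linear_left[of x]]
      by simp
    from has_integral_linear[OF I[unfolded has_vector_contour_integral_def] this]
    have "((\<lambda>w. cinner y (f w x)) has_contour_integral cinner y (I x)) ?g"
      unfolding has_contour_integral_def by (simp add: o_def cinner_scaleC_right mult.commute)
    moreover have "((\<lambda>w. cinner y (f w x)) has_contour_integral 0) ?g"
    proof (rule Cauchy_theorem_disc_simple[of _ s e])
      show "(\<lambda>w. cinner y (f w x)) holomorphic_on ball s e"
        unfolding holomorphic_on_def
        using f complex_differentiable_at_cinner field_differentiable_at_within by blast
    qed (use r in \<open>auto simp: dist_norm\<close>)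
    ultimately show ?thesis by (rule has_contour_integral_unique)
  qed
  then have "I x = 0" for x using cinner_eq_zeroD by blast
  then have "I = 0" by (intro blinfun_eqI) simp
  then show ?thesis using I by simp
qed

lemma scaleC_left_cancel:
  assumes "a \<noteq> 0" "a *\<^sub>C x = a *\<^sub>C y"
  shows "x = y"
proof -
  have "inverse a *\<^sub>C a *\<^sub>C x = inverse a *\<^sub>C a *\<^sub>C y" using assms(2) by simp
  then show ?thesis using assms(1) by (simp add: scaleC_scaleC)
qed

text \<open>The choice in \<open>vector_residue\<close> is forced, since any two candidates share a
  small circle, on which the integral is unique.\<close>

lemma vector_residue_eqI:
  fixes f :: "complex \<Rightarrow> 'b::complex_normed_vector"
  assumes "e > 0"
    and "\<And>r. 0 < r \<Longrightarrow> r < e \<Longrightarrow>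
      has_vector_contour_integral f ((2 * complex_of_real pi * \<i>) *\<^sub>C R) (circlepath z r)"
  shows "vector_residue f z = R"
  unfolding vector_residue_def
proof (rule some_equality)
  show "\<exists>e>0. \<forall>\<epsilon>>0. \<epsilon> < e \<longrightarrow>
      has_vector_contour_integral f ((2 * complex_of_real pi * \<i>) *\<^sub>C R) (circlepath z \<epsilon>)"
    using assms by blast
next
  fix R' assume "\<exists>e>0. \<forall>\<epsilon>>0. \<epsilon> < e \<longrightarrow>
      has_vector_contour_integral f ((2 * complex_of_real pi * \<i>) *\<^sub>C R') (circlepath z \<epsilon>)"
  then obtain e' where e': "e' > 0" "\<And>r. 0 < r \<Longrightarrow> r < e' \<Longrightarrow>
      has_vector_contour_integral f ((2 * complex_of_real pi * \<i>) *\<^sub>C R') (circlepath z r)"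
    by blast
  define r where "r = min e e' / 2"
  have r: "0 < r" "r < e" "r < e'" using assms(1) e'(1) by (auto simp: r_def)
  have "(2 * complex_of_real pi * \<i>) *\<^sub>C R' = (2 * complex_of_real pi * \<i>) *\<^sub>C R"
    using assms(2)[OF r(1,2)] e'(2)[OF r(1,3)] has_integral_unique
    unfolding has_vector_contour_integral_def by blast
  then show "R' = R" by (rule scaleC_left_cancel[rotated]) simp
qed

text \<open>Each Laurent coefficient contributes its residue -t, and -t K = 1 - U turns the sum into
  a telescoping one that ends at U^n P = 0.\<close>

lemma sum_principal_part:
  fixes K :: "'a::complex_normed_vector \<Rightarrow>\<^sub>L 'a"
  assumes K: "clinear_op K" and R: "riesz_projection (id_blinfun + t *\<^sub>C K) n W P"
  shows "(\<Sum>k<n. (- t) *\<^sub>C (opow (id_blinfun + t *\<^sub>C K) k o\<^sub>L (K o\<^sub>L P))) = P"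
proof (rule blinfun_eqI)
  fix x
  define U where "U = id_blinfun + t *\<^sub>C K"
  have Un: "opow U n (P x) = 0" using R by (simp add: riesz_projection_def U_def)
  have "clinear_op U" unfolding U_def by (intro clinear_op_add clinear_op_id clinear_op_scaleC K)
  then have lin: "clinear_op (opow U k)" for k by (rule clinear_op_opow)
  have *: "(- t) *\<^sub>C opow U k (K (P x)) = - (opow U (Suc k) (P x) - opow U k (P x))" for k
  proof -
    have "t *\<^sub>C opow U k (K (P x)) = opow U k (t *\<^sub>C K (P x))"
      using lin[of k] by (simp add: clinear_op_def)
    also have "t *\<^sub>C K (P x) = U (P x) - P x" by (simp add: U_def blinfun.add_left)
    finally show ?thesis
      by (simp only: opow_Suc_right blinfun.diff_right scaleC.minus_left)
  qed
  have "(\<Sum>k<n. - (opow U (Suc k) (P x) - opow U k (P x))) = P x"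
    by (simp only: sum_negf sum_lessThan_telescope[of "\<lambda>k. opow U k (P x)" n] Un) simp
  then show "(\<Sum>k<n. (- t) *\<^sub>C (opow (id_blinfun + t *\<^sub>C K) k o\<^sub>L (K o\<^sub>L P))) x = P x"
    unfolding U_def[symmetric] blinfun.sum_left
    by (simp only: scaleC_blinfun_apply blinfun_apply_blinfun_compose *)
qed

lemma meromorphic_residue_eq_riesz_projection:
  fixes K :: "'a::complex_hilbert \<Rightarrow>\<^sub>L 'a"
  assumes K: "clinear_op K" "seq_compact_op K"
    and \<delta>: "\<delta> > 0" "\<And>s. \<bar>s - r0\<bar> < \<delta> \<Longrightarrow> s \<in> R"
    and f: "\<And>s. s \<in> R \<Longrightarrow> is_resolvent_family K (complex_of_real (s - r0)) (f s)"
    and r: "r \<noteq> r0"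
    and P: "riesz_projection (id_blinfun + complex_of_real (r - r0) *\<^sub>C K) n W P"
  shows "vector_residue (meromorphic_extension R f) (complex_of_real r) = P"
proof -
  define a where "a = complex_of_real r0"
  define t where "t = complex_of_real (r - r0)"
  define S where "S = {s. \<nexists>X. is_resolvent_family K (s - a) X}"
  define g0 where "g0 = (\<lambda>s. resolvent_family K (s - a))"
  define g where "g = meromorphic_extension R f"
  have t: "t \<noteq> 0" using r by (simp add: t_def)
  have g0: "meromorphic_off S g0"
    unfolding S_def g0_def by (rule resolvent_family_meromorphic[OF K])
  have g0R: "complex_of_real s \<notin> S" "g0 (complex_of_real s) = f s" if "s \<in> R" for s
    using f[OF that] resolvent_family_eq[OF f[OF that]] by (auto simp: S_def g0_def a_def)
  then have "is_meromorphic_extension R f g0"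
    unfolding is_meromorphic_extension_def using g0 by blast
  then have "is_meromorphic_extension R f g"
    unfolding g_def meromorphic_extension_def by (rule someI[of "is_meromorphic_extension R f"])
  then obtain S' where S': "meromorphic_off S' g"
    and gR: "\<And>s. s \<in> R \<Longrightarrow> complex_of_real s \<notin> S'" "\<And>s. s \<in> R \<Longrightarrow> g (complex_of_real s) = f s"
    unfolding is_meromorphic_extension_def by blast
  have eq: "g z = g0 z" if "z \<notin> S \<union> S'" for z
  proof (rule sym, rule meromorphic_off_unique[OF g0 S' _ _ _ _ that])
    \<comment> \<open>The interval of radius \<delta> around \<open>r0\<close> lies in
      \<open>R\<close>, so the two extensions agree on a set that accumulates at a regular point of
      both.\<close>
    show "a islimpt complex_of_real ` R"
      unfolding islimpt_approachable
    proof (intro allI impI)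
      fix e :: real assume "e > 0"
      define d where "d = min e \<delta> / 2"
      have d: "d > 0" "d < e" "d < \<delta>" using \<open>e > 0\<close> \<delta>(1) by (auto simp: d_def)
      have "r0 + d \<in> R" using d by (intro \<delta>(2)) simp
      moreover have "dist (complex_of_real (r0 + d)) a < e" "complex_of_real (r0 + d) \<noteq> a"
        using d by (auto simp: a_def dist_norm)
      ultimately show "\<exists>x'\<in>complex_of_real ` R. x' \<noteq> a \<and> dist x' a < e" by blast
    qed
    have "r0 \<in> R" using \<delta> by simp
    then show "a \<notin> S \<union> S'" using g0R gR by (auto simp: a_def)
    show "complex_of_real ` R \<inter> (S \<union> S') = {}" using g0R gR by blast
    show "g0 z = g z" if "z \<in> complex_of_real ` R" for z using that g0R gR by auto
  qed
  from resolvent_family_near_pole[OF K(1) t P[folded t_def]]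
  obtain e h where e: "e > 0" and hd: "\<And>\<sigma>. cmod \<sigma> < e \<Longrightarrow> complex_differentiable_at h \<sigma>"
    and h: "\<And>\<sigma>. \<sigma> \<noteq> 0 \<Longrightarrow> cmod \<sigma> < e \<Longrightarrow> is_resolvent_family K (t + \<sigma>)
      ((\<Sum>k<n. laurent_coeff t k \<sigma> *\<^sub>C (opow (id_blinfun + t *\<^sub>C K) k o\<^sub>L (K o\<^sub>L P))) + h \<sigma>)"
    by blast
  define D where "D k = opow (id_blinfun + t *\<^sub>C K) k o\<^sub>L (K o\<^sub>L P)" for k
  define z where "z = complex_of_real r"
  have za: "z - a = t" by (simp add: z_def a_def t_def)
  \<comment> \<open>The chosen extension may declare exceptional points of its own, so the circle
    has to stay clear of \<open>S'\<close> as well.\<close>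
  have "\<not> z islimpt S'" using S' by (simp add: meromorphic_off_def)
  then obtain e' where e': "e' > 0" "\<And>w. w \<noteq> z \<Longrightarrow> dist w z < e' \<Longrightarrow> w \<notin> S'"
    unfolding islimpt_approachable by blast
  have near: "g w = (\<Sum>k<n. laurent_coeff t k (w - z) *\<^sub>C D k) + h (w - z)"
    if w: "w \<noteq> z" "cmod (w - z) < e" "cmod (w - z) < e'" for w
  proof -
    have "is_resolvent_family K (w - a) ((\<Sum>k<n. laurent_coeff t k (w - z) *\<^sub>C D k) + h (w - z))"
      using h[of "w - z"] w za by (simp add: D_def algebra_simps)
    moreover from this have "w \<notin> S" by (auto simp: S_def)
    moreover have "w \<notin> S'" using e'(2) w by (simp add: dist_norm)
    ultimately show ?thesis using eq[of w] resolvent_family_eq by (auto simp: g0_def)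
  qed
  have "vector_residue g z = P"
  proof (rule vector_residue_eqI[of "min e e'"])
    fix \<rho> assume \<rho>: "0 < \<rho>" "\<rho> < min e e'"
    have "has_vector_contour_integral (\<lambda>w. \<Sum>k<n. laurent_coeff t k (w - z) *\<^sub>C D k)
        (\<Sum>k<n. ((2 * complex_of_real pi * \<i>) * (- t)) *\<^sub>C D k) (circlepath z \<rho>)"
      using \<rho>(1) by (intro has_vector_contour_integral_sum has_vector_contour_integral_scaleC
          has_contour_integral_laurent_coeff) auto
    moreover have "has_vector_contour_integral (\<lambda>w. h (w - z)) 0 (circlepath z \<rho>)"
      by (rule vector_Cauchy_circlepath[of z e])
        (use \<rho> hd in \<open>auto intro!: complex_differentiable_at_shift simp: dist_norm norm_minus_commute\<close>)
    ultimately have "has_vector_contour_integral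
        (\<lambda>w. (\<Sum>k<n. laurent_coeff t k (w - z) *\<^sub>C D k) + h (w - z))
        ((\<Sum>k<n. ((2 * complex_of_real pi * \<i>) * (- t)) *\<^sub>C D k) + 0) (circlepath z \<rho>)"
      by (rule has_vector_contour_integral_add)
    moreover have "(\<Sum>k<n. ((2 * complex_of_real pi * \<i>) * (- t)) *\<^sub>C D k) + 0 = (2 * complex_of_real pi * \<i>) *\<^sub>C P"
      using sum_principal_part[OF K(1) P[folded t_def], folded D_def]
      by (simp only: scaleC_scaleC[symmetric] scaleC.sum_right[symmetric] add_0_right)
    moreover have "g (circlepath z \<rho> x) =
        (\<Sum>k<n. laurent_coeff t k (circlepath z \<rho> x - z) *\<^sub>C D k) + h (circlepath z \<rho> x - z)"
      if "x \<in> {0..1}" for x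
    proof (rule near)
      have "circlepath z \<rho> x \<in> path_image (circlepath z \<rho>)" using that by (auto simp: path_image_def)
      then have "cmod (circlepath z \<rho> x - z) = \<rho>"
        using \<rho>(1) by (simp add: dist_norm norm_minus_commute)
      then show "circlepath z \<rho> x \<noteq> z" "cmod (circlepath z \<rho> x - z) < e" "cmod (circlepath z \<rho> x - z) < e'"
        using \<rho> by auto
    qed
    ultimately show "has_vector_contour_integral g ((2 * complex_of_real pi * \<i>) *\<^sub>C P) (circlepath z \<rho>)"
      unfolding has_vector_contour_integral_def by (metis (no_types, lifting) has_integral_cong)
  qed (use e e'(1) in simp)
  then show ?thesis by (simp add: g_def z_def)
qed

section \<open>Sesquilinear relations between the idempotents\<close>

text \<open>A relation suffices, because the adjoint of every operator in question is again one of
  the given operators.\<close>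

definition adjoint_pair :: "('a::complex_inner \<Rightarrow>\<^sub>L 'b::complex_inner) \<Rightarrow> ('b \<Rightarrow>\<^sub>L 'a) \<Rightarrow> bool" where
  "adjoint_pair A B \<longleftrightarrow> (\<forall>x y. cinner (A x) y = cinner x (B y))"

lemma adjoint_pairD: "adjoint_pair A B \<Longrightarrow> cinner (A x) y = cinner x (B y)"
  by (simp add: adjoint_pair_def)

lemma adjoint_pair_sym: "adjoint_pair A B \<Longrightarrow> adjoint_pair B A"
  unfolding adjoint_pair_def by (metis cinner_commute)

lemma adjoint_pair_compose:
  "adjoint_pair A A' \<Longrightarrow> adjoint_pair B B' \<Longrightarrow> adjoint_pair (A o\<^sub>L B) (B' o\<^sub>L A')"
  by (simp add: adjoint_pair_def)

lemma adjoint_pair_eq_iff: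
  assumes "adjoint_pair A A'" "adjoint_pair B B'"
  shows "A = B \<longleftrightarrow> A' = B'"
proof
  assume "A = B"
  then have "A' y = B' y" for y
    using assms by (intro cinner_ext) (simp add: adjoint_pair_def)
  then show "A' = B'" by (rule blinfun_eqI)
next
  assume "A' = B'"
  then have "A y = B y" for y
    using assms[THEN adjoint_pair_sym] by (intro cinner_ext) (simp add: adjoint_pair_def)
  then show "A = B" by (rule blinfun_eqI)
qed

lemma adjoint_pair_opow:
  "adjoint_pair U U' \<Longrightarrow> cinner (opow U k x) y = cinner x (opow U' k y)"
  by (induction k arbitrary: x y) (auto simp: adjoint_pair_def opow_commute[of U' U', symmetric])

text \<open>The kernel of \<open>P'\<close> lies in the range of every power of \<open>U'\<close>.
  Moving such a power to the other side hits a vector in the range of \<open>P\<close>, where it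
  gives zero; the symmetric argument handles the other cross term.\<close>

lemma adjoint_pair_riesz_projection:
  assumes R: "riesz_projection U n W P" and R': "riesz_projection U' n' W' P'"
    and adj: "adjoint_pair U U'"
  shows "adjoint_pair P P'"
  unfolding adjoint_pair_def
proof (intro allI)
  fix x y
  have P: "P (x - P x) = 0" "opow U n (P x) = 0"
    using R by (auto simp: riesz_projection_def blinfun.diff_right)
  have P': "P' (y - P' y) = 0" "opow U' n' (P' y) = 0"
    using R' by (auto simp: riesz_projection_def blinfun.diff_right)
  have "cinner (P x) (y - P' y) = cinner (opow U n (P x)) (opow W' n (y - P' y))"
    by (simp only: adjoint_pair_opow[OF adj] riesz_projection_complement(2)[OF R' P'(1)])
  moreover have "cinner (x - P x) (P' y) = cinner (opow W n' (x - P x)) (opow U' n' (P' y))"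
    by (simp only: adjoint_pair_opow[OF adj, symmetric] riesz_projection_complement(2)[OF R P(1)])
  ultimately show "cinner (P x) y = cinner x (P' y)"
    by (simp add: P P' cinner.diff_left cinner.diff_right cinner.zero_left)
qed

lemma adjoint_pair_id_plus_scaleC:
  assumes "adjoint_pair A B"
  shows "adjoint_pair (id_blinfun + complex_of_real t *\<^sub>C A) (id_blinfun + complex_of_real t *\<^sub>C B)"
  using assms
  by (simp add: adjoint_pair_def blinfun.add_left cinner_add_left cinner_add_right
      cinner_scaleC_left cinner_scaleC_right)

lemma quadratic_nonneg_imp_linear_zero:
  fixes b c :: real
  assumes "\<And>\<epsilon>. 0 \<le> \<epsilon> * b + \<epsilon>\<^sup>2 * c"
  shows "b = 0"
proof (rule ccontr)
  assume b: "b \<noteq> 0"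
  \<comment> \<open>Any positive \<open>d\<close> above \<open>c\<close> works: at \<epsilon> = -
    b/d the polynomial equals b^2 (c - d) / d^2 < 0.\<close>
  define d where "d = 1 + \<bar>c\<bar>"
  have d: "d > 0" "c < d" by (auto simp: d_def)
  have "0 \<le> (- b / d) * b + (- b / d)\<^sup>2 * c" by (rule assms)
  also have "\<dots> = b\<^sup>2 / d\<^sup>2 * (c - d)" using d by (simp add: field_simps power2_eq_square)
  also have "\<dots> < 0" using b d by (intro mult_pos_neg) auto
  finally show False by simp
qed

text \<open>Cauchy--Schwarz for the semidefinite form \<open>\<kappa> Im \<langle>f, T f\<rangle>\<close>.\<close>

lemma semidefinite_imaginary_part_kernel:
  fixes T T' :: "'a::complex_inner \<Rightarrow>\<^sub>L 'a"
  assumes adj: "adjoint_pair T T'" and pos: "\<And>f. 0 \<le> \<kappa> * Im (cinner f (T f))"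
    and \<kappa>: "\<kappa> \<noteq> 0" and f: "Im (cinner f (T f)) = 0"
  shows "T f = T' f"
proof -
  have Im0: "Im (cinner g (T f - T' f)) = 0" for g
  proof -
    \<comment> \<open>The cross term in direction g. Along f + \<epsilon> g the form is a
      nonnegative polynomial in \<epsilon> without constant term, so its linear coefficient
      vanishes.\<close>
    define b where "b = Im (cinner g (T f - T' f))"
    have "\<kappa> * b = 0"
    proof (rule quadratic_nonneg_imp_linear_zero)
      fix \<epsilon> :: real
      have "Im (cinner f (T g)) = - Im (cinner g (T' f))"
        unfolding adjoint_pairD[OF adjoint_pair_sym[OF adj], of f g, symmetric]
          cinner_commute[of "T' f" g] by simp
      then have "Im (cinner (f + \<epsilon> *\<^sub>R g) (T (f + \<epsilon> *\<^sub>R g))) = \<epsilon> * b + \<epsilon>\<^sup>2 * Im (cinner g (T g))"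
        using f
        by (simp add: b_def blinfun.add_right blinfun.scaleR_right cinner_add_left cinner_add_right
            cinner.diff_right cinner.scaleR_left cinner.scaleR_right algebra_simps power2_eq_square)
      then show "0 \<le> \<epsilon> * (\<kappa> * b) + \<epsilon>\<^sup>2 * (\<kappa> * Im (cinner g (T g)))"
        using pos[of "f + \<epsilon> *\<^sub>R g"] by (simp add: algebra_simps)
    qed
    then show ?thesis using \<kappa> by (simp add: b_def)
  qed
  \<comment> \<open>The test vector \<i> (T f - T' f) turns the imaginary part into minus the
    squared norm.\<close>
  have "(norm (T f - T' f))\<^sup>2 = 0"
    using Im0[of "\<i> *\<^sub>C (T f - T' f)"] by (simp add: cinner_scaleC_left cinner_self)
  then show ?thesis by simp
qed

text \<open>The form \<open>\<langle>J x, y\<rangle>\<close> is nondegenerate on the range of \<open>P\<close>: its radical there is invariant under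
  \<open>T J\<close>, and by semidefiniteness an eigenvector of \<open>T J\<close> in the radical is also one of \<open>T' J\<close>.\<close>

lemma sandwiched_idempotent_kernel:
  fixes T T' J :: "'a::complex_inner \<Rightarrow>\<^sub>L 'a"
  assumes adj: "adjoint_pair T T'" and J: "adjoint_pair J J"
    and pos: "\<And>f. 0 \<le> \<kappa> * Im (cinner f (T f))" and \<kappa>: "\<kappa> \<noteq> 0" and t: "t \<noteq> 0"
    and R: "riesz_projection (id_blinfun + complex_of_real t *\<^sub>C (T o\<^sub>L J)) n W P"
    and R': "riesz_projection (id_blinfun + complex_of_real t *\<^sub>C (T' o\<^sub>L J)) n' W' P'"
    and RQ: "riesz_projection (id_blinfun + complex_of_real t *\<^sub>C (J o\<^sub>L T')) m V Q"
    and x: "Q (J (P x)) = 0"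
  shows "P x = 0"
proof (rule ccontr)
  assume Px: "P x \<noteq> 0"
  define U where "U = id_blinfun + complex_of_real t *\<^sub>C (T o\<^sub>L J)"
  define U' where "U' = id_blinfun + complex_of_real t *\<^sub>C (T' o\<^sub>L J)"
  define UQ where "UQ = id_blinfun + complex_of_real t *\<^sub>C (J o\<^sub>L T')"
  have Ux: "U v = v + t *\<^sub>R T (J v)" and U'x: "U' v = v + t *\<^sub>R T' (J v)"
    and UQx: "UQ v = v + t *\<^sub>R J (T' v)" for v
    by (simp_all add: U_def U'_def UQ_def blinfun.add_left blinfun.scaleR_left scaleC_of_real)
  have PQ: "adjoint_pair P Q"
    by (rule adjoint_pair_riesz_projection[OF R RQ])
      (intro adjoint_pair_id_plus_scaleC adjoint_pair_compose adj J)
  have P: "P (P v) = P v" "P (U v) = U (P v)" "opow U n (P v) = 0" for v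
    using R by (auto simp: riesz_projection_def U_def)
  have QUQ: "Q (UQ v) = UQ (Q v)" for v
    using RQ by (auto simp: riesz_projection_def UQ_def)
  have JU': "J (U' v) = UQ (J v)" for v
    by (simp add: U'x UQx blinfun.add_right blinfun.scaleR_right)
  have JP': "J (P' v) = Q (J v)" for v
    by (rule riesz_projection_intertwine(1)[OF R' RQ, folded U'_def UQ_def, OF JU'])
  \<comment> \<open>The radical: as \<open>Q\<close> is the adjoint of \<open>P\<close>, the
    condition Q J v = 0 says that J v is orthogonal to the range of \<open>P\<close>.\<close>
  define N where "N = {v. P v = v \<and> Q (J v) = 0}"
  have TT': "T (J v) = T' (J v)" if v: "v \<in> N" for v
  proof (rule semidefinite_imaginary_part_kernel[OF adj pos \<kappa>])
    \<comment> \<open>J v is orthogonal to both v and U v, which lie in the range of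
      \<open>P\<close>, hence to their difference t T J v.\<close>
    have "cinner (U v) (J v) = cinner (P (U v)) (J v)" using v by (simp add: N_def P)
    also have "\<dots> = cinner (U v) (Q (J v))" by (rule adjoint_pairD[OF PQ])
    also have "\<dots> = 0" using v by (simp add: N_def)
    finally have "cinner (J v) (U v) = 0" using cinner_commute[of "J v" "U v"] by simp
    moreover have "cinner (J v) v = cinner (J v) (P v)" using v by (simp add: N_def)
    then have "cinner (J v) v = cnj (cinner v (Q (J v)))"
      using cinner_commute[of "J v" "P v"] adjoint_pairD[OF PQ, of v "J v"] by simp
    then have "cinner (J v) v = 0" using v by (simp add: N_def)
    ultimately have "t *\<^sub>R cinner (J v) (T (J v)) = 0"
      by (simp add: Ux cinner_add_right cinner.scaleR_right)
    then show "Im (cinner (J v) (T (J v))) = 0" using t by simp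
  qed
  have UN: "U v \<in> N" if v: "v \<in> N" for v
  proof -
    have "U v = U' v" by (simp add: Ux U'x TT'[OF v])
    then have "Q (J (U v)) = 0" using v by (simp add: JU' QUQ N_def)
    then show ?thesis using v by (simp add: N_def P)
  qed
  have PxN: "P x \<in> N" using x by (simp add: N_def P)
  have opN: "opow U k (P x) \<in> N" for k
    by (induction k) (use UN PxN in auto)
  \<comment> \<open>The last nonzero vector of the nilpotent chain starting at P x is an eigenvector
    of T J that still lies in the radical.\<close>
  define k where "k = (LEAST k. opow U k (P x) = 0)"
  have k0: "opow U k (P x) = 0" unfolding k_def by (rule LeastI[of _ n]) (rule P)
  obtain j where j: "k = Suc j" using k0 Px by (cases k) auto
  define z where "z = opow U j (P x)"
  have z0: "z \<noteq> 0"
    using not_less_Least[of j "\<lambda>k. opow U k (P x) = 0"] j by (simp add: k_def[symmetric] z_def)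
  have zN: "z \<in> N" unfolding z_def by (rule opN)
  have Uz: "U z = 0" using k0 j by (simp add: z_def)
  \<comment> \<open>Now z is a null vector of \<open>U'\<close> too, so it lies in the range of
    \<open>P'\<close>, where J P' = Q J. Since Q J z = 0 this gives J z = 0, whence U z = z,
    contradicting U z = 0.\<close>
  then have "U' z = 0" using TT'[OF zN] by (simp add: Ux U'x)
  moreover have "W' (U' z) = z - P' z" using R' by (simp add: riesz_projection_def U'_def)
  ultimately have "z = P' z" by simp
  then have "J z = Q (J z)" using JP'[of z] by simp
  also have "\<dots> = 0" using zN by (simp add: N_def)
  finally show False using Uz z0 by (simp add: Ux)
qed

text \<open>The algebraic core. With Q J = J P at each sign, the conditions \<open>?vii\<close>,
  \<open>?viii\<close> and \<open>?ix\<close> equate an operator having the kernel of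
  \<open>Pp\<close> with one having the kernel of \<open>Pm\<close>. The remaining ones are kernel
  algebra of idempotents or adjoints of these.\<close>

lemma property_S_equivalences:
  fixes Pp Pm Qp Qm J :: "'a::complex_inner \<Rightarrow>\<^sub>L 'a"
  assumes idem: "\<And>x. Pp (Pp x) = Pp x" "\<And>x. Pm (Pm x) = Pm x"
      "\<And>x. Qp (Qp x) = Qp x" "\<And>x. Qm (Qm x) = Qm x"
    and adj: "adjoint_pair Pp Qm" "adjoint_pair Pm Qp" "adjoint_pair J J"
    and JP: "\<And>x. J (Pp x) = Qp (J x)" "\<And>x. J (Pm x) = Qm (J x)"
    and ker: "\<And>x. Qm (J (Pp x)) = 0 \<Longrightarrow> Pp x = 0" "\<And>x. Qp (J (Pm x)) = 0 \<Longrightarrow> Pm x = 0"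
    and S: "S \<longleftrightarrow> {x. Pp x = 0} = {x. Pm x = 0}"
  shows "S \<longleftrightarrow> Pp o\<^sub>L Pm = Pp \<and> Pm o\<^sub>L Pp = Pm" (is ?ii)
    and "S \<longleftrightarrow> range (blinfun_apply Qp) = range (blinfun_apply Qm)" (is ?iii)
    and "S \<longleftrightarrow> Qp o\<^sub>L Qm = Qm \<and> Qm o\<^sub>L Qp = Qp" (is ?iv)
    and "S \<longleftrightarrow> Qm o\<^sub>L J o\<^sub>L Pp = J o\<^sub>L Pp" (is ?v)
    and "S \<longleftrightarrow> Qp o\<^sub>L J o\<^sub>L Pm = J o\<^sub>L Pm" (is ?vi)
    and "S \<longleftrightarrow> Qm o\<^sub>L J o\<^sub>L Pp = Qm o\<^sub>L J" (is ?vii)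
    and "S \<longleftrightarrow> Qp o\<^sub>L J o\<^sub>L Pm = Qp o\<^sub>L J" (is ?viii)
    and "S \<longleftrightarrow> Qm o\<^sub>L J o\<^sub>L Pp = Qp o\<^sub>L J o\<^sub>L Pm" (is ?ix)
proof -
  have op_eq: "A = B \<longleftrightarrow> (\<forall>x. blinfun_apply A x = blinfun_apply B x)" for A B :: "'a \<Rightarrow>\<^sub>L 'a"
    using blinfun_eqI by auto
  note adj' = adj(1,2)[THEN adjoint_pair_sym]
  have fwd: "Pp (Pm x) = Pp x" "Pm (Pp x) = Pm x" if S for x
  proof -
    have *: "Pp y = 0 \<longleftrightarrow> Pm y = 0" for y using that S by blast
    have "Pp (x - Pm x) = 0" unfolding * by (simp add: blinfun.diff_right idem)
    then show "Pp (Pm x) = Pp x" by (simp add: blinfun.diff_right)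
    have "Pm (x - Pp x) = 0" unfolding *[symmetric] by (simp add: blinfun.diff_right idem)
    then show "Pm (Pp x) = Pm x" by (simp add: blinfun.diff_right)
  qed
  show ii: ?ii
  proof
    assume "Pp o\<^sub>L Pm = Pp \<and> Pm o\<^sub>L Pp = Pm"
    then have "Pp x = Pp (Pm x)" "Pm x = Pm (Pp x)" for x
      by (auto simp: op_eq)
    then show S unfolding S by (metis blinfun.zero_right)
  qed (use fwd in \<open>auto simp: op_eq\<close>)
  have "Pp o\<^sub>L Pm = Pp \<longleftrightarrow> Qp o\<^sub>L Qm = Qm" "Pm o\<^sub>L Pp = Pm \<longleftrightarrow> Qm o\<^sub>L Qp = Qp"
    by (intro adjoint_pair_eq_iff adjoint_pair_compose adj)+
  then show iv: ?iv using ii by simp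
  have "range (blinfun_apply Qp) = range (blinfun_apply Qm) \<longleftrightarrow> Qp o\<^sub>L Qm = Qm \<and> Qm o\<^sub>L Qp = Qp"
  proof
    assume eq: "range (blinfun_apply Qp) = range (blinfun_apply Qm)"
    have "Qp (Qm x) = Qm x" for x
    proof -
      have "Qm x \<in> range (blinfun_apply Qp)" unfolding eq by (rule rangeI)
      then show ?thesis by (rule rangeE) (simp add: idem)
    qed
    moreover have "Qm (Qp x) = Qp x" for x
    proof -
      have "Qp x \<in> range (blinfun_apply Qm)" unfolding eq[symmetric] by (rule rangeI)
      then show ?thesis by (rule rangeE) (simp add: idem)
    qed
    ultimately show "Qp o\<^sub>L Qm = Qm \<and> Qm o\<^sub>L Qp = Qp" by (simp add: op_eq)
  next
    assume "Qp o\<^sub>L Qm = Qm \<and> Qm o\<^sub>L Qp = Qp"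
    then have "Qm x = Qp (Qm x)" "Qp x = Qm (Qp x)" for x by (auto simp: op_eq)
    then show "range (blinfun_apply Qp) = range (blinfun_apply Qm)"
      by (metis (mono_tags, lifting) image_subset_iff rangeI subset_antisym)
  qed
  then show ?iii using iv by simp
  have vii_op: "Qm o\<^sub>L J o\<^sub>L Pp = Qm o\<^sub>L J \<longleftrightarrow> (\<forall>x. Qm (J (Pp x)) = J (Pm x))"
    by (simp add: op_eq JP)
  have viii_op: "Qp o\<^sub>L J o\<^sub>L Pm = Qp o\<^sub>L J \<longleftrightarrow> (\<forall>x. Qp (J (Pm x)) = J (Pp x))"
    by (simp add: op_eq JP)
  have kerJ: "J (Pp x) = 0 \<longleftrightarrow> Pp x = 0" "J (Pm x) = 0 \<longleftrightarrow> Pm x = 0" for x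
    using ker[of x] by auto
  show vii: ?vii
    unfolding vii_op
  proof
    assume S
    then show "\<forall>x. Qm (J (Pp x)) = J (Pm x)" using fwd(2) by (simp add: JP(2)[symmetric])
  next
    assume *: "\<forall>x. Qm (J (Pp x)) = J (Pm x)"
    have "Pp x = 0 \<longleftrightarrow> Pm x = 0" for x
      using *[rule_format, of x] ker(1)[of x] kerJ(2)[of x] by auto
    then show S unfolding S by simp
  qed
  show viii: ?viii
    unfolding viii_op
  proof
    assume S
    then show "\<forall>x. Qp (J (Pm x)) = J (Pp x)" using fwd(1) by (simp add: JP(1)[symmetric])
  next
    assume *: "\<forall>x. Qp (J (Pm x)) = J (Pp x)"
    have "Pp x = 0 \<longleftrightarrow> Pm x = 0" for x
      using *[rule_format, of x] ker(2)[of x] kerJ(1)[of x] by auto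
    then show S unfolding S by simp
  qed
  \<comment> \<open>Both triple products are self-adjoint, so passing to adjoints exchanges
    \<open>?v\<close> with \<open>?vii\<close> and \<open>?vi\<close> with
    \<open>?viii\<close>.\<close>
  have X: "adjoint_pair (Qm o\<^sub>L J o\<^sub>L Pp) (Qm o\<^sub>L (J o\<^sub>L Pp))" "adjoint_pair (Qp o\<^sub>L J o\<^sub>L Pm) (Qp o\<^sub>L (J o\<^sub>L Pm))"
    by (intro adjoint_pair_compose adj adj')+
  have assoc: "A o\<^sub>L (B o\<^sub>L C) = A o\<^sub>L B o\<^sub>L C" for A B C :: "'a \<Rightarrow>\<^sub>L 'a"
    by (simp add: op_eq)
  have "Qm o\<^sub>L J o\<^sub>L Pp = J o\<^sub>L Pp \<longleftrightarrow> Qm o\<^sub>L J o\<^sub>L Pp = Qm o\<^sub>L J"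
    by (rule adjoint_pair_eq_iff[OF X(1)[unfolded assoc]]) (intro adjoint_pair_compose adj)
  then show v: ?v using vii by simp
  have "Qp o\<^sub>L J o\<^sub>L Pm = J o\<^sub>L Pm \<longleftrightarrow> Qp o\<^sub>L J o\<^sub>L Pm = Qp o\<^sub>L J"
    by (rule adjoint_pair_eq_iff[OF X(2)[unfolded assoc]]) (intro adjoint_pair_compose adj)
  then show vi: ?vi using viii by simp
  show ?ix
  proof
    assume S
    \<comment> \<open>Both sides of the last condition reduce to J Pm.\<close>
    then have "Qm (J (Pp x)) = J (Pm x)" "Qp (J (Pm x)) = J (Pm x)" for x
      using vii vi by (auto simp: vii_op) (auto simp: op_eq)
    then show "Qm o\<^sub>L J o\<^sub>L Pp = Qp o\<^sub>L J o\<^sub>L Pm" by (simp add: op_eq)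
  next
    assume "Qm o\<^sub>L J o\<^sub>L Pp = Qp o\<^sub>L J o\<^sub>L Pm"
    then have *: "Qm (J (Pp x)) = Qp (J (Pm x))" for x by (simp add: op_eq)
    have "Pp x = 0 \<longleftrightarrow> Pm x = 0" for x
      using *[of x] ker[of x] by auto
    then show S unfolding S by simp
  qed
qed

section \<open>Self-adjoint operators and sandwiched resolvents\<close>

lemma op_adjointD: "(y, w) \<in> op_adjoint T \<Longrightarrow> (x, v) \<in> T \<Longrightarrow> cinner v y = cinner x w"
  unfolding op_adjoint_def by blast

lemma op_adjointI: "(\<And>x v. (x, v) \<in> T \<Longrightarrow> cinner v y = cinner x w) \<Longrightarrow> (y, w) \<in> op_adjoint T"
  unfolding op_adjoint_def by blast

lemma linear_opD:
  assumes "linear_op T"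
  shows "(0, 0) \<in> T" "(x, y) \<in> T \<Longrightarrow> (u, v) \<in> T \<Longrightarrow> (x + u, y + v) \<in> T"
    "(x, y) \<in> T \<Longrightarrow> (c *\<^sub>C x, c *\<^sub>C y) \<in> T"
    "(x, y) \<in> T \<Longrightarrow> (x, z) \<in> T \<Longrightarrow> y = z"
  using assms unfolding linear_op_def single_valued_def by blast+

lemma linear_op_scaleR: "linear_op T \<Longrightarrow> (x, y) \<in> T \<Longrightarrow> (r *\<^sub>R x, r *\<^sub>R y) \<in> T"
  using linear_opD(3)[of T x y "complex_of_real r"] by (simp add: scaleC_of_real)

lemma linear_op_diff:
  assumes "linear_op T" "(x, y) \<in> T" "(u, v) \<in> T"
  shows "(x - u, y - v) \<in> T"
  using linear_opD(2)[OF assms(1,2) linear_op_scaleR[OF assms(1,3), of "- 1"]] by simp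

lemma subspace_linear_op: "linear_op T \<Longrightarrow> subspace T"
  unfolding subspace_def by (auto simp: linear_opD linear_op_scaleR zero_prod_def)

lemma subspace_Domain_op_adjoint: "subspace (Domain (op_adjoint T))"
proof (rule subspaceI)
  have "(0, 0) \<in> op_adjoint T" by (rule op_adjointI) simp
  then show "0 \<in> Domain (op_adjoint T)" by blast
next
  fix x y assume "x \<in> Domain (op_adjoint T)" "y \<in> Domain (op_adjoint T)"
  then obtain u v where "(x, u) \<in> op_adjoint T" "(y, v) \<in> op_adjoint T" by blast
  then have "(x + y, u + v) \<in> op_adjoint T"
    by (intro op_adjointI) (simp add: cinner_add_right op_adjointD)
  then show "x + y \<in> Domain (op_adjoint T)" by blast
next
  fix c :: real and x assume "x \<in> Domain (op_adjoint T)"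
  then obtain u where "(x, u) \<in> op_adjoint T" by blast
  then have "(c *\<^sub>R x, c *\<^sub>R u) \<in> op_adjoint T"
    by (intro op_adjointI) (simp add: cinner.scaleR_right op_adjointD)
  then show "c *\<^sub>R x \<in> Domain (op_adjoint T)" by blast
qed

lemma closure_of_subspace:
  fixes S :: "'a::real_normed_vector set"
  assumes S: "subspace S"
  shows "subspace (closure S)"
proof (rule subspaceI)
  show "0 \<in> closure S" using subspace_0[OF S] closure_subset by blast
next
  fix x y assume "x \<in> closure S" "y \<in> closure S"
  then obtain f g where "\<And>n. f n \<in> S" "f \<longlonglongrightarrow> x" "\<And>n. g n \<in> S" "g \<longlonglongrightarrow> y"
    unfolding closure_sequential by blast
  then have "(\<forall>n. f n + g n \<in> S) \<and> (\<lambda>n. f n + g n) \<longlonglongrightarrow> x + y"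
    by (auto intro: tendsto_add subspace_add[OF S])
  then show "x + y \<in> closure S"
    unfolding closure_sequential by (rule exI[of _ "\<lambda>n. f n + g n"])
next
  fix c x assume "x \<in> closure S"
  then obtain f where "\<And>n. f n \<in> S" "f \<longlonglongrightarrow> x" unfolding closure_sequential by blast
  then have "(\<forall>n. c *\<^sub>R f n \<in> S) \<and> (\<lambda>n. c *\<^sub>R f n) \<longlonglongrightarrow> c *\<^sub>R x"
    by (auto intro: tendsto_intros subspace_scale[OF S])
  then show "c *\<^sub>R x \<in> closure S"
    unfolding closure_sequential by (rule exI[of _ "\<lambda>n. c *\<^sub>R f n"])
qed

text \<open>Von Neumann's argument. For u orthogonal to the adjoint domain, split (0, u) along the
  graph of \<open>F\<close>. The component (a, b) orthogonal to the graph puts b in the adjoint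
  domain, so it is orthogonal to (0, u) and hence zero; then (0, u) lies in \<open>F\<close>, which
  forces u = 0.\<close>

lemma Domain_op_adjoint_dense:
  fixes F :: "('h::complex_hilbert, 'k::complex_hilbert) op_graph"
  assumes F: "linear_op F" "closed F"
  shows "closure (Domain (op_adjoint F)) = UNIV"
proof -
  let ?M = "closure (Domain (op_adjoint F))"
  have "y \<in> ?M" for y
  proof -
    have "subspace ?M" "closed ?M"
      using closure_of_subspace[OF subspace_Domain_op_adjoint] closed_closure by auto
    then obtain m u where m: "m \<in> ?M" "y = m + u" "\<And>v. v \<in> ?M \<Longrightarrow> inner u v = 0"
      using orthogonal_decomposition by blast
    obtain p q where p: "p \<in> F" "(0, u) = p + q" "\<And>v. v \<in> F \<Longrightarrow> inner q v = 0"
      using orthogonal_decomposition[OF subspace_linear_op[OF F(1)] F(2)] by blast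
    obtain a b where q: "q = (a, b)" by fastforce
    have orth: "cinner a x + cinner b v = 0" if "(x, v) \<in> F" for x v
    proof -
      have "inner a (c *\<^sub>C x) + inner b (c *\<^sub>C v) = 0" for c
        using p(3)[OF linear_opD(3)[OF F(1) that, of c]] by (simp add: q)
      from this[of 1] this[of \<i>] show ?thesis by (simp add: complex_eq_iff Re_cinner Im_cinner)
    qed
    have "(b, - a) \<in> op_adjoint F"
    proof (rule op_adjointI)
      fix x v assume "(x, v) \<in> F"
      then have "cinner b v = - cinner a x" using orth[of x v] by (simp add: eq_neg_iff_add_eq_0 add.commute)
      then show "cinner v b = cinner x (- a)"
        using cinner_commute[of v b] cinner_commute[of x a] by (simp add: cinner_minus_right)
    qed
    then have "b \<in> ?M" by (intro subsetD[OF closure_subset] DomainI)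
    then have "inner (0, u) q = 0" using m(3) by (simp add: q)
    moreover have "inner q p = 0" by (rule p(3)[OF p(1)])
    ultimately have "inner q q = 0" unfolding p(2) by (simp add: inner_add_right inner_commute)
    then have "(0, u) \<in> F" using p by simp
    then have "u = 0" by (rule linear_opD(4)[OF F(1) _ linear_opD(1)[OF F(1)]])
    then show ?thesis using m by simp
  qed
  then show ?thesis by blast
qed

lemma self_adjoint_symmetric:
  "self_adjoint H \<Longrightarrow> (x, u) \<in> H \<Longrightarrow> (y, v) \<in> H \<Longrightarrow> cinner u y = cinner x v"
  unfolding self_adjoint_def using op_adjointD by metis

lemma self_adjoint_Im:
  assumes "self_adjoint H" "(x, u) \<in> H"
  shows "Im (cinner x (u - z *\<^sub>C x)) = - Im z * (norm x)\<^sup>2"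
proof -
  have "cinner x u = cnj (cinner x u)"
    using self_adjoint_symmetric[OF assms(1,2,2)] cinner_commute[of u x] by simp
  then have "Im (cinner x u) = 0" by (metis Im_complex_of_real Reals_cases Reals_cnj_iff)
  then show ?thesis by (simp add: cinner.diff_right cinner_scaleC_right cinner_self)
qed

lemma self_adjoint_lower_bound:
  assumes "self_adjoint H" "(x, u) \<in> H"
  shows "\<bar>Im z\<bar> * norm x \<le> norm (u - z *\<^sub>C x)"
proof (cases "x = 0")
  case False
  have "\<bar>Im z\<bar> * (norm x)\<^sup>2 = \<bar>Im (cinner x (u - z *\<^sub>C x))\<bar>"
    unfolding self_adjoint_Im[OF assms] by (simp add: abs_mult)
  also have "\<dots> \<le> norm x * norm (\<i> *\<^sub>C (u - z *\<^sub>C x))"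
    unfolding Im_cinner abs_minus_cancel by (rule Cauchy_Schwarz_ineq2)
  finally have "norm x * (\<bar>Im z\<bar> * norm x) \<le> norm x * norm (u - z *\<^sub>C x)"
    by (simp add: norm_scaleC power2_eq_square mult_ac)
  then show ?thesis using False by simp
qed simp

text \<open>The lower bound by the imaginary part closes the range of H - z; a vector orthogonal to
  the range would be an eigenvector of \<open>H\<close> for the non-real value \<open>cnj z\<close>,
  excluded by the same bound.\<close>

lemma self_adjoint_resolvent_surj:
  fixes H :: "('h::complex_hilbert, 'h) op_graph"
  assumes H: "self_adjoint H" and z: "Im z \<noteq> 0"
  shows "\<exists>x u. (x, u) \<in> H \<and> u - z *\<^sub>C x = v"
proof -
  have lin: "linear_op H" and adj: "op_adjoint H = H" using H by (auto simp: self_adjoint_def)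
  define R where "R = {u - z *\<^sub>C x | x u. (x, u) \<in> H}"
  have sub: "subspace R"
  proof (rule subspaceI)
    have "0 - z *\<^sub>C 0 \<in> R" unfolding R_def using linear_opD(1)[OF lin] by blast
    then show "0 \<in> R" by (simp add: scaleC.zero_right)
  next
    fix a b assume "a \<in> R" "b \<in> R"
    then obtain x u y w where "(x, u) \<in> H" "(y, w) \<in> H" "a = u - z *\<^sub>C x" "b = w - z *\<^sub>C y"
      unfolding R_def by blast
    then have "(x + y, u + w) \<in> H" "a + b = (u + w) - z *\<^sub>C (x + y)"
      using linear_opD(2)[OF lin] by (auto simp: scaleC.add_right)
    then show "a + b \<in> R" unfolding R_def by blast
  next
    fix c a assume "a \<in> R"
    then obtain x u where "(x, u) \<in> H" "a = u - z *\<^sub>C x" unfolding R_def by blast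
    then have "(c *\<^sub>R x, c *\<^sub>R u) \<in> H" "c *\<^sub>R a = c *\<^sub>R u - z *\<^sub>C (c *\<^sub>R x)"
      using linear_op_scaleR[OF lin] by (auto simp: scaleC.scaleR_right scaleR_diff_right)
    then show "c *\<^sub>R a \<in> R" unfolding R_def by blast
  qed
  have cl: "closed R"
  proof (rule closed_sequential_limits[THEN iffD2], safe)
    fix f l assume f: "\<forall>n. f n \<in> R" and l: "f \<longlonglongrightarrow> l"
    then have "\<forall>n. \<exists>x u. (x, u) \<in> H \<and> f n = u - z *\<^sub>C x" unfolding R_def by blast
    then obtain x u where xu: "\<And>n. (x n, u n) \<in> H" "\<And>n. f n = u n - z *\<^sub>C x n" by metis
    have "Cauchy x"
    proof (rule metric_CauchyI)
      fix e :: real assume "e > 0"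
      then have "\<bar>Im z\<bar> * e > 0" using z by simp
      then obtain M where M: "\<And>m n. m \<ge> M \<Longrightarrow> n \<ge> M \<Longrightarrow> dist (f m) (f n) < \<bar>Im z\<bar> * e"
        using metric_CauchyD[OF LIMSEQ_imp_Cauchy[OF l]] by blast
      have "dist (x m) (x n) < e" if "m \<ge> M" "n \<ge> M" for m n
      proof -
        have "(x m - x n, u m - u n) \<in> H" by (rule linear_op_diff[OF lin xu(1) xu(1)])
        from self_adjoint_lower_bound[OF H this, of z]
        have "\<bar>Im z\<bar> * dist (x m) (x n) \<le> dist (f m) (f n)"
          unfolding dist_norm xu(2) by (simp add: scaleC.diff_right algebra_simps)
        also have "\<dots> < \<bar>Im z\<bar> * e" by (rule M[OF that])
        finally show ?thesis using z by simp
      qed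
      then show "\<exists>M. \<forall>m\<ge>M. \<forall>n\<ge>M. dist (x m) (x n) < e" by blast
    qed
    then obtain x0 where x0: "x \<longlonglongrightarrow> x0" using Cauchy_convergent_iff convergent_def by blast
    have u0: "u \<longlonglongrightarrow> l + z *\<^sub>C x0"
      using tendsto_add[OF l scaleC.tendsto[OF tendsto_const[of z] x0]] by (simp add: xu(2))
    \<comment> \<open>Closedness of \<open>H\<close> is obtained from \<open>H\<close> being an
      adjoint.\<close>
    have "(x0, l + z *\<^sub>C x0) \<in> op_adjoint H"
    proof (rule op_adjointI)
      fix a b assume "(a, b) \<in> H"
      then have "cinner b (x n) = cinner a (u n)" for n
        using self_adjoint_symmetric[OF H _ xu(1)[of n]] by blast
      moreover have "(\<lambda>n. cinner b (x n)) \<longlonglongrightarrow> cinner b x0"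
        by (intro cinner.tendsto tendsto_const x0)
      moreover have "(\<lambda>n. cinner a (u n)) \<longlonglongrightarrow> cinner a (l + z *\<^sub>C x0)"
        by (intro cinner.tendsto tendsto_const u0)
      ultimately show "cinner b x0 = cinner a (l + z *\<^sub>C x0)"
        using LIMSEQ_unique by simp
    qed
    then have "(l + z *\<^sub>C x0) - z *\<^sub>C x0 \<in> R" unfolding adj R_def by blast
    then show "l \<in> R" by simp
  qed
  obtain m w where mw: "m \<in> R" "v = m + w" "\<And>y. y \<in> R \<Longrightarrow> inner w y = 0"
    using orthogonal_decomposition[OF sub cl] by blast
  have "(w, cnj z *\<^sub>C w) \<in> op_adjoint H"
  proof (rule op_adjointI)
    fix x u assume xu: "(x, u) \<in> H"
    have "inner w (c *\<^sub>C (u - z *\<^sub>C x)) = 0" for c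
    proof (rule mw(3))
      have "c *\<^sub>C (u - z *\<^sub>C x) = c *\<^sub>C u - z *\<^sub>C (c *\<^sub>C x)"
        by (simp add: scaleC.diff_right scaleC_scaleC mult.commute)
      then show "c *\<^sub>C (u - z *\<^sub>C x) \<in> R"
        unfolding R_def using linear_opD(3)[OF lin xu, of c] by blast
    qed
    then have "cinner w (u - z *\<^sub>C x) = 0" by (rule inner_imp_cinner_eq_zero)
    then have "cinner w u = z * cinner w x" by (simp add: cinner.diff_right cinner_scaleC_right)
    then show "cinner u w = cinner x (cnj z *\<^sub>C w)"
      using cinner_commute[of u w] cinner_commute[of x w] by (simp add: cinner_scaleC_right)
  qed
  then have "(w, cnj z *\<^sub>C w) \<in> H" by (simp add: adj)
  from self_adjoint_lower_bound[OF H this, of "cnj z"] have "w = 0" using z by (simp add: mult_le_0_iff)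
  then show ?thesis using mw unfolding R_def by auto
qed

lemma blinfun_eq_on_dense:
  fixes A B :: "'a::real_normed_vector \<Rightarrow>\<^sub>L 'b::real_normed_vector"
  assumes "closure D = UNIV" "\<And>x. x \<in> D \<Longrightarrow> A x = B x"
  shows "A = B"
proof -
  have "closed {x. A x = B x}" by (intro closed_Collect_eq continuous_intros)
  then have "closure D \<subseteq> {x. A x = B x}" using assms(2) by (intro closure_minimal) auto
  then show ?thesis using assms(1) by (intro blinfun_eqI) auto
qed

section \<open>Sandwiched resolvents off the real axis\<close>

context rigged_line
begin

abbreviation sandwiched :: "real \<Rightarrow> complex \<Rightarrow> 'k \<Rightarrow>\<^sub>L 'k" where
  "sandwiched r z \<equiv> sandwiched_resolvent F (op_line H0 V r) z"

lemma Im_nonzero: "z \<notin> \<real> \<Longrightarrow> Im z \<noteq> 0"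
  by (simp add: complex_is_Real_iff)

lemma sandwiched_is:
  "z \<notin> \<real> \<Longrightarrow> is_sandwiched_resolvent F (op_line H0 V r) z (sandwiched r z)"
  unfolding sandwiched_resolvent_def using someI_ex[OF sandwiched_resolvent_exists] .

lemma compact_operator_sandwiched: "z \<notin> \<real> \<Longrightarrow> compact_operator (sandwiched r z)"
  using sandwiched_is unfolding is_sandwiched_resolvent_def by blast

lemma sandwiched_apply:
  assumes "z \<notin> \<real>" "(f, u - z *\<^sub>C x) \<in> op_adjoint F" "(x, u) \<in> op_line H0 V r" "(x, w) \<in> F"
  shows "sandwiched r z f = w"
proof -
  have "(u - z *\<^sub>C x, x) \<in> resolvent (op_line H0 V r) z"
    using assms(3) unfolding resolvent_def by blast
  then have "(f, w) \<in> op_adjoint F O resolvent (op_line H0 V r) z O F"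
    using assms(2,4) by blast
  then have "(f, w) \<in> graph_of (sandwiched r z)"
    using sandwiched_is[OF assms(1)] unfolding is_sandwiched_resolvent_def by blast
  then show ?thesis by (simp add: graph_of_def)
qed

text \<open>The resolvent maps into \<D>, which lies in the domain of \<open>F\<close>, so the
  sandwiched product is defined on the whole adjoint domain and can be computed there through
  x.\<close>

lemma sandwiched_witness:
  assumes z: "z \<notin> \<real>" and f: "(f, g) \<in> op_adjoint F"
  obtains x u where "(x, u) \<in> op_line H0 V r" "g = u - z *\<^sub>C x" "(x, sandwiched r z f) \<in> F"
proof -
  obtain x u where xu: "(x, u) \<in> op_line H0 V r" "u - z *\<^sub>C x = g"
    using self_adjoint_resolvent_surj[OF line_self_adjoint Im_nonzero[OF z]] by blast
  then have "x \<in> \<D>" using line_domain[of r] by blast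
  then obtain w where w: "(x, w) \<in> F" using domain_subset by blast
  have "sandwiched r z f = w"
    by (rule sandwiched_apply[OF z _ xu(1) w]) (use f xu(2) in simp)
  then show thesis using that[OF xu(1) _] xu(2) w by blast
qed

lemma adjoint_domain_dense: "closure (Domain (op_adjoint F)) = UNIV"
  by (rule Domain_op_adjoint_dense[OF F_operator(1,3)])

lemma J_linear: "clinear_op J"
proof -
  have "linear_op (graph_of J)" using J_self_adjoint by (simp add: self_adjoint_def)
  then have "(c *\<^sub>C x, c *\<^sub>C J x) \<in> graph_of J" for c x
    using linear_opD(3)[of "graph_of J" x "J x" c] by (auto simp: graph_of_def)
  then show ?thesis by (auto simp: clinear_op_def graph_of_def)
qed

lemma J_adjoint: "adjoint_pair J J"
  using self_adjoint_symmetric[OF J_self_adjoint] by (simp add: adjoint_pair_def graph_of_def)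

text \<open>For x the resolvent at r applied to the adjoint image g of f, the factorization of
  \<open>V\<close> makes (H_s - z) x = g + (s - r) V x the adjoint image of f + (s - r) J F x. Both
  sides thus agree on a dense set.\<close>

lemma second_resolvent_identity:
  assumes z: "z \<notin> \<real>"
  shows "sandwiched s z + (s - r) *\<^sub>R (sandwiched s z o\<^sub>L J o\<^sub>L sandwiched r z) = sandwiched r z"
proof (rule blinfun_eq_on_dense[OF adjoint_domain_dense])
  fix f assume "f \<in> Domain (op_adjoint F)"
  then obtain g where fg: "(f, g) \<in> op_adjoint F" by blast
  let ?w = "sandwiched r z f"
  obtain x u where xu: "(x, u) \<in> op_line H0 V r" "g = u - z *\<^sub>C x" "(x, ?w) \<in> F"
    by (rule sandwiched_witness[OF z fg])
  obtain h v where hv: "(x, h) \<in> H0" "(x, v) \<in> V" "u = h + r *\<^sub>R v"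
    using xu(1) unfolding op_line_def by blast
  obtain a where a: "(x, a) \<in> F" "(J a, v) \<in> op_adjoint F"
    using hv(2) unfolding V_factorization graph_of_def by blast
  have "a = ?w" using linear_opD(4)[OF F_operator(1) a(1) xu(3)] .
  have "(x, h + s *\<^sub>R v) \<in> op_line H0 V s" using hv unfolding op_line_def by blast
  moreover have "(f + (s - r) *\<^sub>R J ?w, (h + s *\<^sub>R v) - z *\<^sub>C x) \<in> op_adjoint F"
  proof (rule op_adjointI)
    fix y b assume yb: "(y, b) \<in> F"
    have "(h + s *\<^sub>R v) - z *\<^sub>C x = g + (s - r) *\<^sub>R v"
      unfolding xu(2) hv(3) by (simp add: algebra_simps)
    then show "cinner b (f + (s - r) *\<^sub>R J ?w) = cinner y ((h + s *\<^sub>R v) - z *\<^sub>C x)"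
      using op_adjointD[OF fg yb] op_adjointD[OF a(2) yb] \<open>a = ?w\<close>
      by (simp only: cinner_add_right cinner.scaleR_right)
  qed
  ultimately have "sandwiched s z (f + (s - r) *\<^sub>R J ?w) = ?w"
    using sandwiched_apply[OF z _ _ xu(3)] by blast
  then show "(sandwiched s z + (s - r) *\<^sub>R (sandwiched s z o\<^sub>L J o\<^sub>L sandwiched r z)) f = sandwiched r z f"
    by (simp add: blinfun.add_left blinfun.add_right blinfun.scaleR_left blinfun.scaleR_right)
qed

lemma adjoint_pair_sandwiched:
  assumes z: "z \<notin> \<real>"
  shows "adjoint_pair (sandwiched r z) (sandwiched r (cnj z))"
  unfolding adjoint_pair_def
proof (intro allI)
  have cz: "cnj z \<notin> \<real>" using z by (simp add: complex_is_Real_iff)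
  let ?D = "Domain (op_adjoint F)" and ?T = "sandwiched r z" and ?T' = "sandwiched r (cnj z)"
  have base: "cinner (?T f) g = cinner f (?T' g)" if fg: "f \<in> ?D" "g \<in> ?D" for f g
  proof -
    obtain f' g' where f': "(f, f') \<in> op_adjoint F" and g': "(g, g') \<in> op_adjoint F"
      using fg by blast
    obtain x u where xu: "(x, u) \<in> op_line H0 V r" "f' = u - z *\<^sub>C x" "(x, ?T f) \<in> F"
      by (rule sandwiched_witness[OF z f'])
    obtain y v where yv: "(y, v) \<in> op_line H0 V r" "g' = v - cnj z *\<^sub>C y" "(y, ?T' g) \<in> F"
      by (rule sandwiched_witness[OF cz g'])
    have "cinner (?T f) g = cinner x g'" by (rule op_adjointD[OF g' xu(3)])
    also have "\<dots> = cinner x v - cnj z * cinner x y"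
      by (simp add: yv(2) cinner.diff_right cinner_scaleC_right)
    also have "cinner x v = cinner u y"
      using self_adjoint_symmetric[OF line_self_adjoint xu(1) yv(1)] by simp
    also have "cinner u y - cnj z * cinner x y = cinner f' y"
      by (simp add: xu(2) cinner.diff_left cinner_scaleC_left)
    also have "\<dots> = cnj (cinner (?T' g) f)"
      using op_adjointD[OF f' yv(3)] cinner_commute[of f' y] by simp
    also have "\<dots> = cinner f (?T' g)" using cinner_commute[of f "?T' g"] by simp
    finally show ?thesis .
  qed
  have 1: "cinner (?T f) g = cinner f (?T' g)" if g: "g \<in> ?D" for f g
  proof -
    have "closed {f. cinner (?T f) g = cinner f (?T' g)}"
      by (intro closed_Collect_eq cinner.continuous_on continuous_intros)
    then have "closure ?D \<subseteq> {f. cinner (?T f) g = cinner f (?T' g)}"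
      using base g by (intro closure_minimal) auto
    then show ?thesis using adjoint_domain_dense by auto
  qed
  fix f g
  have "closed {g. cinner (?T f) g = cinner f (?T' g)}"
    by (intro closed_Collect_eq cinner.continuous_on continuous_intros)
  then have "closure ?D \<subseteq> {g. cinner (?T f) g = cinner f (?T' g)}"
    using 1 by (intro closure_minimal) auto
  then show "cinner (?T f) g = cinner f (?T' g)" using adjoint_domain_dense by auto
qed

text \<open>On the adjoint domain the imaginary part of the form is Im z times the squared norm of
  the witness; density does the rest.\<close>

lemma sandwiched_semidefinite:
  assumes z: "z \<notin> \<real>"
  shows "0 \<le> Im z * Im (cinner f (sandwiched r z f))"
proof -
  let ?D = "Domain (op_adjoint F)" and ?T = "sandwiched r z"
  have base: "0 \<le> Im z * Im (cinner f (?T f))" if f: "f \<in> ?D" for f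
  proof -
    obtain f' where f': "(f, f') \<in> op_adjoint F" using f by blast
    obtain x u where xu: "(x, u) \<in> op_line H0 V r" "f' = u - z *\<^sub>C x" "(x, ?T f) \<in> F"
      by (rule sandwiched_witness[OF z f'])
    have "cinner (?T f) f = cinner x (u - z *\<^sub>C x)"
      using op_adjointD[OF f' xu(3)] xu(2) by simp
    then have "Im (cinner (?T f) f) = - Im z * (norm x)\<^sup>2"
      using self_adjoint_Im[OF line_self_adjoint xu(1)] by simp
    then have "Im (cinner f (?T f)) = Im z * (norm x)\<^sup>2"
      using cinner_commute[of f "?T f"] by simp
    then show ?thesis by (simp add: mult.assoc[symmetric])
  qed
  have "closed {f. 0 \<le> Im z * Im (cinner f (?T f))}"
    by (intro closed_Collect_le cinner.continuous_on continuous_intros)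
  then have "closure ?D \<subseteq> {f. 0 \<le> Im z * Im (cinner f (?T f))}"
    using base by (intro closure_minimal) auto
  then show ?thesis using adjoint_domain_dense by auto
qed

section \<open>Boundary values\<close>

abbreviation boundary :: "real \<Rightarrow> real \<Rightarrow> real \<Rightarrow> 'k \<Rightarrow>\<^sub>L 'k" where
  "boundary lam r \<sigma> \<equiv> boundary_resolvent F (op_line H0 V r) lam \<sigma>"

lemma boundary_tendsto:
  assumes "r \<in> nonresonant_points F H0 V lam" "\<sigma> \<in> {1, -1}"
  shows "((\<lambda>y. sandwiched r (Complex lam (\<sigma> * y))) \<longlongrightarrow> boundary lam r \<sigma>) (at_right 0)"
proof -
  obtain L where L: "((\<lambda>y. sandwiched r (Complex lam (\<sigma> * y))) \<longlongrightarrow> L) (at_right 0)"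
    using assms unfolding nonresonant_points_def regular_points_def by blast
  then show ?thesis
    unfolding boundary_resolvent_def using tendsto_Lim[OF trivial_limit_at_right_real L] by simp
qed

lemma nonreal_boundary_path:
  assumes "\<sigma> \<in> {1, -1 :: real}"
  shows "\<forall>\<^sub>F y in at_right 0. Complex lam (\<sigma> * y) \<notin> \<real>"
  using eventually_at_right_less[of 0] assms by (auto simp: complex_is_Real_iff elim: eventually_mono)

lemma boundary_second_resolvent_identity:
  assumes r: "r \<in> nonresonant_points F H0 V lam" and s: "s \<in> nonresonant_points F H0 V lam"
    and \<sigma>: "\<sigma> \<in> {1, -1}"
  shows "boundary lam s \<sigma> + (s - r) *\<^sub>R (boundary lam s \<sigma> o\<^sub>L J o\<^sub>L boundary lam r \<sigma>) = boundary lam r \<sigma>"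
proof (rule tendsto_unique[OF trivial_limit_at_right_real _ boundary_tendsto[OF r \<sigma>]])
  let ?z = "\<lambda>y. Complex lam (\<sigma> * y)"
  have "((\<lambda>y. sandwiched s (?z y) + (s - r) *\<^sub>R (sandwiched s (?z y) o\<^sub>L J o\<^sub>L sandwiched r (?z y)))
      \<longlongrightarrow> boundary lam s \<sigma> + (s - r) *\<^sub>R (boundary lam s \<sigma> o\<^sub>L J o\<^sub>L boundary lam r \<sigma>)) (at_right 0)"
    by (intro tendsto_add tendsto_scaleR tendsto_const blinfun_compose.tendsto boundary_tendsto r s \<sigma>)
  then show "((\<lambda>y. sandwiched r (?z y))
      \<longlongrightarrow> boundary lam s \<sigma> + (s - r) *\<^sub>R (boundary lam s \<sigma> o\<^sub>L J o\<^sub>L boundary lam r \<sigma>)) (at_right 0)"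
  proof (rule Lim_transform_eventually)
    show "\<forall>\<^sub>F y in at_right 0. sandwiched s (?z y) +
        (s - r) *\<^sub>R (sandwiched s (?z y) o\<^sub>L J o\<^sub>L sandwiched r (?z y)) = sandwiched r (?z y)"
      using nonreal_boundary_path[OF \<sigma>, of lam] by eventually_elim (rule second_resolvent_identity)
  qed
qed

lemma adjoint_pair_boundary:
  assumes r: "r \<in> nonresonant_points F H0 V lam"
  shows "adjoint_pair (boundary lam r 1) (boundary lam r (- 1))"
  unfolding adjoint_pair_def
proof (intro allI)
  fix f g
  let ?z = "\<lambda>y. Complex lam (1 * y)" and ?z' = "\<lambda>y. Complex lam (- 1 * y)"
  have "((\<lambda>y. cinner (sandwiched r (?z y) f) g) \<longlongrightarrow> cinner (boundary lam r 1 f) g) (at_right 0)"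
    by (intro cinner.tendsto blinfun.tendsto tendsto_const boundary_tendsto r) simp
  moreover have "((\<lambda>y. cinner f (sandwiched r (?z' y) g)) \<longlongrightarrow> cinner f (boundary lam r (- 1) g)) (at_right 0)"
    by (intro cinner.tendsto blinfun.tendsto tendsto_const boundary_tendsto r) simp
  moreover have "\<forall>\<^sub>F y in at_right 0. cinner f (sandwiched r (?z' y) g) = cinner (sandwiched r (?z y) f) g"
    using nonreal_boundary_path[of 1 lam, simplified]
  proof eventually_elim
    case (elim y)
    have "cnj (?z y) = ?z' y" by (simp add: complex_eq_iff)
    then show ?case using adjoint_pairD[OF adjoint_pair_sandwiched[of "?z y" r], of f g] elim by simp
  qed
  then have "((\<lambda>y. cinner (sandwiched r (?z y) f) g) \<longlongrightarrow> cinner f (boundary lam r (- 1) g)) (at_right 0)"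
    by (rule Lim_transform_eventually[OF calculation(2)])
  ultimately show "cinner (boundary lam r 1 f) g = cinner f (boundary lam r (- 1) g)"
    by (intro tendsto_unique[OF trivial_limit_at_right_real])
qed

lemma boundary_semidefinite:
  assumes r: "r \<in> nonresonant_points F H0 V lam" and \<sigma>: "\<sigma> \<in> {1, -1}"
  shows "0 \<le> \<sigma> * Im (cinner f (boundary lam r \<sigma> f))"
proof (rule tendsto_lowerbound[OF _ _ trivial_limit_at_right_real])
  let ?z = "\<lambda>y. Complex lam (\<sigma> * y)"
  show "((\<lambda>y. \<sigma> * Im (cinner f (sandwiched r (?z y) f))) \<longlongrightarrow> \<sigma> * Im (cinner f (boundary lam r \<sigma> f))) (at_right 0)"
    by (intro tendsto_mult tendsto_Im cinner.tendsto blinfun.tendsto tendsto_const boundary_tendsto r \<sigma>)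
  show "\<forall>\<^sub>F y in at_right 0. 0 \<le> \<sigma> * Im (cinner f (sandwiched r (?z y) f))"
    using nonreal_boundary_path[OF \<sigma>, of lam] eventually_at_right_less[of 0]
  proof eventually_elim
    case (elim y)
    have "0 \<le> y * (\<sigma> * Im (cinner f (sandwiched r (?z y) f)))"
      using sandwiched_semidefinite[OF elim(1), of f r] by (simp add: mult_ac)
    then show ?case using elim(2) by (simp add: zero_le_mult_iff)
  qed
qed

lemma boundary_compact:
  assumes r: "r \<in> nonresonant_points F H0 V lam" and \<sigma>: "\<sigma> \<in> {1, -1}"
  shows "seq_compact_op (boundary lam r \<sigma>)" "clinear_op (boundary lam r \<sigma>)"
proof -
  note lim = boundary_tendsto[OF r \<sigma>]
  note ev = nonreal_boundary_path[OF \<sigma>, of lam]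
  show "seq_compact_op (boundary lam r \<sigma>)"
  proof (rule seq_compact_op_limit)
    fix e :: real assume "e > 0"
    from eventually_conj[OF tendstoD[OF lim this] ev]
    obtain y where "dist (sandwiched r (Complex lam (\<sigma> * y))) (boundary lam r \<sigma>) < e"
      "Complex lam (\<sigma> * y) \<notin> \<real>"
      using eventually_happens[of _ "at_right (0::real)"] trivial_limit_at_right_real by blast
    then show "\<exists>C. compact_operator C \<and> norm (boundary lam r \<sigma> - C) < e"
      using compact_operator_sandwiched by (metis dist_norm norm_minus_commute)
  qed
  show "clinear_op (boundary lam r \<sigma>)"
  proof (rule clinear_op_tendsto[OF lim trivial_limit_at_right_real])
    show "\<forall>\<^sub>F y in at_right 0. clinear_op (sandwiched r (Complex lam (\<sigma> * y)))"
      using ev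
      by eventually_elim (use compact_operator_sandwiched in \<open>auto simp: compact_operator_def clinear_op_def\<close>)
  qed
qed

section \<open>Openness of the non-resonant set\<close>

text \<open>Replacing the converging family Y by its limit B in Y = T + c Y J T gives (1 + c B J) T
  = Y + c (B - Y) J T. The left factor is invertible for small c, and an a priori bound on T makes
  the last term vanish in the limit.\<close>

lemma sandwiched_converges_nearby:
  assumes r: "r \<in> nonresonant_points F H0 V lam" and \<sigma>: "\<sigma> \<in> {1, -1}"
    and small: "\<bar>s - r\<bar> * (norm J * (norm (boundary lam r \<sigma>) + 1)) \<le> 1 / 2"
  shows "\<exists>L. ((\<lambda>y. sandwiched s (Complex lam (\<sigma> * y))) \<longlongrightarrow> L) (at_right 0)"
proof -
  define B where "B = boundary lam r \<sigma>"
  define c where "c = s - r"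
  define K where "K = B o\<^sub>L J"
  define Y where "Y y = sandwiched r (Complex lam (\<sigma> * y))" for y
  define T where "T y = sandwiched s (Complex lam (\<sigma> * y))" for y
  have Y: "(Y \<longlongrightarrow> B) (at_right 0)" unfolding Y_def B_def by (rule boundary_tendsto[OF r \<sigma>])
  have small: "\<bar>c\<bar> * (norm J * (norm B + 1)) \<le> 1 / 2" using small by (simp add: c_def B_def)
  have "norm K \<le> norm B * norm J" unfolding K_def by (rule norm_blinfun_compose)
  also have "\<dots> \<le> norm J * (norm B + 1)" by (simp add: algebra_simps)
  finally have "\<bar>c\<bar> * norm K \<le> \<bar>c\<bar> * (norm J * (norm B + 1))" by (rule mult_left_mono) simp
  then have "cmod (complex_of_real c) * norm K < 1" using small by simp
  moreover have "clinear_op K"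
    unfolding K_def B_def by (intro clinear_op_compose boundary_compact r \<sigma> J_linear)
  ultimately obtain X where X: "is_resolvent_family K (complex_of_real c) X"
    using is_resolvent_family_exists by blast
  have X1: "X x + c *\<^sub>R X (K x) = K x" for x
    using X by (simp add: is_resolvent_family_def scaleC_of_real)
  \<comment> \<open>A left inverse of 1 + c K.\<close>
  define S where "S = id_blinfun - c *\<^sub>R X"
  have S: "S (x + c *\<^sub>R K x) = x" for x
    using arg_cong[OF X1[of x], of "\<lambda>v. c *\<^sub>R v"]
    by (simp add: S_def blinfun.diff_left blinfun.add_right blinfun.scaleR_left blinfun.scaleR_right
        scaleR_add_right algebra_simps)
  \<comment> \<open>The margin 1 over the norm of the limit holds near the boundary and is the
    reason for the summand 1 in the smallness assumption.\<close>
  have ev: "\<forall>\<^sub>F y in at_right 0. Complex lam (\<sigma> * y) \<notin> \<real> \<and> norm (Y y) < norm B + 1"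
    using nonreal_boundary_path[OF \<sigma>] order_tendstoD(2)[OF tendsto_norm[OF Y], of "norm B + 1"]
    by (intro eventually_conj) auto
  have T_eq: "T y = S o\<^sub>L (Y y + c *\<^sub>R ((B - Y y) o\<^sub>L (J o\<^sub>L T y)))"
    and T_le: "norm (T y) \<le> 2 * (norm B + 1)"
    if y: "Complex lam (\<sigma> * y) \<notin> \<real>" "norm (Y y) < norm B + 1" for y
  proof -
    have "T y + c *\<^sub>R (T y o\<^sub>L J o\<^sub>L Y y) = Y y"
      using second_resolvent_identity[OF y(1), of s r] by (simp add: T_def Y_def c_def)
    then have "T y = Y y - c *\<^sub>R (T y o\<^sub>L J o\<^sub>L Y y)" by (simp add: eq_diff_eq)
    then have "norm (T y) \<le> norm (Y y) + norm (c *\<^sub>R (T y o\<^sub>L J o\<^sub>L Y y))"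
      using norm_triangle_ineq4 by metis
    also have "norm (c *\<^sub>R (T y o\<^sub>L J o\<^sub>L Y y)) \<le> \<bar>c\<bar> * (norm (T y) * norm J * norm (Y y))"
      unfolding norm_scaleR
      by (intro mult_left_mono order_trans[OF norm_blinfun_compose] mult_right_mono norm_blinfun_compose) auto
    also have "\<dots> \<le> \<bar>c\<bar> * (norm (T y) * norm J * (norm B + 1))"
      using y(2) by (intro mult_left_mono) auto
    also have "\<dots> = norm (T y) * (\<bar>c\<bar> * (norm J * (norm B + 1)))" by (simp add: mult_ac)
    also have "\<dots> \<le> norm (T y) * (1 / 2)" by (rule mult_left_mono[OF small]) simp
    finally show "norm (T y) \<le> 2 * (norm B + 1)" using y(2) by simp
    have "Y y x + (r - s) *\<^sub>R Y y (J (T y x)) = T y x" for x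
      using arg_cong[OF second_resolvent_identity[OF y(1), of r s], of "\<lambda>A. blinfun_apply A x"]
      by (simp add: T_def Y_def blinfun.add_left blinfun.scaleR_left)
    then have eq: "Y y x = T y x + c *\<^sub>R Y y (J (T y x))" for x
      by (simp add: c_def algebra_simps)
    show "T y = S o\<^sub>L (Y y + c *\<^sub>R ((B - Y y) o\<^sub>L (J o\<^sub>L T y)))"
    proof (rule blinfun_eqI)
      fix x
      have "(Y y + c *\<^sub>R ((B - Y y) o\<^sub>L (J o\<^sub>L T y))) x = T y x + c *\<^sub>R K (T y x)"
        using eq[of x] by (simp add: blinfun.add_left blinfun.diff_left blinfun.scaleR_left K_def scaleR_diff_right)
      then show "T y x = (S o\<^sub>L (Y y + c *\<^sub>R ((B - Y y) o\<^sub>L (J o\<^sub>L T y)))) x"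
        by (simp only: blinfun_apply_blinfun_compose S)
    qed
  qed
  have "((\<lambda>y. (B - Y y) o\<^sub>L (J o\<^sub>L T y)) \<longlongrightarrow> 0) (at_right 0)"
  proof (rule Lim_null_comparison)
    have "norm ((B - Y y) o\<^sub>L (J o\<^sub>L T y)) \<le> norm (B - Y y) * (norm J * (2 * (norm B + 1)))"
      if y: "Complex lam (\<sigma> * y) \<notin> \<real>" "norm (Y y) < norm B + 1" for y
    proof -
      have "norm (J o\<^sub>L T y) \<le> norm J * norm (T y)" by (rule norm_blinfun_compose)
      also have "\<dots> \<le> norm J * (2 * (norm B + 1))" by (intro mult_left_mono T_le y) simp
      finally have "norm (B - Y y) * norm (J o\<^sub>L T y) \<le> norm (B - Y y) * (norm J * (2 * (norm B + 1)))"
        by (rule mult_left_mono) simp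
      then show ?thesis by (rule order_trans[OF norm_blinfun_compose])
    qed
    then show "\<forall>\<^sub>F y in at_right 0. norm ((B - Y y) o\<^sub>L (J o\<^sub>L T y)) \<le> norm (B - Y y) * (norm J * (2 * (norm B + 1)))"
      using ev by (auto elim: eventually_mono)
    have "((\<lambda>y. norm (B - Y y) * (norm J * (2 * (norm B + 1)))) \<longlongrightarrow> norm (B - B) * (norm J * (2 * (norm B + 1)))) (at_right 0)"
      by (intro tendsto_intros Y)
    then show "((\<lambda>y. norm (B - Y y) * (norm J * (2 * (norm B + 1)))) \<longlongrightarrow> 0) (at_right 0)"
      by (simp only: diff_self norm_zero mult_zero_left)
  qed
  then have "((\<lambda>y. S o\<^sub>L (Y y + c *\<^sub>R ((B - Y y) o\<^sub>L (J o\<^sub>L T y)))) \<longlongrightarrow> S o\<^sub>L (B + c *\<^sub>R 0)) (at_right 0)"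
    by (intro blinfun_compose.tendsto tendsto_const tendsto_add Y tendsto_scaleR)
  then have "(T \<longlongrightarrow> S o\<^sub>L (B + c *\<^sub>R 0)) (at_right 0)"
  proof (rule Lim_transform_eventually)
    show "\<forall>\<^sub>F y in at_right 0. S o\<^sub>L (Y y + c *\<^sub>R ((B - Y y) o\<^sub>L (J o\<^sub>L T y))) = T y"
      using ev by eventually_elim (rule T_eq[symmetric]; simp)
  qed
  then show ?thesis unfolding T_def by blast
qed

text \<open>Supplies the interval on which all meromorphic extensions must agree.\<close>

lemma nonresonant_nearby:
  assumes r: "r \<in> nonresonant_points F H0 V lam"
  shows "\<exists>\<delta>>0. \<forall>s. \<bar>s - r\<bar> < \<delta> \<longrightarrow> s \<in> nonresonant_points F H0 V lam"
proof -
  \<comment> \<open>One radius has to serve both signs; the final 1 keeps \<open>M\<close> positive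
    when \<open>J\<close> is zero.\<close>
  define M where "M = norm J * (norm (boundary lam r 1) + 1) + norm J * (norm (boundary lam r (- 1)) + 1) + 1"
  have pos: "0 \<le> norm J * (norm (boundary lam r \<sigma>) + 1)" for \<sigma> by simp
  have M: "M > 0" unfolding M_def using pos[of 1] pos[of "- 1"] by linarith
  have le: "norm J * (norm (boundary lam r \<sigma>) + 1) \<le> M" if "\<sigma> \<in> {1, -1}" for \<sigma>
  proof -
    have "\<sigma> = 1 \<or> \<sigma> = - 1" using that by simp
    then show ?thesis
    proof
      assume "\<sigma> = 1"
      then show ?thesis using pos[of "- 1"] unfolding M_def \<open>\<sigma> = 1\<close> by linarith
    next
      assume "\<sigma> = - 1"
      then show ?thesis using pos[of 1] unfolding M_def \<open>\<sigma> = - 1\<close> by linarith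
    qed
  qed
  have "s \<in> nonresonant_points F H0 V lam" if s: "\<bar>s - r\<bar> < 1 / (2 * M)" for s
  proof -
    have "\<bar>s - r\<bar> * (norm J * (norm (boundary lam r \<sigma>) + 1)) \<le> 1 / 2" if "\<sigma> \<in> {1, -1}" for \<sigma>
    proof -
      have "\<bar>s - r\<bar> * (norm J * (norm (boundary lam r \<sigma>) + 1)) \<le> 1 / (2 * M) * M"
        using s M pos le[OF that] by (intro mult_mono) auto
      then show ?thesis using M by simp
    qed
    then show ?thesis
      using sandwiched_converges_nearby[OF r] unfolding nonresonant_points_def regular_points_def by blast
  qed
  then show ?thesis using M by (intro exI[of _ "1 / (2 * M)"]) simp
qed

section \<open>Identification of the idempotents\<close>

lemma idempotents_are_riesz_projections:
  assumes r0: "r0 \<in> nonresonant_points F H0 V lam" and r: "r \<noteq> r0" and \<sigma>: "\<sigma> \<in> {1, -1}"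
  shows "\<exists>n W. riesz_projection
      (id_blinfun + complex_of_real (r - r0) *\<^sub>C (boundary lam r0 \<sigma> o\<^sub>L J)) n W (P_idem F J H0 V lam \<sigma> r)"
    and "\<exists>n W. riesz_projection
      (id_blinfun + complex_of_real (r - r0) *\<^sub>C (J o\<^sub>L boundary lam r0 \<sigma>)) n W (Q_idem F J H0 V lam \<sigma> r)"
proof -
  let ?R = "nonresonant_points F H0 V lam"
  obtain \<delta> where \<delta>: "\<delta> > 0" "\<And>s. \<bar>s - r0\<bar> < \<delta> \<Longrightarrow> s \<in> ?R"
    using nonresonant_nearby[OF r0] by blast
  have A: "clinear_op (boundary lam r0 \<sigma> o\<^sub>L J)" "seq_compact_op (boundary lam r0 \<sigma> o\<^sub>L J)"
    and B: "clinear_op (J o\<^sub>L boundary lam r0 \<sigma>)" "seq_compact_op (J o\<^sub>L boundary lam r0 \<sigma>)"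
    by (intro clinear_op_compose seq_compact_op_compose_left seq_compact_op_compose_right
        boundary_compact r0 \<sigma> J_linear)+
  have eq1: "boundary lam s \<sigma> x + (s - r0) *\<^sub>R boundary lam s \<sigma> (J (boundary lam r0 \<sigma> x)) = boundary lam r0 \<sigma> x"
    and eq2: "boundary lam s \<sigma> x + (s - r0) *\<^sub>R boundary lam r0 \<sigma> (J (boundary lam s \<sigma> x)) = boundary lam r0 \<sigma> x"
    if "s \<in> ?R" for s x
  proof -
    show "boundary lam s \<sigma> x + (s - r0) *\<^sub>R boundary lam s \<sigma> (J (boundary lam r0 \<sigma> x)) = boundary lam r0 \<sigma> x"
      using arg_cong[OF boundary_second_resolvent_identity[OF r0 that \<sigma>], of "\<lambda>A. blinfun_apply A x"]
      by (simp add: blinfun.add_left blinfun.scaleR_left)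
    \<comment> \<open>Exchanging the roles of \<open>r0\<close> and s in the resolvent identity
      gives the product in the other order, the second half of the resolvent family.\<close>
    have "boundary lam r0 \<sigma> x + (r0 - s) *\<^sub>R boundary lam r0 \<sigma> (J (boundary lam s \<sigma> x)) = boundary lam s \<sigma> x"
      using arg_cong[OF boundary_second_resolvent_identity[OF that r0 \<sigma>], of "\<lambda>A. blinfun_apply A x"]
      by (simp add: blinfun.add_left blinfun.scaleR_left)
    then show "boundary lam s \<sigma> x + (s - r0) *\<^sub>R boundary lam r0 \<sigma> (J (boundary lam s \<sigma> x)) = boundary lam r0 \<sigma> x"
      by (simp add: algebra_simps)
  qed
  have famA: "is_resolvent_family (boundary lam r0 \<sigma> o\<^sub>L J) (complex_of_real (s - r0)) (boundary lam s \<sigma> o\<^sub>L J)"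
    and famB: "is_resolvent_family (J o\<^sub>L boundary lam r0 \<sigma>) (complex_of_real (s - r0)) (J o\<^sub>L boundary lam s \<sigma>)"
    if s: "s \<in> ?R" for s
  proof -
    show "is_resolvent_family (boundary lam r0 \<sigma> o\<^sub>L J) (complex_of_real (s - r0)) (boundary lam s \<sigma> o\<^sub>L J)"
      unfolding is_resolvent_family_def
      by (intro conjI clinear_op_compose boundary_compact s \<sigma> J_linear)
        (simp_all only: blinfun_apply_blinfun_compose scaleC_of_real eq1[OF s] eq2[OF s] simp_thms)
    have "J (boundary lam s \<sigma> x) + (s - r0) *\<^sub>R J (boundary lam s \<sigma> (J (boundary lam r0 \<sigma> x))) = J (boundary lam r0 \<sigma> x)"
      "J (boundary lam s \<sigma> x) + (s - r0) *\<^sub>R J (boundary lam r0 \<sigma> (J (boundary lam s \<sigma> x))) = J (boundary lam r0 \<sigma> x)" for x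
      using arg_cong[OF eq1[OF s, of x], of J] arg_cong[OF eq2[OF s, of x], of J]
      by (simp_all add: blinfun.add_right blinfun.scaleR_right)
    then show "is_resolvent_family (J o\<^sub>L boundary lam r0 \<sigma>) (complex_of_real (s - r0)) (J o\<^sub>L boundary lam s \<sigma>)"
      unfolding is_resolvent_family_def
      by (intro conjI clinear_op_compose boundary_compact s \<sigma> J_linear)
        (simp_all only: blinfun_apply_blinfun_compose scaleC_of_real simp_thms)
  qed
  obtain n W P where P: "riesz_projection (id_blinfun + complex_of_real (r - r0) *\<^sub>C (boundary lam r0 \<sigma> o\<^sub>L J)) n W P"
    using seq_compact_op_riesz_projection[OF A(2)] by blast
  have "P_idem F J H0 V lam \<sigma> r = P"
    unfolding P_idem_def A_fun_def
    by (rule meromorphic_residue_eq_riesz_projection[OF A \<delta> famA r P])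
  then show "\<exists>n W. riesz_projection
      (id_blinfun + complex_of_real (r - r0) *\<^sub>C (boundary lam r0 \<sigma> o\<^sub>L J)) n W (P_idem F J H0 V lam \<sigma> r)"
    using P by blast
  obtain n W Q where Q: "riesz_projection (id_blinfun + complex_of_real (r - r0) *\<^sub>C (J o\<^sub>L boundary lam r0 \<sigma>)) n W Q"
    using seq_compact_op_riesz_projection[OF B(2)] by blast
  have "Q_idem F J H0 V lam \<sigma> r = Q"
    unfolding Q_idem_def B_fun_def
    by (rule meromorphic_residue_eq_riesz_projection[OF B \<delta> famB r Q])
  then show "\<exists>n W. riesz_projection
      (id_blinfun + complex_of_real (r - r0) *\<^sub>C (J o\<^sub>L boundary lam r0 \<sigma>)) n W (Q_idem F J H0 V lam \<sigma> r)"
    using Q by blast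
qed

end

theorem proposition1p40:
  fixes F :: "('h::separable_complex_hilbert, 'k::separable_complex_hilbert) op_graph"
    and J :: "'k \<Rightarrow>\<^sub>L 'k"
    and H0 V :: "('h, 'h) op_graph"
    and \<D> :: "'h set"
    and lam r_lam :: real
  assumes "rigged_line F J H0 V \<D>"
    and "essentially_regular F H0 V lam"
    and "r_lam \<in> resonance_points F H0 V lam"
  shows
    "let Pp = P_idem F J H0 V lam 1 r_lam; Pm = P_idem F J H0 V lam (- 1) r_lam;
         Qp = Q_idem F J H0 V lam 1 r_lam; Qm = Q_idem F J H0 V lam (- 1) r_lam
     in
       (property_S F J H0 V lam r_lam \<longleftrightarrow> Pp o\<^sub>L Pm = Pp \<and> Pm o\<^sub>L Pp = Pm) \<and>
       (property_S F J H0 V lam r_lam \<longleftrightarrow> range (blinfun_apply Qp) = range (blinfun_apply Qm)) \<and>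
       (property_S F J H0 V lam r_lam \<longleftrightarrow> Qp o\<^sub>L Qm = Qm \<and> Qm o\<^sub>L Qp = Qp) \<and>
       (property_S F J H0 V lam r_lam \<longleftrightarrow> Qm o\<^sub>L J o\<^sub>L Pp = J o\<^sub>L Pp) \<and>
       (property_S F J H0 V lam r_lam \<longleftrightarrow> Qp o\<^sub>L J o\<^sub>L Pm = J o\<^sub>L Pm) \<and>
       (property_S F J H0 V lam r_lam \<longleftrightarrow> Qm o\<^sub>L J o\<^sub>L Pp = Qm o\<^sub>L J) \<and>
       (property_S F J H0 V lam r_lam \<longleftrightarrow> Qp o\<^sub>L J o\<^sub>L Pm = Qp o\<^sub>L J) \<and>
       (property_S F J H0 V lam r_lam \<longleftrightarrow> Qm o\<^sub>L J o\<^sub>L Pp = Qp o\<^sub>L J o\<^sub>L Pm)"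
proof -
  interpret rigged_line F J H0 V \<D> by (rule assms(1))
  obtain r0 where "lam \<in> regular_points F (op_line H0 V r0)"
    using assms(2) unfolding essentially_regular_def by blast
  then have r0: "r0 \<in> nonresonant_points F H0 V lam" by (simp add: nonresonant_points_def)
  then have r: "r_lam \<noteq> r0" using assms(3) by (auto simp: resonance_points_def)
  define t where "t = r_lam - r0"
  have t: "t \<noteq> 0" using r by (simp add: t_def)
  define Tp where "Tp = boundary lam r0 1"
  define Tm where "Tm = boundary lam r0 (- 1)"
  define Pp where "Pp = P_idem F J H0 V lam 1 r_lam"
  define Pm where "Pm = P_idem F J H0 V lam (- 1) r_lam"
  define Qp where "Qp = Q_idem F J H0 V lam 1 r_lam"
  define Qm where "Qm = Q_idem F J H0 V lam (- 1) r_lam"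
  have adj: "adjoint_pair Tp Tm" unfolding Tp_def Tm_def by (rule adjoint_pair_boundary[OF r0])
  note adj' = adjoint_pair_sym[OF adj]
  have posp: "0 \<le> 1 * Im (cinner f (Tp f))" and posm: "0 \<le> - 1 * Im (cinner f (Tm f))" for f
    unfolding Tp_def Tm_def by (rule boundary_semidefinite[OF r0]; simp)+
  obtain np Wp where Pp: "riesz_projection (id_blinfun + complex_of_real t *\<^sub>C (Tp o\<^sub>L J)) np Wp Pp"
    using idempotents_are_riesz_projections(1)[OF r0 r, of 1] unfolding t_def Tp_def Pp_def by blast
  obtain nm Wm where Pm: "riesz_projection (id_blinfun + complex_of_real t *\<^sub>C (Tm o\<^sub>L J)) nm Wm Pm"
    using idempotents_are_riesz_projections(1)[OF r0 r, of "- 1"] unfolding t_def Tm_def Pm_def by blast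
  obtain mp Vp where Qp: "riesz_projection (id_blinfun + complex_of_real t *\<^sub>C (J o\<^sub>L Tp)) mp Vp Qp"
    using idempotents_are_riesz_projections(2)[OF r0 r, of 1] unfolding t_def Tp_def Qp_def by blast
  obtain mm Vm where Qm: "riesz_projection (id_blinfun + complex_of_real t *\<^sub>C (J o\<^sub>L Tm)) mm Vm Qm"
    using idempotents_are_riesz_projections(2)[OF r0 r, of "- 1"] unfolding t_def Tm_def Qm_def by blast
  have idem: "Pp (Pp x) = Pp x" "Pm (Pm x) = Pm x" "Qp (Qp x) = Qp x" "Qm (Qm x) = Qm x" for x
    using Pp Pm Qp Qm by (simp_all add: riesz_projection_def)
  have adjP: "adjoint_pair Pp Qm" "adjoint_pair Pm Qp"
    by (rule adjoint_pair_riesz_projection[OF Pp Qm] adjoint_pair_riesz_projection[OF Pm Qp];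
        intro adjoint_pair_id_plus_scaleC adjoint_pair_compose adj adj' J_adjoint)+
  have JU: "J ((id_blinfun + complex_of_real t *\<^sub>C (T o\<^sub>L J)) x) =
      (id_blinfun + complex_of_real t *\<^sub>C (J o\<^sub>L T)) (J x)" for T x
    by (simp add: blinfun.add_left blinfun.add_right clinear_opD[OF J_linear])
  have JP: "J (Pp x) = Qp (J x)" "J (Pm x) = Qm (J x)" for x
    by (rule riesz_projection_intertwine(1)[OF Pp Qp JU] riesz_projection_intertwine(1)[OF Pm Qm JU])+
  \<comment> \<open>The primed data belong to the opposite boundary point, and \<kappa> is the sign
    of the half-plane: 1 here, -1 in the companion statement.\<close>
  have ker: "Pp x = 0" if "Qm (J (Pp x)) = 0" for x
    by (rule sandwiched_idempotent_kernel[OF adj J_adjoint posp _ t Pp Pm Qm that]) simp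
  have ker': "Pm x = 0" if "Qp (J (Pm x)) = 0" for x
    by (rule sandwiched_idempotent_kernel[OF adj' J_adjoint posm _ t Pm Pp Qp that]) simp
  have S: "property_S F J H0 V lam r_lam \<longleftrightarrow> {x. Pp x = 0} = {x. Pm x = 0}"
    by (simp add: property_S_def Pp_def Pm_def)
  show ?thesis
    unfolding Let_def Pp_def[symmetric] Pm_def[symmetric] Qp_def[symmetric] Qm_def[symmetric]
    by (intro conjI property_S_equivalences[OF idem adjP J_adjoint JP ker ker' S])
qed

end
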